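(* Let $\mathscr{A}$ be a unital Banach $^*$-algebra with unit $1$, let $f,g$ be positive (hence representable) functionals on $\mathscr{A}$, and let $A,B\in\mathscr{B}(\mathscr{A};\bar{\mathscr{A}}')$ be the associated positive operators $\langle Aa,b\rangle:=f(b^*a)$, $\langle Ba,b\rangle:=g(b^*a)$, $a,b\in\mathscr{A}$. Then $f:g=\overline{(A:B)1}$, that is, $$(f:g)(a)=\overline{\langle(A:B)1,a\rangle},\qquad a\in\mathscr{A}.$$
   Context: Inner products are linear in the first variable. Functionals. A linear functional $f$ on $\mathscr{A}$ is positive if $f(a^*a)\ge0$ for all $a$, and representable if $f(a)=(\pi(a)\zeta\mid\zeta)$, $a\in\mathscr A$, for some $^*$-representation $\pi$ of $\mathscr{A}$ by bounded operators on a Hilbert space and some vector $\zeta$. For representable positive $f,g$ let $(H_f,\pi_f,\zeta_f)$, $(H_g,\pi_g,\zeta_g)$ be the GNS-triples ($\pi_f$ a $^*$-representation on the Hilbert space $H_f$ with cyclic vector $\zeta_f$ and $f(a)=(\pi_f(a)\zeta_f\mid\zeta_f)_f$; similarly for $g$). The parallel sum $f:g$ is the representable positive functional $(f:g)(a):=((\pi_f\oplus\pi_g)(a)Q(\zeta_f\oplus0)\mid Q(\zeta_f\oplus0))$, where $Q$ is the orthogonal projection of $H_f\oplus H_g$ onto the orthogonal complement of $\{\pi_f(a)\zeta_f\oplus\pi_g(a)\zeta_g:a\in\mathscr{A}\}$; it satisfies $(f:g)(a^*a)=\inf\{f((a-b)^*(a-b))+g(b^*b):b\in\mathscr{A}\}$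 for all $a\in\mathscr A$. Operators. For a complex Banach space $E$ (here $E=\mathscr{A}$), $\bar E'$ is the Banach space of continuous conjugate-linear functionals on $E$, $\langle\varphi,x\rangle:=\varphi(x)$, and $\mathscr{B}(E;\bar E')$ is the space of bounded linear operators $E\to\bar E'$. $A\in\mathscr{B}(E;\bar E')$ is positive if $\langle Ax,x\rangle\ge0$ for all $x\in E$. For positive $A$, $H_A$ is the Hilbert space completion of $\operatorname{ran}A$ under $(Ax\mid Ay)_A:=\langle Ax,y\rangle$; similarly $H_B$. $\bar E''$ is the antidual of $\bar E'$ and $j_E:E\to\bar E''$ is given by $j_E(x)(\varphi):=\overline{\varphi(x)}$. The bounded operators $J,\widetilde J_A:H_A\times H_B\to\bar E'$ are the continuous extensions of $J(Ax,By):=Ax+By$ and $\widetilde J_A(Ax,By):=Ax$. For bounded $S:K\to\bar E'$ with $K$ a Hilbert space, $S^*:\bar E''\to K$ is defined by $(S^*\Phi\mid\xi)_K=\Phi(S\xi)$; then $(J^*\circ j_E)(x)=(Ax,Bx)$ and $(\widetilde J_A^*\circ j_E)(x)=(Ax,0)$. With $P$ the orthogonal projection of $H_A\times H_B$ onto $\{\operatorname{ran}(J^*\circ j_E)\}^\perp$, the parallel sum of $A$ and $B$ is the positive operator $A:B:=\widetilde J_AP\widetilde J_A^*\circ j_E\in\mathscr{B}(E;\bar E')$; it satisfies $\langle(A:B)x,x\rangle=\inf\{\langle A(x-y),x-y\rangle+\langle By,y\rangle:y\in E\}$. For $\varphi\in\bar{\mathscr{A}}'$, $\overline{\varphi}$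 denotes the linear functional $a\mapsto\overline{\langle\varphi,a\rangle}$. *)

theory Defs
  imports "HOL-Analysis.Analysis" "HOL-Library.Complex_Order"
begin

section \<open>Complex vector spaces and Banach *-algebras\<close>

class complex_vector = ab_group_add +
  fixes scaleC :: "complex \<Rightarrow> 'a \<Rightarrow> 'a"  (infixr \<open>*\<^sub>C\<close> 75)
  assumes scaleC_add_right: "c *\<^sub>C (x + y) = c *\<^sub>C x + c *\<^sub>C y"
    and scaleC_add_left: "(c + d) *\<^sub>C x = c *\<^sub>C x + d *\<^sub>C x"
    and scaleC_scaleC: "c *\<^sub>C d *\<^sub>C x = (c * d) *\<^sub>C x"
    and scaleC_one: "1 *\<^sub>C x = x"

class complex_normed_vector = complex_vector + real_normed_vector +
  assumes scaleR_eq_scaleC: "r *\<^sub>R x = complex_of_real r *\<^sub>C x"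
    and norm_scaleC: "norm (c *\<^sub>C x) = cmod c * norm x"

text \<open>No relation between norm and involution is required: the involution need be neither
  isometric nor continuous. Likewise the norm of the unit is not required to be \<open>1\<close>.\<close>

class unital_banach_star_algebra =
  complex_normed_vector + real_algebra_1 + real_normed_algebra + banach +
  fixes star :: "'a \<Rightarrow> 'a"
  assumes mult_scaleC_left: "(c *\<^sub>C a) * b = c *\<^sub>C (a * b)"
    and mult_scaleC_right: "a * (c *\<^sub>C b) = c *\<^sub>C (a * b)"
    and star_star: "star (star a) = a"
    and star_add: "star (a + b) = star a + star b"
    and star_scaleC: "star (c *\<^sub>C a) = cnj c *\<^sub>C star a"
    and star_mult: "star (a * b) = star b * star a"

instantiation prod :: (complex_vector, complex_vector) complex_vector
begin

definition "c *\<^sub>C z = (c *\<^sub>C fst z, c *\<^sub>C snd z)"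

instance
  by standard
    (simp_all add: scaleC_prod_def scaleC_add_right scaleC_add_left scaleC_scaleC scaleC_one)

end


section \<open>The antidual\<close>

text \<open>\<open>'e antidual\<close> is the space of continuous conjugate-linear functionals; real-linear
  boundedness plus the condition on complex scalars says exactly this. As the construction
  yields a complex normed space again, the second antidual is \<open>'e antidual antidual\<close>.\<close>

typedef (overloaded) 'e antidual =
  "{\<phi> :: 'e::complex_normed_vector \<Rightarrow> complex.
      bounded_linear \<phi> \<and> (\<forall>c x. \<phi> (c *\<^sub>C x) = cnj c * \<phi> x)}"
  morphisms antidual_apply Antidual
  by (intro exI[of _ "\<lambda>_. 0"]) (simp add: bounded_linear_zero)

setup_lifting type_definition_antidual

notation antidual_apply (\<open>\<langle>_,/ _\<rangle>\<close>)

lemma antidual_eqI: "(\<And>x. \<langle>\<phi>, x\<rangle> = \<langle>\<psi>, x\<rangle>) \<Longrightarrow> \<phi> = \<psi>"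
  by transfer auto

lemma bounded_linear_antidual_apply: "bounded_linear (antidual_apply \<phi>)"
  by transfer simp

instantiation antidual :: (complex_normed_vector) complex_normed_vector
begin

lift_definition norm_antidual :: "'a antidual \<Rightarrow> real" is onorm .

lift_definition zero_antidual :: "'a antidual" is "\<lambda>_. 0"
  by (simp add: bounded_linear_zero)

lift_definition plus_antidual :: "'a antidual \<Rightarrow> 'a antidual \<Rightarrow> 'a antidual"
  is "\<lambda>\<phi> \<psi> x. \<phi> x + \<psi> x"
  by (simp add: bounded_linear_add algebra_simps)

lift_definition minus_antidual :: "'a antidual \<Rightarrow> 'a antidual \<Rightarrow> 'a antidual"
  is "\<lambda>\<phi> \<psi> x. \<phi> x - \<psi> x"
  by (simp add: bounded_linear_sub algebra_simps)

lift_definition uminus_antidual :: "'a antidual \<Rightarrow> 'a antidual" is "\<lambda>\<phi> x. - \<phi> x"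
  by (simp add: bounded_linear_minus)

lift_definition scaleC_antidual :: "complex \<Rightarrow> 'a antidual \<Rightarrow> 'a antidual"
  is "\<lambda>c \<phi> x. c * \<phi> x"
  by (simp add: bounded_linear_const_mult)

definition scaleR_antidual :: "real \<Rightarrow> 'a antidual \<Rightarrow> 'a antidual"
  where "scaleR_antidual r \<phi> = complex_of_real r *\<^sub>C \<phi>"

definition dist_antidual :: "'a antidual \<Rightarrow> 'a antidual \<Rightarrow> real"
  where "dist_antidual \<phi> \<psi> = norm (\<phi> - \<psi>)"

definition sgn_antidual :: "'a antidual \<Rightarrow> 'a antidual"
  where "sgn_antidual \<phi> = inverse (norm \<phi>) *\<^sub>R \<phi>"

definition uniformity_antidual :: "('a antidual \<times> 'a antidual) filter"
  where "uniformity_antidual = (INF e\<in>{0 <..}. principal {(\<phi>, \<psi>). dist \<phi> \<psi> < e})"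

definition open_antidual :: "'a antidual set \<Rightarrow> bool"
  where "open_antidual U \<longleftrightarrow> (\<forall>\<phi>\<in>U. \<forall>\<^sub>F (\<phi>', \<psi>) in uniformity. \<phi>' = \<phi> \<longrightarrow> \<psi> \<in> U)"

instance
proof
  fix \<phi> \<psi> \<theta> :: "'a antidual" and c d :: complex and r s :: real
  show "\<phi> + \<psi> + \<theta> = \<phi> + (\<psi> + \<theta>)" "\<phi> + \<psi> = \<psi> + \<phi>" "0 + \<phi> = \<phi>"
    "- \<phi> + \<phi> = 0" "\<phi> - \<psi> = \<phi> + - \<psi>"
    by (simp_all add: antidual_eqI plus_antidual.rep_eq minus_antidual.rep_eq
      uminus_antidual.rep_eq zero_antidual.rep_eq)
  show c1: "c *\<^sub>C (\<phi> + \<psi>) = c *\<^sub>C \<phi> + c *\<^sub>C \<psi>" for c :: complex and \<phi> \<psi> :: "'a antidual"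
    by (transfer, simp add: algebra_simps)
  show c2: "(c + d) *\<^sub>C \<phi> = c *\<^sub>C \<phi> + d *\<^sub>C \<phi>" for c d :: complex and \<phi> :: "'a antidual"
    by (transfer, simp add: algebra_simps)
  show c3: "c *\<^sub>C d *\<^sub>C \<phi> = (c * d) *\<^sub>C \<phi>" for c d :: complex and \<phi> :: "'a antidual"
    by (transfer, simp add: algebra_simps)
  show c4: "1 *\<^sub>C \<phi> = \<phi>" for \<phi> :: "'a antidual"
    by (transfer, simp)
  show "r *\<^sub>R (\<phi> + \<psi>) = r *\<^sub>R \<phi> + r *\<^sub>R \<psi>" "(r + s) *\<^sub>R \<phi> = r *\<^sub>R \<phi> + s *\<^sub>R \<phi>"
    "r *\<^sub>R s *\<^sub>R \<phi> = (r * s) *\<^sub>R \<phi>" "1 *\<^sub>R \<phi> = \<phi>"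
    by (simp_all add: scaleR_antidual_def c1 c2 c3 c4)
  show "r *\<^sub>R \<phi> = complex_of_real r *\<^sub>C \<phi>"
    by (fact scaleR_antidual_def)
  show "dist \<phi> \<psi> = norm (\<phi> - \<psi>)"
    by (fact dist_antidual_def)
  show "sgn \<phi> = inverse (norm \<phi>) *\<^sub>R \<phi>"
    by (fact sgn_antidual_def)
  show "uniformity = (INF e\<in>{0 <..}. principal {(\<phi>, \<psi>). dist \<phi> (\<psi> :: 'a antidual) < e})"
    by (fact uniformity_antidual_def)
  show "open U \<longleftrightarrow> (\<forall>\<phi>\<in>U. \<forall>\<^sub>F (\<phi>', \<psi>) in uniformity. \<phi>' = \<phi> \<longrightarrow> \<psi> \<in> U)"
    for U :: "'a antidual set"
    by (fact open_antidual_def)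
  show "norm \<phi> = 0 \<longleftrightarrow> \<phi> = 0"
    by transfer (simp add: onorm_eq_0 fun_eq_iff)
  show "norm (\<phi> + \<psi>) \<le> norm \<phi> + norm \<psi>"
    by transfer (simp add: onorm_triangle)
  show n: "norm (c *\<^sub>C \<phi>) = cmod c * norm \<phi>" for c and \<phi> :: "'a antidual"
  proof transfer
    fix c :: complex and \<phi> :: "'a \<Rightarrow> complex"
    assume "bounded_linear \<phi> \<and> (\<forall>c x. \<phi> (c *\<^sub>C x) = cnj c * \<phi> x)"
    then have b: "bounded_linear \<phi>" by simp
    have le: "onorm (\<lambda>x. d * \<psi> x) \<le> cmod d * onorm \<psi>"
      if "bounded_linear \<psi>" for d :: complex and \<psi> :: "'a \<Rightarrow> complex"
    proof (rule onorm_bound)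
      show "0 \<le> cmod d * onorm \<psi>"
        by (simp add: onorm_pos_le that)
      show "norm (d * \<psi> x) \<le> cmod d * onorm \<psi> * norm x" for x
        using mult_left_mono[OF onorm[OF that, of x] norm_ge_zero[of d]]
        by (simp add: norm_mult mult.assoc)
    qed
    show "onorm (\<lambda>x. c * \<phi> x) = cmod c * onorm \<phi>"
    proof (cases "c = 0")
      case True
      then show ?thesis by (simp add: onorm_zero)
    next
      case False
      have "onorm \<phi> \<le> cmod (inverse c) * onorm (\<lambda>x. c * \<phi> x)"
        using le[OF bounded_linear_const_mult[OF b], of "inverse c" c] False
        by (simp add: mult.assoc[symmetric])
      then have "cmod c * onorm \<phi> \<le> onorm (\<lambda>x. c * \<phi> x)"
        using False by (simp add: norm_inverse norm_divide field_simps)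
      then show ?thesis using le[OF b, of c] by simp
    qed
  qed
  show "norm (r *\<^sub>R \<phi>) = \<bar>r\<bar> * norm \<phi>"
    by (simp add: scaleR_antidual_def n)
qed

end

lemma antidual_apply_le: "cmod \<langle>\<phi>, x\<rangle> \<le> norm \<phi> * norm x"
  by transfer (auto intro: onorm)

lift_definition j_E :: "'e::complex_normed_vector \<Rightarrow> 'e antidual antidual"
  is "\<lambda>x \<phi>. cnj \<langle>\<phi>, x\<rangle>"
proof -
  fix x :: 'e
  have "bounded_linear (\<lambda>\<phi>. cnj \<langle>\<phi>, x\<rangle>)"
  proof (rule bounded_linear_intro[where K = "norm x"])
    show "cnj \<langle>\<phi> + \<psi>, x\<rangle> = cnj \<langle>\<phi>, x\<rangle> + cnj \<langle>\<psi>, x\<rangle>" for \<phi> \<psi>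
      by (simp add: plus_antidual.rep_eq)
    show "cnj \<langle>r *\<^sub>R \<phi>, x\<rangle> = r *\<^sub>R cnj \<langle>\<phi>, x\<rangle>" for r \<phi>
      by (simp add: scaleR_antidual_def scaleC_antidual.rep_eq scaleR_conv_of_real)
    show "norm (cnj \<langle>\<phi>, x\<rangle>) \<le> norm \<phi> * norm x" for \<phi>
      by (simp add: antidual_apply_le)
  qed
  then show "bounded_linear (\<lambda>\<phi>. cnj \<langle>\<phi>, x\<rangle>) \<and>
      (\<forall>c \<phi>. cnj \<langle>c *\<^sub>C \<phi>, x\<rangle> = cnj c * cnj \<langle>\<phi>, x\<rangle>)"
    by (simp add: scaleC_antidual.rep_eq)
qed


section \<open>Hilbert spaces\<close>

text \<open>A Hilbert space is a linear subspace of some complex vector space, with its own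
  inner product (linear in the first variable), complete in the induced metric.\<close>

record 'v inner_space =
  carrier :: "'v set"
  ip :: "'v \<Rightarrow> 'v \<Rightarrow> complex"

definition hnorm :: "('v, 'm) inner_space_scheme \<Rightarrow> 'v \<Rightarrow> real"
  where "hnorm H x = sqrt (Re (ip H x x))"

text \<open>The case distinction makes \<open>Metric_space (carrier H) (hdist H)\<close> hold whatever \<open>ip H\<close> is outside
  the carrier: that locale demands symmetry and nonnegativity on the whole type.\<close>

definition hdist :: "('v::complex_vector, 'm) inner_space_scheme \<Rightarrow> 'v \<Rightarrow> 'v \<Rightarrow> real"
  where "hdist H x y = (if x \<in> carrier H \<and> y \<in> carrier H then hnorm H (x - y) else 0)"

definition pre_hilbert_space :: "('v::complex_vector, 'm) inner_space_scheme \<Rightarrow> bool"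
  where "pre_hilbert_space H \<longleftrightarrow>
    0 \<in> carrier H \<and>
    (\<forall>x\<in>carrier H. \<forall>y\<in>carrier H. x + y \<in> carrier H) \<and>
    (\<forall>c. \<forall>x\<in>carrier H. c *\<^sub>C x \<in> carrier H) \<and>
    (\<forall>x\<in>carrier H. \<forall>y\<in>carrier H. \<forall>z\<in>carrier H. ip H (x + y) z = ip H x z + ip H y z) \<and>
    (\<forall>c. \<forall>x\<in>carrier H. \<forall>y\<in>carrier H. ip H (c *\<^sub>C x) y = c * ip H x y) \<and>
    (\<forall>x\<in>carrier H. \<forall>y\<in>carrier H. ip H y x = cnj (ip H x y)) \<and>
    (\<forall>x\<in>carrier H. 0 \<le> ip H x x) \<and>
    (\<forall>x\<in>carrier H. ip H x x = 0 \<longrightarrow> x = 0)"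

definition hilbert_space :: "('v::complex_vector, 'm) inner_space_scheme \<Rightarrow> bool"
  where "hilbert_space H \<longleftrightarrow>
    pre_hilbert_space H \<and> Metric_space.mcomplete (carrier H) (hdist H)"

definition dense_in :: "('v::complex_vector, 'm) inner_space_scheme \<Rightarrow> 'v set \<Rightarrow> bool"
  where "dense_in H S \<longleftrightarrow>
    S \<subseteq> carrier H \<and>
    Metric_space.mtopology (carrier H) (hdist H) closure_of S = carrier H"

definition prod_space :: "'v inner_space \<Rightarrow> 'w inner_space \<Rightarrow> ('v \<times> 'w) inner_space"
  where "prod_space H K =
    \<lparr>carrier = carrier H \<times> carrier K,
     ip = (\<lambda>x y. ip H (fst x) (fst y) + ip K (snd x) (snd y))\<rparr>"

definition orth_compl :: "'v inner_space \<Rightarrow> 'v set \<Rightarrow> 'v set"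
  where "orth_compl H S = {x \<in> carrier H. \<forall>y\<in>S. ip H x y = 0}"

definition orth_proj :: "'v::complex_vector inner_space \<Rightarrow> 'v set \<Rightarrow> 'v \<Rightarrow> 'v"
  where "orth_proj H M x = (THE y. y \<in> M \<and> x - y \<in> orth_compl H M)"

definition clinear_on :: "'v::complex_vector set \<Rightarrow> ('v \<Rightarrow> 'w::complex_vector) \<Rightarrow> bool"
  where "clinear_on V T \<longleftrightarrow>
    (\<forall>x\<in>V. \<forall>y\<in>V. T (x + y) = T x + T y) \<and> (\<forall>c. \<forall>x\<in>V. T (c *\<^sub>C x) = c *\<^sub>C T x)"

definition bounded_endo :: "'v::complex_vector inner_space \<Rightarrow> ('v \<Rightarrow> 'v) \<Rightarrow> bool"
  where "bounded_endo H T \<longleftrightarrow>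
    T ` carrier H \<subseteq> carrier H \<and> clinear_on (carrier H) T \<and>
    (\<exists>C. \<forall>x\<in>carrier H. hnorm H (T x) \<le> C * hnorm H x)"

definition bounded_op ::
    "'v::complex_vector inner_space \<Rightarrow> ('v \<Rightarrow> 'w::complex_normed_vector) \<Rightarrow> bool"
  where "bounded_op H T \<longleftrightarrow>
    clinear_on (carrier H) T \<and> (\<exists>C. \<forall>x\<in>carrier H. norm (T x) \<le> C * hnorm H x)"


section \<open>Parallel sum of representable functionals\<close>

definition positive_functional :: "('a::unital_banach_star_algebra \<Rightarrow> complex) \<Rightarrow> bool"
  where "positive_functional f \<longleftrightarrow>
    (\<forall>a b. f (a + b) = f a + f b) \<and> (\<forall>c a. f (c *\<^sub>C a) = c * f a) \<and>
    (\<forall>a. 0 \<le> f (star a * a))"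

definition star_representation ::
    "'v::complex_vector inner_space \<Rightarrow> ('a::unital_banach_star_algebra \<Rightarrow> 'v \<Rightarrow> 'v) \<Rightarrow> bool"
  where "star_representation H \<pi> \<longleftrightarrow>
    (\<forall>a. bounded_endo H (\<pi> a)) \<and>
    (\<forall>a b. \<forall>x\<in>carrier H. \<pi> (a + b) x = \<pi> a x + \<pi> b x) \<and>
    (\<forall>c a. \<forall>x\<in>carrier H. \<pi> (c *\<^sub>C a) x = c *\<^sub>C \<pi> a x) \<and>
    (\<forall>a b. \<forall>x\<in>carrier H. \<pi> (a * b) x = \<pi> a (\<pi> b x)) \<and>
    (\<forall>a. \<forall>x\<in>carrier H. \<forall>y\<in>carrier H. ip H (\<pi> (star a) x) y = ip H x (\<pi> a y))"

definition is_gns_triple ::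
    "('a::unital_banach_star_algebra \<Rightarrow> complex) \<Rightarrow>
     'v::complex_vector inner_space \<times> ('a \<Rightarrow> 'v \<Rightarrow> 'v) \<times> 'v \<Rightarrow> bool"
  where "is_gns_triple f = (\<lambda>(H, \<pi>, \<zeta>).
    hilbert_space H \<and> star_representation H \<pi> \<and> \<zeta> \<in> carrier H \<and>
    dense_in H (range (\<lambda>a. \<pi> a \<zeta>)) \<and>
    (\<forall>a. f a = ip H (\<pi> a \<zeta>) \<zeta>))"

text \<open>The GNS-triple is determined up to unitary equivalence, so any one may be chosen. Looking
  for it inside \<open>'a antidual\<close> is no restriction: for every GNS-triple, \<open>\<xi> \<mapsto> (a \<mapsto> (\<xi> | \<pi>(a)\<zeta>))\<close> is
  an injective linear map from the Hilbert space to the antidual.\<close>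

definition gns_triple ::
    "('a::unital_banach_star_algebra \<Rightarrow> complex) \<Rightarrow>
     'a antidual inner_space \<times> ('a \<Rightarrow> 'a antidual \<Rightarrow> 'a antidual) \<times> 'a antidual"
  where "gns_triple f = (SOME t. is_gns_triple f t)"

definition functional_parallel_sum ::
    "('a::unital_banach_star_algebra \<Rightarrow> complex) \<Rightarrow> ('a \<Rightarrow> complex) \<Rightarrow> 'a \<Rightarrow> complex"
  where "functional_parallel_sum f g a =
    (let (H\<^sub>f, \<pi>\<^sub>f, \<zeta>\<^sub>f) = gns_triple f;
         (H\<^sub>g, \<pi>\<^sub>g, \<zeta>\<^sub>g) = gns_triple g;
         K = prod_space H\<^sub>f H\<^sub>g;
         \<pi> = (\<lambda>a \<xi>. (\<pi>\<^sub>f a (fst \<xi>), \<pi>\<^sub>g a (snd \<xi>)));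
         Q = orth_proj K (orth_compl K (range (\<lambda>b. (\<pi>\<^sub>f b \<zeta>\<^sub>f, \<pi>\<^sub>g b \<zeta>\<^sub>g))))
     in ip K (\<pi> a (Q (\<zeta>\<^sub>f, 0))) (Q (\<zeta>\<^sub>f, 0)))"


section \<open>Parallel sum of positive operators\<close>

text \<open>The completion of \<open>ran A\<close> is taken to contain \<open>ran A\<close> as a dense subspace. It can be
  realised in \<open>'e antidual\<close> because the continuous extension of the inclusion of \<open>ran A\<close>
  to the completion is injective.\<close>

definition is_range_completion ::
    "('e::complex_normed_vector \<Rightarrow> 'e antidual) \<Rightarrow> 'e antidual inner_space \<Rightarrow> bool"
  where "is_range_completion A H \<longleftrightarrow>
    hilbert_space H \<and> dense_in H (range A) \<and> (\<forall>x y. ip H (A x) (A y) = \<langle>A x, y\<rangle>)"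

definition range_completion ::
    "('e::complex_normed_vector \<Rightarrow> 'e antidual) \<Rightarrow> 'e antidual inner_space"
  where "range_completion A = (SOME H. is_range_completion A H)"

definition sum_space ::
    "('e::complex_normed_vector \<Rightarrow> 'e antidual) \<Rightarrow> ('e \<Rightarrow> 'e antidual) \<Rightarrow>
     ('e antidual \<times> 'e antidual) inner_space"
  where "sum_space A B = prod_space (range_completion A) (range_completion B)"

text \<open>In the next two definitions the values outside the carrier are immaterial; on the carrier
  the continuous extension is unique.\<close>

definition J_op ::
    "('e::complex_normed_vector \<Rightarrow> 'e antidual) \<Rightarrow> ('e \<Rightarrow> 'e antidual) \<Rightarrow>
     'e antidual \<times> 'e antidual \<Rightarrow> 'e antidual"
  where "J_op A B =
    (SOME J. bounded_op (sum_space A B) J \<and> (\<forall>x y. J (A x, B y) = A x + B y))"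

definition J_tilde ::
    "('e::complex_normed_vector \<Rightarrow> 'e antidual) \<Rightarrow> ('e \<Rightarrow> 'e antidual) \<Rightarrow>
     'e antidual \<times> 'e antidual \<Rightarrow> 'e antidual"
  where "J_tilde A B =
    (SOME J. bounded_op (sum_space A B) J \<and> (\<forall>x y. J (A x, B y) = A x))"

definition op_adjoint ::
    "'v inner_space \<Rightarrow> ('v \<Rightarrow> 'e::complex_normed_vector antidual) \<Rightarrow> 'e antidual antidual \<Rightarrow> 'v"
  where "op_adjoint K S \<Phi> =
    (THE k. k \<in> carrier K \<and> (\<forall>\<xi>\<in>carrier K. ip K k \<xi> = \<langle>\<Phi>, S \<xi>\<rangle>))"

definition operator_parallel_sum ::
    "('e::complex_normed_vector \<Rightarrow> 'e antidual) \<Rightarrow> ('e \<Rightarrow> 'e antidual) \<Rightarrow> 'e \<Rightarrow> 'e antidual"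
  where "operator_parallel_sum A B =
    (let K = sum_space A B;
         P = orth_proj K (orth_compl K (range (op_adjoint K (J_op A B) \<circ> j_E)))
     in J_tilde A B \<circ> P \<circ> op_adjoint K (J_tilde A B) \<circ> j_E)"

definition assoc_operator ::
    "('a::unital_banach_star_algebra \<Rightarrow> complex) \<Rightarrow> 'a \<Rightarrow> 'a antidual"
  where "assoc_operator f a = (THE \<phi>. \<forall>b. \<langle>\<phi>, b\<rangle> = f (star b * a))"

end

theory Submission
  imports Defs
begin

text \<open>For a positive functional \<open>f\<close> with associated operator \<open>A\<close>, the map \<open>\<pi>\<^sub>f(a)\<zeta>\<^sub>f \<mapsto> Aa\<close> is isometric,
  because both Gram matrices are \<open>f(b\<^sup>*a)\<close>. Hence \<open>Q(\<zeta>\<^sub>f \<oplus> 0)\<close> and \<open>P(A1, 0)\<close> have the same inner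
  products with \<open>\<pi>\<^sub>f(a)\<zeta>\<^sub>f \<oplus> 0\<close> and \<open>(Aa, 0)\<close>. Since the range of \<open>Q\<close> reduces \<open>\<pi>\<^sub>f \<oplus> \<pi>\<^sub>g\<close>, these
  inner products are \<open>(f:g)(a)\<close> and \<open>\<langle>(A:B)1, a\<rangle>\<close>, up to conjugation.

  It remains that the GNS-triples and \<open>H\<^sub>A\<close> exist, for which one needs \<open>f(b\<^sup>*a\<^sup>*ab) \<le> C\<^sub>a f(b\<^sup>*b)\<close> and
  \<open>f(a\<^sup>*a) \<le> C \<parallel>a\<parallel>\<^sup>2\<close>, although the involution need not be continuous. The first bound follows from
  Ford's square root lemma: \<open>1 - h\<close> has a hermitian square root if \<open>h\<close> is hermitian and of small norm.
  The second follows from the first one by a Baire category argument.\<close>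

section \<open>Hermitian square roots\<close>

text \<open>If \<open>star\<close> were continuous, hermitian square roots would be limits of series
  in \<open>h\<close>, and the hermitian parts of \<open>y\<close> would be bounded by a multiple of
  \<open>norm y\<close>. Without continuity, a root \<open>v\<close> found by iteration might differ
  from \<open>star v\<close>. What survives is algebraic: \<open>1 - c *\<^sub>C star v\<close> is
  invertible whenever \<open>1 - cnj c *\<^sub>C v\<close> is, and this controls the powers of
  \<open>star v\<close>. Likewise, Baire's theorem only yields series of hermitian elements of
  controlled norm that together converge to \<open>y\<close>. Their sums need not be hermitian, but
  the discrepancy with the true hermitian parts has seminorm tending to 0.

  GNS-triples and \<open>range_completion\<close> are arbitrary choices, so the comparison may use
  only their defining properties. The projections are therefore compared through a sequence in the
  algebra that realises both of them. One construction, the functionals in the antidual that are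
  approximable by \<open>range A\<close>, proves that both kinds of objects exist.\<close>

lemma scaleC_zero_left [simp]: "0 *\<^sub>C (x::'v::complex_vector) = 0"
  using scaleC_add_left[of 0 0 x] by simp

lemma scaleC_zero_right [simp]: "c *\<^sub>C (0::'v::complex_vector) = 0"
  using scaleC_add_right[of c 0 "0::'v"] by simp

lemma scaleC_minus_left: "(- c) *\<^sub>C (x::'v::complex_vector) = - (c *\<^sub>C x)"
  using scaleC_add_left[of c "-c" x] by (simp add: eq_neg_iff_add_eq_0 add.commute)

lemma scaleC_minus_right: "c *\<^sub>C (- x) = - (c *\<^sub>C (x::'v::complex_vector))"
  using scaleC_add_right[of c x "-x"] by (simp add: eq_neg_iff_add_eq_0 add.commute)

lemma scaleC_minus_one: "(- 1) *\<^sub>C x = - (x::'v::complex_vector)"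
  by (simp add: scaleC_minus_left scaleC_one)

lemma scaleC_diff_left: "(c - d) *\<^sub>C (x::'v::complex_vector) = c *\<^sub>C x - d *\<^sub>C x"
  using scaleC_add_left[of c "-d" x] by (simp add: scaleC_minus_left)

lemma scaleC_diff_right: "c *\<^sub>C (x - y) = c *\<^sub>C (x::'v::complex_vector) - c *\<^sub>C y"
  using scaleC_add_right[of c x "-y"] by (simp add: scaleC_minus_right)

lemma scaleC_sum_left: "(\<Sum>k\<in>K. c k) *\<^sub>C (x::'v::complex_vector) = (\<Sum>k\<in>K. c k *\<^sub>C x)"
  by (induction K rule: infinite_finite_induct) (simp_all add: scaleC_add_left)

lemma power_scaleC: "(c *\<^sub>C a) ^ n = c ^ n *\<^sub>C (a::'a::unital_banach_star_algebra) ^ n"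
  by (induction n) (simp_all add: scaleC_one mult_scaleC_left mult_scaleC_right scaleC_scaleC mult.commute)

lemma star_zero [simp]: "star (0::'a::unital_banach_star_algebra) = 0"
  using star_add[of 0 "0::'a"] by simp

lemma star_minus: "star (- a) = - star (a::'a::unital_banach_star_algebra)"
  using star_add[of a "- a"] by (simp add: eq_neg_iff_add_eq_0 add.commute)

lemma star_diff: "star (a - b) = star a - star (b::'a::unital_banach_star_algebra)"
  using star_add[of a "- b"] by (simp add: star_minus)

lemma star_one [simp]: "star (1::'a::unital_banach_star_algebra) = 1"
  by (metis mult_1 mult_1_right star_mult star_star)

lemma star_scaleR: "star (r *\<^sub>R a) = r *\<^sub>R star (a::'a::unital_banach_star_algebra)"
  by (simp add: scaleR_eq_scaleC star_scaleC)

lemma norm_one_ge_1: "1 \<le> norm (1::'a::unital_banach_star_algebra)"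
  using norm_mult_ineq[of "1::'a" 1] by simp

text \<open>The factor \<open>norm 1\<close> accounts for n = 0, since the unit may have norm
  greater than 1.\<close>

lemma norm_power_le: "norm ((a::'a::unital_banach_star_algebra) ^ n) \<le> norm (1::'a) * norm a ^ n"
proof (induction n)
  case (Suc n)
  have "norm (a ^ Suc n) \<le> norm a * norm (a ^ n)"
    by (simp add: norm_mult_ineq)
  also have "\<dots> \<le> norm a * (norm (1::'a) * norm a ^ n)"
    by (intro mult_left_mono Suc.IH) simp
  finally show ?case by (simp add: algebra_simps)
qed simp

section \<open>Invertibility and boundedness of powers\<close>

lemma neumann_inverse:
  fixes a :: "'a::unital_banach_star_algebra"
  assumes "norm a < 1"
  shows "\<exists>b. (1 - a) * b = 1 \<and> b * (1 - a) = 1"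
proof -
  have s: "summable (\<lambda>n. a ^ n)"
  proof (rule summable_comparison_test')
    show "summable (\<lambda>n. norm (1::'a) * norm a ^ n)"
      using assms by (intro summable_mult summable_geometric) simp
    show "norm (a ^ n) \<le> norm (1::'a) * norm a ^ n" if "n \<ge> 0" for n
      by (rule norm_power_le)
  qed
  have 1: "a * (\<Sum>n. a ^ n) = (\<Sum>n. a ^ n) - 1"
    using suminf_mult[OF s, of a] suminf_split_head[OF s] by simp
  have 2: "(\<Sum>n. a ^ n) * a = (\<Sum>n. a ^ n) - 1"
    using suminf_mult2[OF s, of a] suminf_split_head[OF s] by (simp add: power_commutes)
  show ?thesis
    by (rule exI[of _ "\<Sum>n. a ^ n"]) (simp add: algebra_simps 1 2)
qed

lemma geometric_telescope: "(\<Sum>j<n. y ^ j) * (1 - y) = 1 - (y::'r::ring_1) ^ n"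
proof (induction n)
  case (Suc n)
  have "(\<Sum>j<Suc n. y ^ j) * (1 - y) = (\<Sum>j<n. y ^ j) * (1 - y) + (y ^ n - y ^ n * y)"
    by (simp add: algebra_simps)
  also have "\<dots> = 1 - y ^ Suc n"
    unfolding Suc.IH by (simp add: power_commutes)
  finally show ?case .
qed simp

text \<open>Multiplication by \<open>1 - x ^ n\<close> turns \<open>G k\<close> into the geometric
  sum of the first n powers of \<open>\<omega> k *\<^sub>C x\<close>, where
  \<open>\<omega> k\<close> is an n-th root of unity. Summing over k annihilates all powers of
  \<open>x\<close> except the zeroth.\<close>

lemma root_average_inverse:
  fixes x :: "'a::unital_banach_star_algebra"
  assumes n: "0 < n"
    and G: "\<And>k. k < n \<Longrightarrow> (1 - cis (2 * pi * real k / real n) *\<^sub>C x) * G k = 1"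
  shows "(1 - x ^ n) * ((1 / complex_of_nat n) *\<^sub>C (\<Sum>k<n. G k)) = 1"
proof -
  define \<omega> where "\<omega> = (\<lambda>k. cis (2 * pi * real k / real n))"
  \<comment> \<open>Exchanging the indices makes the sum over k a geometric one with ratio
    \<open>\<omega> j\<close>.\<close>
  have \<omega>j: "\<omega> k ^ j = \<omega> j ^ k" for k j
    unfolding \<omega>_def Complex.DeMoivre by (simp add: mult_ac)
  have \<omega>n: "\<omega> k ^ n = 1" for k
  proof -
    have "\<omega> k ^ n = cis (2 * pi * real k)"
      unfolding \<omega>_def Complex.DeMoivre using n by simp
    then show ?thesis by (metis cis_multiple_2pi Ints_of_nat)
  qed
  have sums: "(\<Sum>k<n. \<omega> k ^ j) = (if j = 0 then of_nat n else 0)" if j: "j < n" for j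
  proof (cases "j = 0")
    case False
    have "inj_on \<omega> {..<n}"
      using Complex.bij_betw_roots_unity[OF n] unfolding bij_betw_def \<omega>_def by simp
    then have "\<omega> j \<noteq> \<omega> 0"
      using j n False by (auto dest: inj_onD)
    then have "\<omega> j \<noteq> 1"
      by (simp add: \<omega>_def)
    then have "(\<Sum>k<n. \<omega> j ^ k) = 0"
      using geometric_sum[of "\<omega> j" n] \<omega>n by simp
    then show ?thesis using False by (simp add: \<omega>j[of _ j])
  qed simp
  have geo: "(1 - x ^ n) * G k = (\<Sum>j<n. \<omega> k ^ j *\<^sub>C x ^ j)" if "k < n" for k
  proof -
    have "1 - x ^ n = (\<Sum>j<n. (\<omega> k *\<^sub>C x) ^ j) * (1 - \<omega> k *\<^sub>C x)"
      using geometric_telescope[of "\<omega> k *\<^sub>C x" n] by (simp add: power_scaleC \<omega>n scaleC_one)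
    then show ?thesis
      using G[OF that] by (simp add: mult.assoc power_scaleC \<omega>_def)
  qed
  have "(1 - x ^ n) * (\<Sum>k<n. G k) = (\<Sum>k<n. \<Sum>j<n. \<omega> k ^ j *\<^sub>C x ^ j)"
    unfolding sum_distrib_left by (rule sum.cong[OF refl]) (simp add: geo)
  also have "\<dots> = (\<Sum>j<n. (\<Sum>k<n. \<omega> k ^ j) *\<^sub>C x ^ j)"
    by (subst sum.swap) (simp add: scaleC_sum_left)
  also have "\<dots> = (\<Sum>j<n. if j = 0 then of_nat n *\<^sub>C 1 else 0)"
    by (rule sum.cong) (simp_all add: sums)
  also have "\<dots> = of_nat n *\<^sub>C 1"
    using n by (simp add: sum.delta)
  finally show ?thesis
    using n by (simp add: mult_scaleC_right scaleC_scaleC scaleC_one)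
qed

text \<open>Rickart's elementary substitute for the spectral radius formula: the average of \<open>(1 - cw)\<^sup>-\<^sup>1\<close> over
  \<open>n\<close> equidistant points \<open>c\<close> of the circle of radius \<open>r\<close> is \<open>(1 - r\<^sup>n w\<^sup>n)\<^sup>-\<^sup>1\<close>, so that by uniform
  continuity the boundedness of \<open>r\<^sup>n w\<^sup>n\<close> spreads from one radius to all those at distance less than a
  fixed \<open>\<delta>\<close>.\<close>

lemma powers_bounded_if_invertible:
  fixes w :: "'a::unital_banach_star_algebra"
  assumes inv: "\<And>c. cmod c \<le> 1 \<Longrightarrow> \<exists>b. (1 - c *\<^sub>C w) * b = 1 \<and> b * (1 - c *\<^sub>C w) = 1"
  shows "Bseq (\<lambda>n. w ^ n)"
proof -
  obtain G where G1: "\<And>c. cmod c \<le> 1 \<Longrightarrow> (1 - c *\<^sub>C w) * G c = 1"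
    and G2: "\<And>c. cmod c \<le> 1 \<Longrightarrow> G c * (1 - c *\<^sub>C w) = 1"
    using inv by metis
  \<comment> \<open>The resolvent identity.\<close>
  have res: "G c - G d = (c - d) *\<^sub>C (G c * (w * G d))" if "cmod c \<le> 1" "cmod d \<le> 1" for c d
  proof -
    have "G c - G d = G c * ((1 - d *\<^sub>C w) * G d) - (G c * (1 - c *\<^sub>C w)) * G d"
      using G1[OF that(2)] G2[OF that(1)] by simp
    also have "\<dots> = G c * ((1 - d *\<^sub>C w) - (1 - c *\<^sub>C w)) * G d"
      by (simp add: algebra_simps)
    also have "(1 - d *\<^sub>C w) - (1 - c *\<^sub>C w) = (c - d) *\<^sub>C w"
      by (simp add: scaleC_diff_left)
    finally show ?thesis by (simp add: mult_scaleC_left mult_scaleC_right mult.assoc)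
  qed
  have res_le: "norm (G c - G d) \<le> cmod (c - d) * (norm (G c) * norm w * norm (G d))"
    if "cmod c \<le> 1" "cmod d \<le> 1" for c d
  proof -
    have "norm (G c * (w * G d)) \<le> norm (G c) * (norm w * norm (G d))"
      using order_trans[OF norm_mult_ineq mult_left_mono[OF norm_mult_ineq norm_ge_zero]] .
    then show ?thesis
      unfolding res[OF that] norm_scaleC by (simp add: mult.assoc mult_left_mono)
  qed
  have cont: "continuous_on (cball 0 1) G"
    unfolding continuous_on_iff
  proof (intro ballI allI impI)
    fix c :: complex and e :: real
    assume c: "c \<in> cball 0 1" and e: "0 < e"
    \<comment> \<open>\<open>res_le\<close> bounds \<open>G c - G d\<close> in terms of
      \<open>G d\<close>, which is not yet controlled. The distance 1/(2K) makes this bound at most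
      half of \<open>norm (G d)\<close>, so that \<open>norm (G d) \<le> L\<close>. Then the
      distance e/(K L) gives e.\<close>
    define K where "K = norm (G c) * norm w + 1"
    have K: "0 < K" "1 \<le> K" "norm (G c) * norm w \<le> K" by (auto simp: K_def intro: add_nonneg_pos)
    define L where "L = 2 * norm (G c) + 1"
    have L: "0 < L" by (auto simp: L_def intro: add_nonneg_pos)
    show "\<exists>\<delta>>0. \<forall>d\<in>cball 0 1. dist d c < \<delta> \<longrightarrow> dist (G d) (G c) < e"
    proof (intro exI[of _ "min (1 / (2 * K)) (e / (K * L))"] conjI ballI impI)
      show "0 < min (1 / (2 * K)) (e / (K * L))"
        using K L e by simp
      fix d assume d: "d \<in> cball 0 1" and less: "dist d c < min (1 / (2 * K)) (e / (K * L))"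
      have cd: "cmod (c - d) < 1 / (2 * K)" "cmod (c - d) < e / (K * L)"
        using less by (simp_all add: dist_norm norm_minus_commute)
      have le: "norm (G c - G d) \<le> cmod (c - d) * K * norm (G d)"
      proof -
        have "norm (G c) * norm w * norm (G d) \<le> K * norm (G d)"
          by (rule mult_right_mono[OF K(3)]) simp
        from mult_left_mono[OF this, of "cmod (c - d)"]
        show ?thesis using res_le[of c d] c d by (simp add: mult.assoc)
      qed
      have "cmod (c - d) * K \<le> 1 / 2"
        using cd(1) K by (simp add: field_simps)
      then have "cmod (c - d) * K * norm (G d) \<le> 1 / 2 * norm (G d)"
        by (rule mult_right_mono) simp
      then have "norm (G c - G d) \<le> norm (G d) / 2"
        using le by simp
      then have "norm (G d) \<le> 2 * norm (G c)"
        using norm_triangle_ineq2[of "G d" "G c"] by (simp add: norm_minus_commute)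
      then have "norm (G d) \<le> L"
        by (simp add: L_def)
      then have "norm (G c - G d) \<le> cmod (c - d) * K * L"
        using mult_left_mono[of "norm (G d)" L "cmod (c - d) * K"] le K by simp
      also have "\<dots> < e"
        using cd(2) K L by (simp add: field_simps)
      finally show "dist (G d) (G c) < e"
        by (simp add: dist_norm norm_minus_commute)
    qed
  qed
  have "uniformly_continuous_on (cball 0 1) G"
    using cont compact_cball by (rule compact_uniformly_continuous)
  \<comment> \<open>Two errors of 1/4 will add up to the distance 1/2 from 1 within which
    \<open>M n s\<close> is to be kept.\<close>
  then have "\<exists>\<delta>>0. \<forall>c\<in>cball 0 1. \<forall>d\<in>cball 0 1. dist d c < \<delta> \<longrightarrow> dist (G d) (G c) < 1 / 4"
    unfolding uniformly_continuous_on_def by (elim allE[of _ "1 / 4"]) simp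
  then obtain \<delta> where \<delta>: "0 < \<delta>" and
    uc: "\<And>c d. cmod c \<le> 1 \<Longrightarrow> cmod d \<le> 1 \<Longrightarrow> cmod (c - d) < \<delta> \<Longrightarrow> norm (G c - G d) < 1 / 4"
    by (auto simp: dist_norm norm_minus_commute)
  define M where "M = (\<lambda>n r. (1 / complex_of_nat n) *\<^sub>C
    (\<Sum>k<n. G (cis (2 * pi * real k / real n) * complex_of_real r)))"
  have M: "(1 - r ^ n *\<^sub>R w ^ n) * M n r = 1" if "0 < n" "0 \<le> r" "r \<le> 1" for n r
  proof -
    have "(1 - (complex_of_real r *\<^sub>C w) ^ n) * M n r = 1"
      unfolding M_def using that
      by (intro root_average_inverse) (simp_all add: scaleC_scaleC G1 norm_mult)
    then show ?thesis by (simp add: power_scaleC scaleR_eq_scaleC)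
  qed
  have M_diff: "norm (M n r - M n s) \<le> 1 / 4"
    if "0 < n" "0 \<le> r" "r \<le> 1" "0 \<le> s" "s \<le> 1" "\<bar>r - s\<bar> < \<delta>" for n r s
  proof -
    have 1: "norm (G (cis t * complex_of_real r) - G (cis t * complex_of_real s)) \<le> 1 / 4" for t
    proof -
      have "cmod (cis t * complex_of_real r - cis t * complex_of_real s) = \<bar>r - s\<bar>"
        unfolding right_diff_distrib[symmetric] of_real_diff[symmetric] norm_mult norm_cis
        by (simp only: norm_of_real mult_1)
      then show ?thesis
        using that by (intro less_imp_le[OF uc]) (simp_all add: norm_mult)
    qed
    have "norm (\<Sum>k<n. G (cis (2 * pi * real k / real n) * complex_of_real r)
        - G (cis (2 * pi * real k / real n) * complex_of_real s)) \<le> (\<Sum>k<n. 1 / 4)"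
      by (intro sum_norm_le 1)
    then show ?thesis
      using that(1) unfolding M_def scaleC_diff_right[symmetric] sum_subtractf[symmetric] norm_scaleC
      by (simp add: norm_divide field_simps)
  qed
  define P where "P = (\<lambda>r. Bseq (\<lambda>n. r ^ n *\<^sub>R w ^ n))"
  define B where "B = norm (1::'a)"
  have B: "1 \<le> B" unfolding B_def by (rule norm_one_ge_1)
  have step: "P s" if r: "0 \<le> r" "P r" and s: "0 \<le> s" "s \<le> 1" "r \<le> s" "s < r + \<delta>" for r s
  proof -
    \<comment> \<open>Retreat from \<open>r\<close> to \<open>q = max 0 (r - u)\<close>, which is
      still closer than \<delta> to \<open>s\<close>. Boundedness at \<open>r\<close> becomes
      convergence to 0 at \<open>q\<close>. Hence \<open>M n q\<close> is close to 1 for large n,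
      and \<open>M n s\<close> cannot be far from it.\<close>
    define u where "u = (r + \<delta> - s) / 2"
    have u: "0 < u" "s - r + u < \<delta>"
      using s by (simp_all add: u_def field_simps)
    define q where "q = max 0 (r - u)"
    have q: "0 \<le> q" "q \<le> 1" "\<bar>s - q\<bar> < \<delta>" "q < r \<or> q = 0"
      using r(1) s u unfolding q_def by linarith+
    have lim: "(\<lambda>n. norm (q ^ n *\<^sub>R w ^ n)) \<longlonglongrightarrow> 0"
    proof (cases "q = 0")
      case True
      show ?thesis
        by (rule tendsto_eventually)
          (auto simp: True eventually_sequentially power_0_left intro!: exI[of _ 1])
    next
      case False
      then have qr: "0 < q" "q < r" using q by auto
      obtain K where K: "\<And>n. norm (r ^ n *\<^sub>R w ^ n) \<le> K"
        using r(2) unfolding P_def by (meson BseqE)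
      have "(\<lambda>n. (q / r) ^ n * K) \<longlonglongrightarrow> 0"
        using qr by (intro tendsto_mult_left_zero LIMSEQ_power_zero) simp
      moreover have "norm (norm (q ^ n *\<^sub>R w ^ n)) \<le> (q / r) ^ n * K" for n
      proof -
        have "norm (norm (q ^ n *\<^sub>R w ^ n)) = (q / r) ^ n * norm (r ^ n *\<^sub>R w ^ n)"
          using qr by (simp add: power_divide)
        also have "\<dots> \<le> (q / r) ^ n * K"
          using K[of n] qr by (intro mult_left_mono) simp_all
        finally show ?thesis .
      qed
      ultimately show ?thesis
        by (rule Lim_null_comparison[rotated, OF _ always_eventually[OF allI]])
    qed
    have "\<forall>\<^sub>F n in sequentially. norm (q ^ n *\<^sub>R w ^ n) < 1 / (8 * B)"
      using lim B by (intro order_tendstoD(2)[OF lim]) simp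
    then have "\<forall>\<^sub>F n in sequentially. norm (s ^ n *\<^sub>R w ^ n) \<le> 3 * B"
      using eventually_gt_at_top[of 0]
    proof eventually_elim
      case (elim n)
      define e where "e = norm (q ^ n *\<^sub>R w ^ n)"
      have e: "0 \<le> e" "e * B \<le> 1 / 8" "e \<le> 1 / 8"
      proof -
        show e0: "0 \<le> e" by (simp add: e_def)
        show eB: "e * B \<le> 1 / 8" using elim(1) B by (simp add: e_def field_simps)
        show "e \<le> 1 / 8" using mult_left_mono[OF B e0] eB by simp
      qed
      define Mq where "Mq = M n q"
      define Ms where "Ms = M n s"
      \<comment> \<open>The deviation t = \<open>norm (Mq - 1)\<close> satisfies t \<le> e (t + B)
        \<le> t/8 + 1/8; the threshold 1/(8 B) for e was chosen for this.\<close>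
      have "Mq - 1 = (q ^ n *\<^sub>R w ^ n) * Mq"
        using M[OF elim(2) q(1,2)] by (simp add: Mq_def algebra_simps)
      then have "norm (Mq - 1) \<le> e * norm Mq"
        unfolding e_def by (metis norm_mult_ineq)
      also have "\<dots> \<le> e * (norm (Mq - 1) + B)"
        using e(1) norm_triangle_sub[of Mq 1] by (intro mult_left_mono) (simp_all add: B_def add.commute)
      also have "\<dots> \<le> 1 / 8 * norm (Mq - 1) + 1 / 8"
        using e mult_right_mono[OF e(3), of "norm (Mq - 1)"] by (simp add: algebra_simps)
      finally have "norm (Mq - 1) \<le> 1 / 4" by simp
      moreover have "norm (Ms - Mq) \<le> 1 / 4"
        unfolding Ms_def Mq_def using elim(2) q s by (intro M_diff) auto
      ultimately have Ms: "norm (Ms - 1) \<le> 1 / 2"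
        using norm_triangle_ineq[of "Ms - Mq" "Mq - 1"] by simp
      \<comment> \<open>\<open>y\<close> has the right inverse \<open>Ms\<close>, which is within
        1/2 of 1. In y = 1 - y (Ms - 1) the last term costs at most half of \<open>norm y\<close>
        and is absorbed on the left.\<close>
      define y where "y = 1 - s ^ n *\<^sub>R w ^ n"
      have "y = 1 - y * (Ms - 1)"
        using M[OF elim(2) s(1,2)] by (simp add: y_def Ms_def algebra_simps)
      then have "norm y \<le> B + norm (y * (Ms - 1))"
        unfolding B_def by (metis norm_triangle_ineq4)
      also have "norm (y * (Ms - 1)) \<le> norm y * (1 / 2)"
        by (rule order_trans[OF norm_mult_ineq mult_left_mono[OF Ms]]) simp
      finally have "norm y \<le> 2 * B" by simp
      moreover have "norm (s ^ n *\<^sub>R w ^ n) \<le> B + norm y"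
        using norm_triangle_ineq4[of 1 y] by (simp add: y_def B_def)
      ultimately show ?case by simp
    qed
    then show ?thesis unfolding P_def by (rule BfunI)
  qed
  \<comment> \<open>At radius 0 all terms but the zeroth vanish. Steps of \<delta>/2, smaller than
    the permitted \<delta>, reach radius 1.\<close>
  have P: "P (min 1 (real j * (\<delta> / 2)))" for j
  proof (induction j)
    case 0
    have "Bseq (\<lambda>n. 0 ^ n *\<^sub>R w ^ n)"
      by (rule BfunI[of _ 0]) (auto simp: eventually_sequentially power_0_left intro!: exI[of _ 1])
    then show ?case by (simp add: P_def)
  next
    case (Suc j)
    show ?case
      by (rule step[OF _ Suc.IH]) (use \<delta> in \<open>auto simp: algebra_simps min_def\<close>)
  qed
  obtain j where "1 / (\<delta> / 2) < real j"
    using reals_Archimedean2 by blast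
  then have "min 1 (real j * (\<delta> / 2)) = 1"
    using \<delta> by (simp add: field_simps)
  then show ?thesis
    using P[of j] by (simp add: P_def)
qed

text \<open>With \<open>w = star v\<close> and \<open>d = v - w\<close> one has \<open>d w = 2 d - d v\<close>, so that \<open>d w\<^sup>n\<close> grows like \<open>(3/2)\<^sup>n\<close> unless
  \<open>d = 0\<close>, while the powers of \<open>w\<close> are bounded.\<close>

lemma hermitian_square_root:
  fixes h :: "'a::unital_banach_star_algebra"
  assumes h: "star h = h" and norm_h: "norm h \<le> 3 / 4"
  obtains v where "star v = v" "(1 - v) * (1 - v) = 1 - h"
proof -
  \<comment> \<open>A fixed point of \<open>T\<close> satisfies 2 v = h + v^2, that is, (1 - v)^2 =
    1 - h. On the ball of radius 1/2 the map \<open>T\<close> contracts by 1/2, and 3/4 + 1/4 = 1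
    keeps its values in the ball. The commutation clause puts \<open>v\<close> in the bicommutant of
    \<open>h\<close>. As \<open>star v\<close> commutes with \<open>h\<close>, this makes
    \<open>v\<close> commute with \<open>star v\<close>.\<close>
  define S where "S = {v. norm v \<le> 1 / 2 \<and> (\<forall>b. b * h = h * b \<longrightarrow> b * v = v * b)}"
  define T where "T = (\<lambda>v. (1 / 2) *\<^sub>R (h + v * v))"
  have "closed S"
    unfolding S_def
    by (intro closed_Collect_conj closed_Collect_all closed_Collect_imp closed_Collect_le
        closed_Collect_eq continuous_intros) simp_all
  then have "complete S" by (simp add: complete_eq_closed)
  moreover have "0 \<in> S" by (simp add: S_def)
  moreover have "T ` S \<subseteq> S"
  proof (rule image_subsetI)
    fix v assume v: "v \<in> S"
    have "norm (v * v) \<le> 1 / 2 * (1 / 2)"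
      using v by (intro order_trans[OF norm_mult_ineq mult_mono]) (simp_all add: S_def)
    then have "norm (h + v * v) \<le> 1"
      using norm_triangle_ineq[of h "v * v"] norm_h by simp
    moreover have "b * T v = T v * b" if b: "b * h = h * b" for b
    proof -
      have bv: "b * v = v * b" using v b by (simp add: S_def)
      have "b * (v * v) = (v * v) * b"
        by (metis bv mult.assoc)
      then show ?thesis by (simp add: T_def b distrib_left distrib_right)
    qed
    ultimately show "T v \<in> S" by (simp add: S_def T_def)
  qed
  moreover have "dist (T v) (T w) \<le> 1 / 2 * dist v w" if "v \<in> S" "w \<in> S" for v w
  proof -
    have "v * v - w * w = v * (v - w) + (v - w) * w"
      by (simp add: algebra_simps)
    then have "norm (v * v - w * w) \<le> norm v * norm (v - w) + norm (v - w) * norm w"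
      by (metis norm_triangle_mono norm_mult_ineq)
    also have "\<dots> \<le> 1 / 2 * norm (v - w) + norm (v - w) * (1 / 2)"
      using that by (intro add_mono mult_mono) (simp_all add: S_def)
    finally have "norm (v * v - w * w) \<le> norm (v - w)" by simp
    moreover have "T v - T w = (1 / 2) *\<^sub>R (v * v - w * w)"
      by (simp add: T_def algebra_simps)
    ultimately show ?thesis by (simp add: dist_norm)
  qed
  ultimately obtain v where v: "v \<in> S" "T v = v"
    using Banach_fix[of S "1 / 2" T] by auto
  define w where "w = star v"
  define d where "d = v - w"
  have T_eq: "2 *\<^sub>R T x = h + x * x" for x by (simp add: T_def)
  have eq_v: "2 *\<^sub>R v = h + v * v" using v(2) by (metis T_eq)
  have eq_w: "2 *\<^sub>R w = h + w * w"
    using arg_cong[OF eq_v, of star] by (simp add: w_def star_scaleR star_add star_mult h)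
  have "h * v = v * h" using v by (simp add: S_def)
  then have "w * h = h * w"
    unfolding w_def by (metis h star_mult)
  then have vw: "w * v = v * w" using v by (simp add: S_def)
  have "d * (v + w) = v * v - w * w"
    by (simp add: d_def algebra_simps vw)
  also have "\<dots> = 2 *\<^sub>R d"
    by (simp add: d_def scaleR_diff_right eq_v eq_w)
  finally have dw: "d * w = 2 *\<^sub>R d - d * v"
    by (simp add: distrib_left eq_diff_eq add.commute)
  \<comment> \<open>Nothing is known about \<open>norm w\<close>, but
    \<open>1 - c *\<^sub>C w\<close> is the star of \<open>1 - cnj c *\<^sub>C v\<close>, which has
    a Neumann inverse because \<open>norm v \<le> 1 / 2\<close>.\<close>
  have "Bseq (\<lambda>n. w ^ n)"
  proof (rule powers_bounded_if_invertible)
    fix c :: complex assume c: "cmod c \<le> 1"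
    have "cmod c * norm v \<le> 1 * (1 / 2)"
      using c v by (intro mult_mono) (simp_all add: S_def)
    then have "norm (cnj c *\<^sub>C v) < 1"
      by (simp add: norm_scaleC)
    then obtain b where b: "(1 - cnj c *\<^sub>C v) * b = 1" "b * (1 - cnj c *\<^sub>C v) = 1"
      using neumann_inverse by blast
    show "\<exists>b. (1 - c *\<^sub>C w) * b = 1 \<and> b * (1 - c *\<^sub>C w) = 1"
      using arg_cong[OF b(1), of star] arg_cong[OF b(2), of star]
      by (intro exI[of _ "star b"]) (simp add: star_mult star_diff star_scaleC w_def)
  qed
  then obtain K where K: "\<And>n. norm (w ^ n) \<le> K"
    by (meson BseqE)
  have grow: "(3 / 2) ^ n * norm d \<le> norm (d * w ^ n)" for n
  proof (induction n)
    case (Suc n)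
    have comm: "v * w ^ n = w ^ n * v"
      using power_commuting_commutes[OF vw, of n] by simp
    have "d * w ^ Suc n = (d * w) * w ^ n" by (simp add: mult.assoc)
    also have "\<dots> = 2 *\<^sub>R (d * w ^ n) - d * w ^ n * v"
      unfolding dw by (simp add: left_diff_distrib mult.assoc comm)
    finally have *: "d * w ^ Suc n = 2 *\<^sub>R (d * w ^ n) - d * w ^ n * v" .
    have "norm (d * w ^ n * v) \<le> norm (d * w ^ n) * (1 / 2)"
      using v by (intro order_trans[OF norm_mult_ineq mult_left_mono]) (simp_all add: S_def)
    moreover have "norm (2 *\<^sub>R (d * w ^ n)) - norm (d * w ^ n * v) \<le> norm (d * w ^ Suc n)"
      unfolding * by (rule norm_triangle_ineq2)
    ultimately have "3 / 2 * norm (d * w ^ n) \<le> norm (d * w ^ Suc n)" by simp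
    then show ?case using Suc.IH by simp
  qed simp
  have "d = 0"
  proof (rule ccontr)
    assume d: "d \<noteq> 0"
    obtain n where n: "K < (3 / 2) ^ n"
      using real_arch_pow[of "3 / 2" K] by auto
    have "(3 / 2) ^ n * norm d \<le> norm d * K"
      by (rule order_trans[OF grow order_trans[OF norm_mult_ineq mult_left_mono[OF K norm_ge_zero]]])
    then show False using n d by (simp add: mult.commute)
  qed
  then have "star v = v" by (simp add: d_def w_def)
  moreover have "(1 - v) * (1 - v) = 1 - h"
    using eq_v by (simp add: algebra_simps scaleR_2)
  ultimately show ?thesis by (rule that)
qed

section \<open>Semi-inner products, a common calculus for \<open>f (star b * a)\<close>,
  \<open>\<langle>A x, y\<rangle>\<close> and Hilbert spaces\<close>

locale semi_inner =
  fixes V :: "'v::complex_vector set" and s :: "'v \<Rightarrow> 'v \<Rightarrow> complex"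
  assumes zero_mem: "0 \<in> V"
    and add_mem: "x \<in> V \<Longrightarrow> y \<in> V \<Longrightarrow> x + y \<in> V"
    and scale_mem: "x \<in> V \<Longrightarrow> c *\<^sub>C x \<in> V"
    and add_left: "x \<in> V \<Longrightarrow> y \<in> V \<Longrightarrow> z \<in> V \<Longrightarrow> s (x + y) z = s x z + s y z"
    and scale_left: "x \<in> V \<Longrightarrow> y \<in> V \<Longrightarrow> s (c *\<^sub>C x) y = c * s x y"
    and hermitian: "x \<in> V \<Longrightarrow> y \<in> V \<Longrightarrow> s y x = cnj (s x y)"
    and pos: "x \<in> V \<Longrightarrow> 0 \<le> s x x"
begin

definition nrm :: "'v \<Rightarrow> real" where "nrm x = sqrt (Re (s x x))"

lemma minus_mem: "x \<in> V \<Longrightarrow> - x \<in> V"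
  using scale_mem[of x "-1"] by (simp add: scaleC_minus_one)

lemma diff_mem: "x \<in> V \<Longrightarrow> y \<in> V \<Longrightarrow> x - y \<in> V"
  using add_mem[of x "-y"] minus_mem by simp

lemma add_right: "x \<in> V \<Longrightarrow> y \<in> V \<Longrightarrow> z \<in> V \<Longrightarrow> s z (x + y) = s z x + s z y"
  using hermitian[of "x + y" z] hermitian[of x z] hermitian[of y z] by (simp add: add_left add_mem)

lemma scale_right: "x \<in> V \<Longrightarrow> y \<in> V \<Longrightarrow> s y (c *\<^sub>C x) = cnj c * s y x"
  using hermitian[of "c *\<^sub>C x" y] hermitian[of x y] by (simp add: scale_left scale_mem)

lemma minus_left: "x \<in> V \<Longrightarrow> y \<in> V \<Longrightarrow> s (- x) y = - s x y"
  using scale_left[of x y "-1"] by (simp add: scaleC_minus_one)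

lemma minus_right: "x \<in> V \<Longrightarrow> y \<in> V \<Longrightarrow> s y (- x) = - s y x"
  using scale_right[of x y "-1"] by (simp add: scaleC_minus_one)

lemma diff_left: "x \<in> V \<Longrightarrow> y \<in> V \<Longrightarrow> z \<in> V \<Longrightarrow> s (x - y) z = s x z - s y z"
  using add_left[of x "-y" z] by (simp add: minus_mem minus_left)

lemma diff_right: "x \<in> V \<Longrightarrow> y \<in> V \<Longrightarrow> z \<in> V \<Longrightarrow> s z (x - y) = s z x - s z y"
  using add_right[of x "-y" z] by (simp add: minus_mem minus_right)

lemma zero_left [simp]: "y \<in> V \<Longrightarrow> s 0 y = 0"
  using scale_left[of 0 y 0] by (simp add: zero_mem)

lemma zero_right [simp]: "y \<in> V \<Longrightarrow> s y 0 = 0"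
  using scale_right[of 0 y 0] by (simp add: zero_mem)

lemma nrm_sq: "x \<in> V \<Longrightarrow> (nrm x)\<^sup>2 = Re (s x x)"
  using pos[of x] by (simp add: nrm_def less_eq_complex_def)

lemma self_eq: "x \<in> V \<Longrightarrow> s x x = complex_of_real ((nrm x)\<^sup>2)"
  using pos[of x] by (simp add: nrm_sq less_eq_complex_def complex_eq_iff)

lemma nrm_nonneg [simp]: "x \<in> V \<Longrightarrow> 0 \<le> nrm x"
  using pos[of x] by (simp add: nrm_def less_eq_complex_def)

lemma nrm_zero [simp]: "nrm 0 = 0"
  by (simp add: nrm_def zero_mem)

text \<open>A real multiple of \<open>- s x y\<close> is the direction of steepest descent, which
  keeps the expansion real and quadratic in \<open>r\<close>. It yields both the Cauchy-Schwarz
  inequality and the orthogonality of minimisers.\<close>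

lemma nrm_sq_add_scale:
  assumes x: "x \<in> V" and y: "y \<in> V"
  shows "(nrm (x + (- complex_of_real r * s x y) *\<^sub>C y))\<^sup>2 =
    (nrm x)\<^sup>2 - 2 * r * (cmod (s x y))\<^sup>2 + r\<^sup>2 * (cmod (s x y))\<^sup>2 * (nrm y)\<^sup>2"
proof -
  define t where "t = - complex_of_real r * s x y"
  have ty: "t *\<^sub>C y \<in> V" using y by (rule scale_mem)
  have cc: "s x y * cnj (s x y) = complex_of_real ((cmod (s x y))\<^sup>2)"
    by (simp flip: complex_norm_square)
  have "s (x + t *\<^sub>C y) (x + t *\<^sub>C y) = s x x + t * s y x + cnj t * s x y + t * cnj t * s y y"
    using x y ty by (simp add: add_left add_right add_mem scale_left scale_right algebra_simps)
  also have "\<dots> = complex_of_real ((nrm x)\<^sup>2) - 2 * complex_of_real r * (s x y * cnj (s x y))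
      + (complex_of_real r)\<^sup>2 * (s x y * cnj (s x y)) * complex_of_real ((nrm y)\<^sup>2)"
    unfolding self_eq[OF x] self_eq[OF y] hermitian[OF x y]
    by (simp add: t_def algebra_simps power2_eq_square)
  also have "\<dots> = complex_of_real ((nrm x)\<^sup>2 - 2 * r * (cmod (s x y))\<^sup>2
      + r\<^sup>2 * (cmod (s x y))\<^sup>2 * (nrm y)\<^sup>2)"
    unfolding cc by simp
  finally show ?thesis
    using nrm_sq[OF add_mem[OF x ty]] by (simp add: t_def)
qed

lemma cauchy_schwarz:
  assumes x: "x \<in> V" and y: "y \<in> V"
  shows "cmod (s x y) \<le> nrm x * nrm y"
proof -
  define c where "c = cmod (s x y)"
  have key: "0 \<le> (nrm x)\<^sup>2 - 2 * r * c\<^sup>2 + r\<^sup>2 * c\<^sup>2 * (nrm y)\<^sup>2" for r :: real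
    unfolding c_def nrm_sq_add_scale[OF x y, symmetric] by simp
  have "c\<^sup>2 \<le> (nrm x * nrm y)\<^sup>2"
  proof (cases "nrm y = 0")
    case True
    show ?thesis
    proof (cases "c = 0")
      case False
      \<comment> \<open>The seminorm may vanish at a nonzero \<open>y\<close>. The expression in
        \<open>key\<close> is then affine in \<open>r\<close>, and this value of \<open>r\<close>
        makes it -1.\<close>
      then show ?thesis using key[of "((nrm x)\<^sup>2 + 1) / (2 * c\<^sup>2)"] True by (simp add: field_simps)
    qed simp
  next
    case False
    then have Y: "0 < (nrm y)\<^sup>2" by simp
    then have "(1 / (nrm y)\<^sup>2)\<^sup>2 * c\<^sup>2 * (nrm y)\<^sup>2 = c\<^sup>2 / (nrm y)\<^sup>2"
      by (simp add: power2_eq_square)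
    then have "c\<^sup>2 / (nrm y)\<^sup>2 \<le> (nrm x)\<^sup>2"
      using key[of "1 / (nrm y)\<^sup>2"] by simp
    then show ?thesis
      using Y by (simp add: pos_divide_le_eq power_mult_distrib)
  qed
  then show ?thesis
    unfolding c_def by (rule power2_le_imp_le) (use x y in simp)
qed

lemma nrm_triangle:
  assumes x: "x \<in> V" and y: "y \<in> V"
  shows "nrm (x + y) \<le> nrm x + nrm y"
proof (rule power2_le_imp_le)
  have "Re (s x y) \<le> nrm x * nrm y"
    using cauchy_schwarz[OF x y] complex_Re_le_cmod[of "s x y"] by simp
  moreover have "(nrm (x + y))\<^sup>2 = (nrm x)\<^sup>2 + 2 * Re (s x y) + (nrm y)\<^sup>2"
    using x y hermitian[OF x y] by (simp add: nrm_sq add_mem add_left add_right)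
  ultimately show "(nrm (x + y))\<^sup>2 \<le> (nrm x + nrm y)\<^sup>2"
    by (simp add: power2_sum)
qed (use x y in simp)

lemma nrm_scale: "x \<in> V \<Longrightarrow> nrm (c *\<^sub>C x) = cmod c * nrm x"
proof -
  assume x: "x \<in> V"
  have "s (c *\<^sub>C x) (c *\<^sub>C x) = (c * cnj c) * s x x"
    using x by (simp add: scale_left scale_right scale_mem)
  also have "\<dots> = complex_of_real ((cmod c * nrm x)\<^sup>2)"
    by (simp add: self_eq[OF x] complex_norm_square[symmetric] power_mult_distrib)
  finally show ?thesis
    using x by (simp add: nrm_def[of "c *\<^sub>C x"])
qed

lemma nrm_minus: "x \<in> V \<Longrightarrow> nrm (- x) = nrm x"
  using nrm_scale[of x "-1"] by (simp add: scaleC_minus_one)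

lemma nrm_diff_commute: "x \<in> V \<Longrightarrow> y \<in> V \<Longrightarrow> nrm (x - y) = nrm (y - x)"
  using nrm_minus[of "x - y"] by (simp add: diff_mem)

lemma nrm_triangle_diff: "x \<in> V \<Longrightarrow> y \<in> V \<Longrightarrow> z \<in> V \<Longrightarrow> nrm (x - z) \<le> nrm (x - y) + nrm (y - z)"
  using nrm_triangle[of "x - y" "y - z"] by (simp add: diff_mem)

lemma nrm_le: "x \<in> V \<Longrightarrow> y \<in> V \<Longrightarrow> nrm x \<le> nrm y + nrm (x - y)"
  using nrm_triangle[of y "x - y"] by (simp add: diff_mem)

end

section \<open>Continuity of positive functionals\<close>

lemma LIMSEQ_null_comparison:
  fixes X :: "nat \<Rightarrow> 'v::real_normed_vector"
  assumes "\<And>n. norm (X n) \<le> Y n" "Y \<longlonglongrightarrow> 0"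
  shows "X \<longlonglongrightarrow> 0"
  using assms(2) by (rule Lim_null_comparison[OF always_eventually[OF allI[OF assms(1)]]])

text \<open>Polarisation: the diagonal is real at \<open>x + y\<close> and at
  \<open>x + \<i> *\<^sub>C y\<close>, which fixes the imaginary and the real part of
  \<open>s y x\<close>.\<close>

lemma hermitian_if_sesquilinear_pos:
  fixes s :: "'v::complex_vector \<Rightarrow> 'v \<Rightarrow> complex"
  assumes al: "\<And>x y z. s (x + y) z = s x z + s y z" and ar: "\<And>x y z. s z (x + y) = s z x + s z y"
    and sl: "\<And>c x y. s (c *\<^sub>C x) y = c * s x y" and sr: "\<And>c x y. s y (c *\<^sub>C x) = cnj c * s y x"
    and pos: "\<And>x. 0 \<le> s x x"
  shows "s y x = cnj (s x y)"
proof -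
  have im: "Im (s z z) = 0" for z
    using pos[of z] by (simp add: less_eq_complex_def)
  have "Im (s x y + s y x) = 0"
    using im[of "x + y"] im[of x] im[of y] by (simp add: al ar)
  moreover have "Im (cnj \<i> * s x y + \<i> * s y x) = 0"
    using im[of "x + \<i> *\<^sub>C y"] im[of x] im[of y] by (simp add: al ar sl sr)
  ultimately show ?thesis by (simp add: complex_eq_iff)
qed

locale pos_functional =
  fixes f :: "'a::unital_banach_star_algebra \<Rightarrow> complex"
  assumes positive: "positive_functional f"
begin

lemma f_add: "f (a + b) = f a + f b"
  and f_scaleC: "f (c *\<^sub>C a) = c * f a"
  and f_pos: "0 \<le> f (star a * a)"
  using positive by (simp_all add: positive_functional_def)

sublocale semi_inner UNIV "\<lambda>a b. f (star b * a)"
proof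
  show "f (star x * y) = cnj (f (star y * x))" for x y
    by (rule hermitian_if_sesquilinear_pos[where s = "\<lambda>a b. f (star b * a)"])
      (simp_all add: distrib_left distrib_right star_add star_scaleC f_add f_scaleC f_pos
        mult_scaleC_left mult_scaleC_right)
qed (simp_all add: distrib_left f_add f_scaleC f_pos mult_scaleC_right)

lemma f_diff: "f (a - b) = f a - f b"
  using diff_left[of a b 1] by simp

lemma f_zero [simp]: "f 0 = 0"
  using f_scaleC[of 0 0] by simp

text \<open>For r = 3/(4 norm h), the largest factor allowed by
  \<open>hermitian_square_root\<close>, the element \<open>1 - r *\<^sub>R h\<close> is the square
  of a hermitian \<open>1 - v\<close>. So f is nonnegative at
  \<open>star b * ((1 - r *\<^sub>R h) * b)\<close>. This gives the constant 4/3, rounded up to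
  2.\<close>

lemma hermitian_sandwich:
  assumes h: "star h = h"
  shows "Re (f (star b * (h * b))) \<le> 2 * norm h * (nrm b)\<^sup>2"
proof (cases "h = 0")
  case True
  then show ?thesis by simp
next
  case False
  define r where "r = 3 / (4 * norm h)"
  have r: "0 < r" using False by (simp add: r_def)
  have "star (r *\<^sub>R h) = r *\<^sub>R h" "norm (r *\<^sub>R h) \<le> 3 / 4"
    using False by (simp_all add: star_scaleR h r_def)
  then obtain v where v: "star v = v" "(1 - v) * (1 - v) = 1 - r *\<^sub>R h"
    by (rule hermitian_square_root)
  have "star ((1 - v) * b) * ((1 - v) * b) = star b * (((1 - v) * (1 - v)) * b)"
    by (simp only: star_mult star_diff star_one v(1) mult.assoc)
  also have "\<dots> = star b * b - complex_of_real r *\<^sub>C (star b * (h * b))"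
    unfolding v(2) scaleR_eq_scaleC
    by (simp add: left_diff_distrib right_diff_distrib mult_scaleC_left mult_scaleC_right)
  finally have "0 \<le> f (star b * b) - complex_of_real r * f (star b * (h * b))"
    using f_pos[of "(1 - v) * b"] by (simp add: f_diff f_scaleC)
  then have "r * Re (f (star b * (h * b))) \<le> (nrm b)\<^sup>2"
    by (simp add: less_eq_complex_def nrm_sq)
  then have "Re (f (star b * (h * b))) \<le> 4 / 3 * norm h * (nrm b)\<^sup>2"
    using False by (simp add: r_def field_simps)
  also have "\<dots> \<le> 2 * norm h * (nrm b)\<^sup>2"
    by (intro mult_right_mono) simp_all
  finally show ?thesis .
qed

text \<open>The sandwich with h = \<open>star a * a\<close>. The constant cannot be expressed by
  \<open>norm a\<close> while the involution is uncontrolled, but it is finite for each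
  \<open>a\<close>, as boundedness of the representing operators requires.\<close>

lemma nrm_mult_le: "nrm (a * b) \<le> sqrt (2 * norm (star a * a)) * nrm b"
proof (rule power2_le_imp_le)
  have "(nrm (a * b))\<^sup>2 = Re (f (star b * ((star a * a) * b)))"
    by (simp add: nrm_sq star_mult mult.assoc)
  also have "\<dots> \<le> 2 * norm (star a * a) * (nrm b)\<^sup>2"
    by (rule hermitian_sandwich) (simp add: star_mult star_star)
  finally show "(nrm (a * b))\<^sup>2 \<le> (sqrt (2 * norm (star a * a)) * nrm b)\<^sup>2"
    by (simp add: power_mult_distrib)
qed simp

text \<open>For hermitian \<open>h\<close> one has \<open>star h * h = h * h\<close>, whose norm is
  at most the square of \<open>norm h\<close>. So the seminorm is continuous on hermitian elements,
  and only the passage to general ones is obstructed by the involution.\<close>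

lemma nrm_hermitian_le:
  assumes "star h = h"
  shows "nrm h \<le> 2 * nrm 1 * norm h"
proof (rule power2_le_imp_le)
  have "(nrm h)\<^sup>2 = Re (f (star 1 * ((h * h) * 1)))"
    by (simp add: nrm_sq assms)
  also have "\<dots> \<le> 2 * norm (h * h) * (nrm 1)\<^sup>2"
    by (rule hermitian_sandwich) (simp add: star_mult assms)
  also have "\<dots> \<le> 4 * (norm h * norm h) * (nrm 1)\<^sup>2"
    using norm_mult_ineq[of h h] by (intro mult_right_mono) (simp_all add: mult_mono)
  finally show "(nrm h)\<^sup>2 \<le> (2 * nrm 1 * norm h)\<^sup>2"
    by (simp add: power2_eq_square mult_ac)
qed simp

text \<open>The involution may be discontinuous, so that \<open>x\<close> and \<open>y\<close> may have nonzero limits; these are not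
  seen by \<open>f\<close>, because \<open>x\<^sup>2 + y\<^sup>2\<close> tends to \<open>0\<close> and is a sum of two positive terms.\<close>

lemma nrm_tendsto_0_if_hermitian_parts:
  assumes herm: "\<And>n. star (x n) = x n" "\<And>n. star (y n) = y n"
    and lim: "x \<longlonglongrightarrow> z" "y \<longlonglongrightarrow> w" and zw: "z + \<i> *\<^sub>C w = 0"
  shows "(\<lambda>n. nrm (x n)) \<longlonglongrightarrow> 0" "(\<lambda>n. nrm (y n)) \<longlonglongrightarrow> 0"
proof -
  have "z = - (\<i> *\<^sub>C w)"
    using zw by (simp add: eq_neg_iff_add_eq_0)
  then have "z * z + w * w = 0"
    by (simp add: mult_scaleC_left mult_scaleC_right scaleC_scaleC scaleC_minus_one
        scaleC_minus_right)
  then have "(\<lambda>n. x n * x n + y n * y n) \<longlonglongrightarrow> 0"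
    using tendsto_add[OF tendsto_mult[OF lim(1) lim(1)] tendsto_mult[OF lim(2) lim(2)]] by simp
  then have 0: "(\<lambda>n. sqrt (2 * norm (x n * x n + y n * y n) * (nrm 1)\<^sup>2)) \<longlonglongrightarrow> 0"
    using tendsto_real_sqrt[OF tendsto_mult[OF tendsto_mult[OF tendsto_const tendsto_norm_zero] tendsto_const]]
    by fastforce
  \<comment> \<open>The sandwich with b = 1. Both summands on the left are nonnegative, so a bound
    on the sum bounds each.\<close>
  have "(nrm (x n))\<^sup>2 + (nrm (y n))\<^sup>2 \<le> 2 * norm (x n * x n + y n * y n) * (nrm 1)\<^sup>2" for n
    using hermitian_sandwich[of "x n * x n + y n * y n" 1]
    by (simp add: nrm_sq[of "x n"] nrm_sq[of "y n"] herm star_add star_mult f_add)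
  then have le: "nrm (x n) \<le> sqrt (2 * norm (x n * x n + y n * y n) * (nrm 1)\<^sup>2)"
    "nrm (y n) \<le> sqrt (2 * norm (x n * x n + y n * y n) * (nrm 1)\<^sup>2)" for n
    by (intro real_le_rsqrt; smt (verit) zero_le_power2)+
  show "(\<lambda>n. nrm (x n)) \<longlonglongrightarrow> 0" "(\<lambda>n. nrm (y n)) \<longlonglongrightarrow> 0"
    by (rule Lim_null_comparison[OF always_eventually[OF allI] 0], simp add: le)+
qed

end

section \<open>Decomposition into hermitian elements of controlled norm\<close>

definition hermitian_part :: "'a \<Rightarrow> 'a::unital_banach_star_algebra"
  where "hermitian_part a = (1 / 2) *\<^sub>R (a + star a)"

definition imaginary_part :: "'a \<Rightarrow> 'a::unital_banach_star_algebra"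
  where "imaginary_part a = hermitian_part (- \<i> *\<^sub>C a)"

lemma hermitian_parts:
  "star (hermitian_part a) = hermitian_part a" "star (imaginary_part a) = imaginary_part a"
  "a = hermitian_part a + \<i> *\<^sub>C imaginary_part a"
proof -
  show 1: "star (hermitian_part a) = hermitian_part a" for a :: 'a
    by (simp add: hermitian_part_def star_scaleR star_add star_star add.commute)
  show "star (imaginary_part a) = imaginary_part a"
    unfolding imaginary_part_def by (rule 1)
  have "\<i> *\<^sub>C imaginary_part a = (1 / 2) *\<^sub>R (a - star a)"
    by (simp add: imaginary_part_def hermitian_part_def scaleR_eq_scaleC scaleC_scaleC star_scaleC
        scaleC_add_right scaleC_diff_right star_minus scaleC_minus_left)
  then show "a = hermitian_part a + \<i> *\<^sub>C imaginary_part a"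
    by (simp add: hermitian_part_def scaleR_add_right scaleR_diff_right flip: scaleR_add_left)
qed

text \<open>Baire's theorem replaces the continuity of the involution.\<close>

lemma approximate_hermitian_parts:
  obtains L where "0 \<le> L"
    "\<And>y::'a::unital_banach_star_algebra. \<exists>h k. star h = h \<and> star k = k \<and> norm h \<le> L * norm y \<and>
      norm k \<le> L * norm y \<and> norm (y - (h + \<i> *\<^sub>C k)) \<le> norm y / 2"
proof -
  define A where "A = (\<lambda>n::nat. {h + \<i> *\<^sub>C k |h k :: 'a.
    star h = h \<and> star k = k \<and> norm h \<le> real n \<and> norm k \<le> real n})"
  have cover: "\<exists>n. a \<in> A n" for a
  proof -
    obtain n where "max (norm (hermitian_part a)) (norm (imaginary_part a)) \<le> real n"
      using real_arch_simple by blast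
    then show ?thesis
      unfolding A_def using hermitian_parts[of a] by auto
  qed
  have "\<exists>n. interior (closure (A n)) \<noteq> {}"
  proof (rule ccontr)
    assume "\<not> ?thesis"
    then have "euclidean interior_of (\<Union>(range (\<lambda>n. closure (A n)))) = {}"
      by (intro Met_TC.metric_Baire_category_alt[unfolded mtopology_is_euclidean])
        (auto simp only: mcomplete_iff_complete complete_UNIV countable_image countableI_type
          closed_closedin[symmetric] closed_closure euclidean_interior_of)
    moreover have "\<Union>(range (\<lambda>n. closure (A n))) = UNIV"
    proof -
      have "a \<in> \<Union>(range (\<lambda>n. closure (A n)))" for a
        using cover[of a] subsetD[OF closure_subset] by blast
      then show ?thesis by (simp add: set_eq_iff)
    qed
    ultimately show False by simp
  qed
  then obtain n x0 where "x0 \<in> interior (closure (A n))"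
    by blast
  then obtain r where r: "0 < r" "ball x0 r \<subseteq> closure (A n)"
    by (auto simp: mem_interior)
  define L where "L = 2 * real n / r"
  have L: "0 \<le> L" using r by (simp add: L_def)
  have "\<exists>h k. star h = h \<and> star k = k \<and> norm h \<le> L * norm y \<and> norm k \<le> L * norm y \<and>
      norm (y - (h + \<i> *\<^sub>C k)) \<le> norm y / 2" for y :: 'a
  proof (cases "y = 0")
    case True
    then show ?thesis by (intro exI[of _ 0]) simp
  next
    case False
    \<comment> \<open>The scaling makes \<open>norm u = r / 2\<close>, so that \<open>x0 + u\<close>
      and \<open>x0 - u\<close> lie in the ball. Subtracting their approximants \<open>p\<close> and
      \<open>q\<close> eliminates the centre \<open>x0\<close>. Multiplied by t/2, the error r/2
      becomes \<open>norm y / 2\<close>, and the bound 2 n on the hermitian parts becomes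
      \<open>L * norm y\<close>.\<close>
    define t where "t = 2 * norm y / r"
    have t: "0 < t" using False r by (simp add: t_def)
    define u where "u = inverse t *\<^sub>R y"
    have "norm u < r" using False r by (simp add: u_def t_def)
    then have "x0 + u \<in> closure (A n)" "x0 - u \<in> closure (A n)"
      using r(2) by (auto simp: dist_norm)
    then obtain p q where p: "p \<in> A n" "dist p (x0 + u) < r / 4"
      and q: "q \<in> A n" "dist q (x0 - u) < r / 4"
      unfolding closure_approachable using r(1) by (meson divide_pos_pos zero_less_numeral)
    obtain h k where hk: "p = h + \<i> *\<^sub>C k" "star h = h" "star k = k" "norm h \<le> n" "norm k \<le> n"
      using p(1) by (auto simp: A_def)
    obtain h' k' where hk': "q = h' + \<i> *\<^sub>C k'" "star h' = h'" "star k' = k'" "norm h' \<le> n" "norm k' \<le> n"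
      using q(1) by (auto simp: A_def)
    have nrm_le: "norm ((t / 2) *\<^sub>R (a - b)) \<le> L * norm y" if "norm a \<le> n" "norm b \<le> n" for a b :: 'a
    proof -
      have "norm (a - b) \<le> 2 * real n"
        using norm_triangle_ineq4[of a b] that by simp
      then have "t / 2 * norm (a - b) \<le> t / 2 * (2 * real n)"
        using t by (intro mult_left_mono) simp_all
      also have "t / 2 * (2 * real n) = L * norm y"
        by (simp add: t_def L_def)
      finally show ?thesis using t by (simp del: scaleR_diff_right)
    qed
    have "norm ((x0 + u - p) - (x0 - u - q)) \<le> r / 4 + r / 4"
      using p(2) q(2) norm_triangle_ineq4[of "x0 + u - p" "x0 - u - q"]
      by (simp add: dist_norm norm_minus_commute)
    then have "norm (2 *\<^sub>R u - (p - q)) \<le> r / 2"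
      by (simp add: scaleR_2 algebra_simps)
    then have "t / 2 * norm (2 *\<^sub>R u - (p - q)) \<le> t / 2 * (r / 2)"
      using t by (intro mult_left_mono) simp_all
    moreover have "y - (t / 2) *\<^sub>R (p - q) = (t / 2) *\<^sub>R (2 *\<^sub>R u - (p - q))"
      using t by (simp add: u_def scaleR_diff_right)
    ultimately have "norm (y - (t / 2) *\<^sub>R (p - q)) \<le> norm y / 2"
      using t r by (simp add: t_def)
    moreover have "(t / 2) *\<^sub>R (p - q) = (t / 2) *\<^sub>R (h - h') + \<i> *\<^sub>C ((t / 2) *\<^sub>R (k - k'))"
      unfolding hk(1) hk'(1) scaleR_eq_scaleC
      by (simp add: scaleC_add_right scaleC_diff_right scaleC_scaleC mult.commute)
    ultimately show ?thesis
      using nrm_le[OF hk(4) hk'(4)] nrm_le[OF hk(5) hk'(5)] hk hk'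
      by (intro exI[of _ "(t / 2) *\<^sub>R (h - h')"] exI[of _ "(t / 2) *\<^sub>R (k - k')"])
        (simp add: star_scaleR star_diff)
  qed
  with L show ?thesis by (rule that)
qed

text \<open>Iterated approximation of the remainder, as in the proof of the open mapping theorem.
  Both series converge absolutely, but with a discontinuous involution their sums need not be
  hermitian, so that only the combined limit is recorded.\<close>

lemma hermitian_series:
  obtains C where "0 \<le> C"
    "\<And>y::'a::unital_banach_star_algebra. \<exists>h k. (\<forall>j. star (h j) = h j) \<and> (\<forall>j. star (k j) = k j) \<and>
      (\<forall>j. norm (h j) \<le> C * norm y * (1 / 2) ^ j) \<and> (\<forall>j. norm (k j) \<le> C * norm y * (1 / 2) ^ j) \<and>
      (\<lambda>n. (\<Sum>j<n. h j) + \<i> *\<^sub>C (\<Sum>j<n. k j)) \<longlonglongrightarrow> y"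
proof -
  obtain L where L: "0 \<le> L"
    and ex: "\<And>y::'a. \<exists>h k. star h = h \<and> star k = k \<and> norm h \<le> L * norm y \<and>
      norm k \<le> L * norm y \<and> norm (y - (h + \<i> *\<^sub>C k)) \<le> norm y / 2"
    using approximate_hermitian_parts by blast
  obtain h k :: "'a \<Rightarrow> 'a" where hk: "\<And>y. star (h y) = h y" "\<And>y. star (k y) = k y"
    "\<And>y. norm (h y) \<le> L * norm y" "\<And>y. norm (k y) \<le> L * norm y"
    "\<And>y. norm (y - (h y + \<i> *\<^sub>C k y)) \<le> norm y / 2"
    using ex by metis
  \<comment> \<open>The remainder after one approximation; each application at least halves the
    norm.\<close>
  define R where "R = (\<lambda>y. y - (h y + \<i> *\<^sub>C k y))"
  have R: "norm ((R ^^ j) y) \<le> norm y * (1 / 2) ^ j" for j y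
  proof (induction j)
    case (Suc j)
    have "norm ((R ^^ Suc j) y) \<le> norm ((R ^^ j) y) / 2"
      using hk(5)[of "(R ^^ j) y"] by (simp add: R_def)
    then show ?case using Suc.IH by simp
  qed simp
  have part: "(\<Sum>j<n. h ((R ^^ j) y)) + \<i> *\<^sub>C (\<Sum>j<n. k ((R ^^ j) y)) = y - (R ^^ n) y" for n y
    by (induction n) (simp_all add: R_def scaleC_add_right algebra_simps)
  have "\<exists>h k. (\<forall>j. star (h j) = h j) \<and> (\<forall>j. star (k j) = k j) \<and>
      (\<forall>j. norm (h j) \<le> L * norm y * (1 / 2) ^ j) \<and> (\<forall>j. norm (k j) \<le> L * norm y * (1 / 2) ^ j) \<and>
      (\<lambda>n. (\<Sum>j<n. h j) + \<i> *\<^sub>C (\<Sum>j<n. k j)) \<longlonglongrightarrow> y" for y :: 'a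
  proof (intro exI conjI allI)
    show "norm (h ((R ^^ j) y)) \<le> L * norm y * (1 / 2) ^ j" for j
      using order_trans[OF hk(3) mult_left_mono[OF R L]] by (simp add: mult.assoc)
    show "norm (k ((R ^^ j) y)) \<le> L * norm y * (1 / 2) ^ j" for j
      using order_trans[OF hk(4) mult_left_mono[OF R L]] by (simp add: mult.assoc)
    have "(\<lambda>n. norm y * (1 / 2) ^ n) \<longlonglongrightarrow> norm y * 0"
      by (intro tendsto_intros LIMSEQ_power_zero) simp
    then have "(\<lambda>n. (R ^^ n) y) \<longlonglongrightarrow> 0"
      by (intro Lim_null_comparison[OF always_eventually[OF allI[OF R]]]) simp
    then have "(\<lambda>n. y - (R ^^ n) y) \<longlonglongrightarrow> y - 0"
      by (intro tendsto_intros)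
    then show "(\<lambda>n. (\<Sum>j<n. h ((R ^^ j) y)) + \<i> *\<^sub>C (\<Sum>j<n. k ((R ^^ j) y))) \<longlonglongrightarrow> y"
      unfolding part by simp
  qed (rule hk)+
  with L show ?thesis by (rule that)
qed

lemma tendsto_scaleC:
  fixes x :: "'i \<Rightarrow> 'v::complex_normed_vector"
  assumes "(x \<longlongrightarrow> z) F"
  shows "((\<lambda>n. c *\<^sub>C x n) \<longlongrightarrow> c *\<^sub>C z) F"
proof -
  have "((\<lambda>n. cmod c * norm (x n - z)) \<longlongrightarrow> cmod c * 0) F"
    using assms by (intro tendsto_intros) (simp add: tendsto_norm_zero_iff Lim_null[symmetric])
  then show ?thesis
    by (subst Lim_null, subst tendsto_norm_zero_iff[symmetric])
      (simp add: scaleC_diff_right[symmetric] norm_scaleC)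
qed

context pos_functional
begin

text \<open>The partial sums of \<open>hermitian_series\<close> are hermitian, hence bounded in
  seminorm by a multiple of \<open>norm y\<close>. What remains of \<open>y\<close> has the
  hermitian parts \<open>x n\<close> and \<open>z n\<close>, whose seminorms tend to 0 by
  \<open>nrm_tendsto_0_if_hermitian_parts\<close>.\<close>

lemma nrm_bounded:
  obtains C where "0 \<le> C" "\<And>y. nrm y \<le> C * norm y"
proof -
  obtain L where L: "0 \<le> L"
    and ex: "\<And>y::'a. \<exists>h k. (\<forall>j. star (h j) = h j) \<and> (\<forall>j. star (k j) = k j) \<and>
      (\<forall>j. norm (h j) \<le> L * norm y * (1 / 2) ^ j) \<and> (\<forall>j. norm (k j) \<le> L * norm y * (1 / 2) ^ j) \<and>
      (\<lambda>n. (\<Sum>j<n. h j) + \<i> *\<^sub>C (\<Sum>j<n. k j)) \<longlonglongrightarrow> y"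
    using hermitian_series by blast
  \<comment> \<open>The inner factor 2 comes from \<open>nrm_hermitian_le\<close>, the outer one is
    the sum of the geometric series. The claim below has a further 2 for the two series.\<close>
  define C where "C = 2 * (2 * nrm 1 * L)"
  have "nrm y \<le> 2 * C * norm y" for y
  proof -
    obtain h k where herm: "\<And>j. star (h j) = h j" "\<And>j. star (k j) = k j"
      and le: "\<And>j. norm (h j) \<le> L * norm y * (1 / 2) ^ j" "\<And>j. norm (k j) \<le> L * norm y * (1 / 2) ^ j"
      and lim: "(\<lambda>n. (\<Sum>j<n. h j) + \<i> *\<^sub>C (\<Sum>j<n. k j)) \<longlonglongrightarrow> y"
      using ex[of y] by auto
    have conv: "(\<lambda>n. \<Sum>j<n. g j) \<longlonglongrightarrow> suminf g"
      if "\<And>j. norm (g j) \<le> L * norm y * (1 / 2) ^ j" for g :: "nat \<Rightarrow> 'a"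
    proof -
      have "summable g"
        by (rule summable_comparison_test'[of "\<lambda>j. L * norm y * (1 / 2) ^ j"])
          (auto intro!: summable_mult summable_geometric that)
      then show ?thesis using summable_LIMSEQ by blast
    qed
    have star_sum: "star (\<Sum>j<n. g j) = (\<Sum>j<n. g j)" if "\<And>j. star (g j) = g j" for n and g :: "nat \<Rightarrow> 'a"
      by (induction n) (simp_all add: star_add that)
    have nrm_sum: "nrm (\<Sum>j<n. g j) \<le> C * norm y"
      if "\<And>j. star (g j) = g j" "\<And>j. norm (g j) \<le> L * norm y * (1 / 2) ^ j" for n and g :: "nat \<Rightarrow> 'a"
    proof -
      have nn: "0 \<le> nrm 1 * L * norm y" using L by (simp add: mult_nonneg_nonneg)
      have g: "nrm (g j) \<le> 2 * nrm 1 * L * norm y * (1 / 2) ^ j" for j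
        using order_trans[OF nrm_hermitian_le[OF that(1)] mult_left_mono[OF that(2)]]
        by (simp add: mult_ac)
      have "nrm (\<Sum>j<n. g j) \<le> 2 * nrm 1 * L * norm y * (\<Sum>j<n. (1 / 2) ^ j)"
      proof (induction n)
        case (Suc n)
        then show ?case
          using nrm_triangle[of "\<Sum>j<n. g j" "g n"] g[of n] by (simp add: algebra_simps)
      qed simp
      also have "\<dots> \<le> 2 * nrm 1 * L * norm y * 2"
        by (rule mult_left_mono) (use nn in \<open>simp_all add: sum_gp_strict mult.assoc\<close>)
      finally show ?thesis by (simp add: C_def mult_ac)
    qed
    define x where "x = (\<lambda>n. hermitian_part y - (\<Sum>j<n. h j))"
    define z where "z = (\<lambda>n. imaginary_part y - (\<Sum>j<n. k j))"
    have y: "hermitian_part y + \<i> *\<^sub>C imaginary_part y = y"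
      using hermitian_parts(3)[of y] by simp
    \<comment> \<open>The limits of \<open>x\<close> and \<open>z\<close> therefore combine to 0,
      though neither of them need be 0.\<close>
    have y_eq: "suminf h + \<i> *\<^sub>C suminf k = y"
      using LIMSEQ_unique[OF tendsto_add[OF conv[OF le(1)] tendsto_scaleC[OF conv[OF le(2)]]] lim] .
    have herm_xz: "star (x n) = x n" "star (z n) = z n" for n
      by (simp_all add: x_def z_def star_diff hermitian_parts star_sum herm)
    have lim_x: "x \<longlonglongrightarrow> hermitian_part y - suminf h" and lim_z: "z \<longlonglongrightarrow> imaginary_part y - suminf k"
      unfolding x_def z_def using conv[OF le(1)] conv[OF le(2)] by (intro tendsto_intros; simp)+
    have "hermitian_part y - suminf h + \<i> *\<^sub>C (imaginary_part y - suminf k) =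
      (hermitian_part y + \<i> *\<^sub>C imaginary_part y) - (suminf h + \<i> *\<^sub>C suminf k)"
      by (simp add: scaleC_diff_right algebra_simps)
    also have "\<dots> = 0" unfolding y y_eq by simp
    finally have 0: "hermitian_part y - suminf h + \<i> *\<^sub>C (imaginary_part y - suminf k) = 0" .
    have "nrm y \<le> nrm (x n) + nrm (z n) + 2 * C * norm y" for n
    proof -
      have "nrm (a + \<i> *\<^sub>C b) \<le> nrm a + nrm b" for a b
        using nrm_triangle[of a "\<i> *\<^sub>C b"] by (simp add: nrm_scale)
      from this[of "x n" "z n"] this[of "\<Sum>j<n. h j" "\<Sum>j<n. k j"]
      have "nrm (x n + \<i> *\<^sub>C z n) \<le> nrm (x n) + nrm (z n)"
        "nrm ((\<Sum>j<n. h j) + \<i> *\<^sub>C (\<Sum>j<n. k j)) \<le> 2 * C * norm y"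
        using nrm_sum[OF herm(1) le(1), of n] nrm_sum[OF herm(2) le(2), of n] by simp_all
      moreover have "(x n + \<i> *\<^sub>C z n) + ((\<Sum>j<n. h j) + \<i> *\<^sub>C (\<Sum>j<n. k j)) = y"
        unfolding x_def z_def scaleC_diff_right using y by (simp add: algebra_simps)
      ultimately show ?thesis
        using nrm_triangle[of "x n + \<i> *\<^sub>C z n" "(\<Sum>j<n. h j) + \<i> *\<^sub>C (\<Sum>j<n. k j)"] by simp
    qed
    moreover have "(\<lambda>n. nrm (x n) + nrm (z n) + 2 * C * norm y) \<longlonglongrightarrow> 0 + 0 + 2 * C * norm y"
      using nrm_tendsto_0_if_hermitian_parts[of x z, OF herm_xz lim_x lim_z 0]
      by (intro tendsto_intros)
    ultimately show ?thesis
      using LIMSEQ_le_const[of "\<lambda>n. nrm (x n) + nrm (z n) + 2 * C * norm y" "2 * C * norm y" "nrm y"]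
      by simp
  qed
  moreover have "0 \<le> 2 * C" using L by (simp add: C_def)
  ultimately show ?thesis by (rule that[rotated])
qed

end

section \<open>Projections in Hilbert spaces\<close>

context semi_inner
begin

text \<open>Descent along \<open>y\<close> with a step r such that
  \<open>r * (nrm y)\<^sup>2 \<le> 1\<close>: the quadratic gain is then at most half of the linear
  loss, which contradicts minimality unless \<open>s x y = 0\<close>. The summand 1 in the
  denominator of r covers \<open>nrm y = 0\<close>.\<close>

lemma orthogonal_if_nrm_minimal:
  assumes x: "x \<in> V" and y: "y \<in> V" and min: "\<And>t. nrm x \<le> nrm (x + t *\<^sub>C y)"
  shows "s x y = 0"
proof -
  define c where "c = (cmod (s x y))\<^sup>2"
  define r where "r = 1 / ((nrm y)\<^sup>2 + 1)"
  have pos: "0 < (nrm y)\<^sup>2 + 1" by (simp add: add_nonneg_pos)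
  then have r: "0 < r" "r * (nrm y)\<^sup>2 \<le> 1" by (simp_all add: r_def field_simps)
  have "(nrm x)\<^sup>2 \<le> (nrm (x + (- complex_of_real r * s x y) *\<^sub>C y))\<^sup>2"
    using min x by (simp add: power_mono)
  then have "2 * r * c \<le> r\<^sup>2 * c * (nrm y)\<^sup>2"
    unfolding nrm_sq_add_scale[OF x y] c_def by simp
  also have "\<dots> = r * c * (r * (nrm y)\<^sup>2)" by (simp add: power2_eq_square)
  also have "\<dots> \<le> r * c * 1"
    using r by (intro mult_left_mono) (simp_all add: c_def)
  finally have "c \<le> 0" using r by simp
  then show ?thesis by (simp add: c_def)
qed

lemma parallelogram:
  assumes x: "x \<in> V" and y: "y \<in> V"
  shows "(nrm (x + y))\<^sup>2 + (nrm (x - y))\<^sup>2 = 2 * (nrm x)\<^sup>2 + 2 * (nrm y)\<^sup>2"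
  using x y by (simp add: nrm_sq add_mem diff_mem add_left add_right diff_left diff_right)

lemma tendsto_inner:
  assumes X: "\<And>n. X n \<in> V" and l: "l \<in> V" and y: "y \<in> V" and lim: "(\<lambda>n. nrm (X n - l)) \<longlonglongrightarrow> 0"
  shows "(\<lambda>n. s (X n) y) \<longlonglongrightarrow> s l y"
proof -
  have "cmod (s (X n) y - s l y) \<le> nrm (X n - l) * nrm y" for n
    using cauchy_schwarz[of "X n - l" y] X l y by (simp add: diff_left diff_mem)
  moreover have "(\<lambda>n. nrm (X n - l) * nrm y) \<longlonglongrightarrow> 0"
    using lim by (rule tendsto_mult_left_zero)
  ultimately have "(\<lambda>n. s (X n) y - s l y) \<longlonglongrightarrow> 0"
    by (rule LIMSEQ_null_comparison)
  then show ?thesis by (simp add: LIM_zero_iff)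
qed

lemma tendsto_nrm:
  assumes X: "\<And>n. X n \<in> V" and l: "l \<in> V" and lim: "(\<lambda>n. nrm (X n - l)) \<longlonglongrightarrow> 0"
  shows "(\<lambda>n. nrm (X n)) \<longlonglongrightarrow> nrm l"
proof -
  have "norm (nrm (X n) - nrm l) \<le> nrm (X n - l)" for n
    using nrm_le[of "X n" l] nrm_le[of l "X n"] nrm_diff_commute[of l "X n"] X l by simp
  then have "(\<lambda>n. nrm (X n) - nrm l) \<longlonglongrightarrow> 0"
    by (rule LIMSEQ_null_comparison[OF _ lim])
  then show ?thesis by (simp add: LIM_zero_iff)
qed

end

section \<open>Inner product spaces as metric spaces, and orthogonal projections\<close>

locale pre_hilbert =
  fixes H :: "'v::complex_vector inner_space"
  assumes pre_hilbert: "pre_hilbert_space H"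
begin

sublocale semi_inner "carrier H" "ip H"
proof
  have 0: "0 \<in> carrier H"
    and add: "\<forall>x\<in>carrier H. \<forall>y\<in>carrier H. x + y \<in> carrier H"
    and scale: "\<forall>c. \<forall>x\<in>carrier H. c *\<^sub>C x \<in> carrier H"
    and ip_add: "\<forall>x\<in>carrier H. \<forall>y\<in>carrier H. \<forall>z\<in>carrier H. ip H (x + y) z = ip H x z + ip H y z"
    and ip_scale: "\<forall>c. \<forall>x\<in>carrier H. \<forall>y\<in>carrier H. ip H (c *\<^sub>C x) y = c * ip H x y"
    and herm: "\<forall>x\<in>carrier H. \<forall>y\<in>carrier H. ip H y x = cnj (ip H x y)"
    and ip_pos: "\<forall>x\<in>carrier H. 0 \<le> ip H x x"
    using pre_hilbert unfolding pre_hilbert_space_def by - (elim conjE, assumption)+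
  show "0 \<in> carrier H" by (rule 0)
  show "x \<in> carrier H \<Longrightarrow> y \<in> carrier H \<Longrightarrow> x + y \<in> carrier H" for x y
    using add by blast
  show "x \<in> carrier H \<Longrightarrow> c *\<^sub>C x \<in> carrier H" for c x
    using scale by blast
  show "x \<in> carrier H \<Longrightarrow> y \<in> carrier H \<Longrightarrow> z \<in> carrier H \<Longrightarrow> ip H (x + y) z = ip H x z + ip H y z" for x y z
    using ip_add by blast
  show "x \<in> carrier H \<Longrightarrow> y \<in> carrier H \<Longrightarrow> ip H (c *\<^sub>C x) y = c * ip H x y" for c x y
    using ip_scale by blast
  show "x \<in> carrier H \<Longrightarrow> y \<in> carrier H \<Longrightarrow> ip H y x = cnj (ip H x y)" for x y
    using herm by blast
  show "x \<in> carrier H \<Longrightarrow> 0 \<le> ip H x x" for x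
    using ip_pos by blast
qed

lemma hnorm_eq: "hnorm H = nrm"
  by (rule ext) (simp add: hnorm_def nrm_def)

lemma ip_definite: "x \<in> carrier H \<Longrightarrow> ip H x x = 0 \<Longrightarrow> x = 0"
  using pre_hilbert unfolding pre_hilbert_space_def by blast

lemma nrm_definite: "x \<in> carrier H \<Longrightarrow> nrm x = 0 \<Longrightarrow> x = 0"
  by (simp add: ip_definite self_eq)

lemma hdist_eq: "x \<in> carrier H \<Longrightarrow> y \<in> carrier H \<Longrightarrow> hdist H x y = nrm (x - y)"
  by (simp add: hdist_def hnorm_eq)

sublocale Metric_space "carrier H" "hdist H"
proof
  show "0 \<le> hdist H x y" for x y
    by (simp add: hdist_def hnorm_eq diff_mem)
  show "hdist H x y = hdist H y x" for x y
    by (simp add: hdist_def hnorm_eq nrm_diff_commute)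
  show "hdist H x y = 0 \<longleftrightarrow> x = y" if "x \<in> carrier H" "y \<in> carrier H" for x y
    using that nrm_definite[of "x - y"] by (auto simp: hdist_eq diff_mem)
  show "hdist H x z \<le> hdist H x y + hdist H y z"
    if "x \<in> carrier H" "y \<in> carrier H" "z \<in> carrier H" for x y z
    using that by (simp add: hdist_eq nrm_triangle_diff)
qed

lemma limitin_iff:
  assumes "\<And>n. X n \<in> carrier H"
  shows "limitin mtopology X l sequentially \<longleftrightarrow> l \<in> carrier H \<and> (\<lambda>n. nrm (X n - l)) \<longlonglongrightarrow> 0"
proof (cases "l \<in> carrier H")
  case True
  then show ?thesis
    unfolding limitin_metric lim_sequentially
    using assms by (simp add: eventually_sequentially hdist_eq diff_mem dist_real_def)
qed (simp add: limitin_metric)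

lemma MCauchy_iff:
  "MCauchy X \<longleftrightarrow> (\<forall>n. X n \<in> carrier H) \<and> (\<forall>\<epsilon>>0. \<exists>N. \<forall>m\<ge>N. \<forall>n\<ge>N. nrm (X m - X n) < \<epsilon>)"
  by (auto simp: MCauchy_def hdist_eq image_subset_iff; fastforce simp: hdist_eq)

lemma dense_in_iff:
  "dense_in H S \<longleftrightarrow> S \<subseteq> carrier H \<and> (\<forall>x\<in>carrier H. \<forall>\<epsilon>>0. \<exists>y\<in>S. nrm (x - y) < \<epsilon>)"
proof (cases "S \<subseteq> carrier H")
  case True
  then have *: "(\<exists>y\<in>S. y \<in> mball x r) \<longleftrightarrow> (\<exists>y\<in>S. nrm (x - y) < r)" if "x \<in> carrier H" for x r
    using that by (auto simp: hdist_eq subset_iff)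
  have "mtopology closure_of S = {x \<in> carrier H. \<forall>r>0. \<exists>y\<in>S. nrm (x - y) < r}"
    unfolding metric_closure_of by (intro Collect_cong conj_cong refl) (simp only: *)
  then show ?thesis
    unfolding dense_in_def using True by (simp only:) blast
qed (simp add: dense_in_def)

text \<open>\<open>x - y\<close> is the limit of the vectors \<open>d n\<close> in \<open>D\<close>,
  and orthogonality to a fixed vector passes to limits. The sequence stands in for membership in the
  closure of \<open>D\<close>.\<close>

lemma orth_proj_residual:
  assumes D: "D \<subseteq> carrier H" and x: "x \<in> carrier H" and y: "y \<in> orth_compl H D"
    and d: "\<And>n. d n \<in> D" and lim: "(\<lambda>n. nrm ((x - d n) - y)) \<longlonglongrightarrow> 0"
  shows "x - y \<in> orth_compl H (orth_compl H D)"
proof -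
  have dc: "d n \<in> carrier H" for n using d D by blast
  have yc: "y \<in> carrier H" using y by (simp add: orth_compl_def)
  have "ip H (x - y) m = 0" if m: "m \<in> orth_compl H D" for m
  proof -
    have mc: "m \<in> carrier H" using m by (simp add: orth_compl_def)
    have "(\<lambda>n. nrm (d n - (x - y))) \<longlonglongrightarrow> 0"
    proof -
      have "nrm (d n - (x - y)) = nrm ((x - d n) - y)" for n
        using nrm_diff_commute[of "d n" "x - y"] dc x yc by (simp add: diff_mem algebra_simps)
      then show ?thesis using lim by simp
    qed
    then have "(\<lambda>n. ip H (d n) m) \<longlonglongrightarrow> ip H (x - y) m"
      using dc x yc mc by (intro tendsto_inner) (auto simp: diff_mem)
    moreover have "ip H (d n) m = 0" for n
      using m d[of n] hermitian[OF mc dc, of n] by (simp add: orth_compl_def)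
    ultimately show ?thesis by (simp add: LIMSEQ_const_iff)
  qed
  then show ?thesis
    using x yc by (auto simp: orth_compl_def diff_mem)
qed

text \<open>Uniqueness for the description in \<open>orth_proj\<close>: two candidates differ by an
  element of \<open>orth_compl H D\<close> which, as a difference of residuals, is orthogonal to
  \<open>orth_compl H D\<close>, hence to itself.\<close>

lemma orth_proj_eqI:
  assumes D: "D \<subseteq> carrier H" and x: "x \<in> carrier H" and y: "y \<in> orth_compl H D"
    and d: "\<And>n. d n \<in> D" and lim: "(\<lambda>n. nrm ((x - d n) - y)) \<longlonglongrightarrow> 0"
  shows "orth_proj H (orth_compl H D) x = y"
  unfolding orth_proj_def
proof (rule the_equality)
  have yc: "y \<in> carrier H" using y by (simp add: orth_compl_def)
  show *: "y \<in> orth_compl H D \<and> x - y \<in> orth_compl H (orth_compl H D)"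
    using y orth_proj_residual[OF assms] by simp
  fix y' assume y': "y' \<in> orth_compl H D \<and> x - y' \<in> orth_compl H (orth_compl H D)"
  have y'c: "y' \<in> carrier H" using y' by (simp add: orth_compl_def)
  have M: "y' - y \<in> orth_compl H D"
    using y y' D yc y'c by (auto simp: orth_compl_def diff_mem diff_left subset_iff)
  have "ip H (x - y) (y' - y) = 0" "ip H (x - y') (y' - y) = 0"
    using * y' M by (simp_all add: orth_compl_def[of H "orth_compl H D"])
  moreover have "y' - y = (x - y) - (x - y')" by simp
  ultimately have "ip H (y' - y) (y' - y) = 0"
    using x yc y'c by (metis diff_left diff_mem diff_self)
  then show "y' = y"
    using ip_definite[of "y' - y"] yc y'c by (simp add: diff_mem)
qed

end

locale hilbert = pre_hilbert +
  assumes complete: "mcomplete"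
begin

lemma Cauchy_limit:
  assumes "\<And>n. X n \<in> carrier H" "\<And>\<epsilon>. 0 < \<epsilon> \<Longrightarrow> \<exists>N. \<forall>m\<ge>N. \<forall>n\<ge>N. nrm (X m - X n) < \<epsilon>"
  obtains l where "l \<in> carrier H" "(\<lambda>n. nrm (X n - l)) \<longlonglongrightarrow> 0"
  using complete assms unfolding mcomplete_def by (metis MCauchy_iff limitin_iff)

text \<open>A minimising sequence for the distance from \<open>x\<close> to \<open>D\<close>. As
  \<open>D\<close> may fail to be closed, there need be no nearest point in \<open>D\<close>; the
  sequence itself is returned, in the form needed for \<open>orth_proj_eqI\<close> and for the
  transport to a second space.\<close>

lemma projection_exists:
  assumes D: "D \<subseteq> carrier H" "0 \<in> D" and D_add: "\<And>a b. a \<in> D \<Longrightarrow> b \<in> D \<Longrightarrow> a + b \<in> D"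
    and D_scale: "\<And>c a. a \<in> D \<Longrightarrow> c *\<^sub>C a \<in> D" and x: "x \<in> carrier H"
  obtains y d where "y \<in> orth_compl H D" "\<And>n. d n \<in> D" "(\<lambda>n. nrm ((x - d n) - y)) \<longlonglongrightarrow> 0"
proof -
  have Dc: "a \<in> carrier H" if "a \<in> D" for a using that D by blast
  define \<delta> where "\<delta> = (INF a\<in>D. nrm (x - a))"
  have bdd: "bdd_below ((\<lambda>a. nrm (x - a)) ` D)"
    using x Dc by (intro bdd_belowI2[of _ 0]) (simp add: diff_mem)
  have \<delta>_le: "\<delta> \<le> nrm (x - a)" if "a \<in> D" for a
    unfolding \<delta>_def by (rule cINF_lower[OF bdd that])
  have \<delta>0: "0 \<le> \<delta>"
    unfolding \<delta>_def using D(2) x Dc by (intro cINF_greatest) (auto simp: diff_mem)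
  have "\<exists>a\<in>D. nrm (x - a) < \<delta> + 1 / real (Suc n)" for n
    using cINF_less_iff[OF _ bdd, of "\<delta> + 1 / real (Suc n)"] D(2) by (auto simp: \<delta>_def)
  then obtain d where d: "\<And>n. d n \<in> D" "\<And>n. nrm (x - d n) < \<delta> + 1 / real (Suc n)"
    by metis
  have lim0: "(\<lambda>n. 1 / real (Suc n)) \<longlonglongrightarrow> 0"
    using LIMSEQ_inverse_real_of_nat by (simp add: inverse_eq_divide)
  \<comment> \<open>The parallelogram law with the midpoint \<open>a\<close> of \<open>d m\<close>
    and \<open>d n\<close>, whose distance from \<open>x\<close> is at least \<delta> since it lies
    in \<open>D\<close>.\<close>
  have sq: "(nrm (d m - d n))\<^sup>2 \<le> 2 * ((\<delta> + 1 / real (Suc m))\<^sup>2 - \<delta>\<^sup>2) + 2 * ((\<delta> + 1 / real (Suc n))\<^sup>2 - \<delta>\<^sup>2)" for m n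
  proof -
    define a where "a = (1 / 2) *\<^sub>C (d m + d n)"
    have a: "a \<in> D" using d D_add D_scale by (simp add: a_def)
    have "(x - d m) + (x - d n) = 2 *\<^sub>C (x - a)"
      using scaleC_add_left[of 1 1 x]
      by (simp add: a_def scaleC_diff_right scaleC_scaleC scaleC_one algebra_simps)
    then have "nrm ((x - d m) + (x - d n)) = 2 * nrm (x - a)"
      using x Dc[OF a] by (simp add: nrm_scale diff_mem)
    then have "(nrm ((x - d m) + (x - d n)))\<^sup>2 \<ge> 4 * \<delta>\<^sup>2"
      using power_mono[OF \<delta>_le[OF a] \<delta>0, of 2] by (simp add: power_mult_distrib)
    moreover have "(nrm ((x - d m) - (x - d n)))\<^sup>2 = (nrm (d m - d n))\<^sup>2"
      using nrm_diff_commute[of "d m" "d n"] Dc d by simp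
    moreover have "(nrm (x - d k))\<^sup>2 \<le> (\<delta> + 1 / real (Suc k))\<^sup>2" for k
      using d(2)[of k] x Dc[OF d(1)] by (intro power_mono) (simp_all add: diff_mem)
    ultimately show ?thesis
      using parallelogram[of "x - d m" "x - d n"] x Dc[OF d(1)] by (smt (verit) diff_mem)
  qed
  have "\<exists>N. \<forall>m\<ge>N. \<forall>n\<ge>N. nrm ((x - d m) - (x - d n)) < \<epsilon>" if e: "0 < \<epsilon>" for \<epsilon>
  proof -
    have "(\<lambda>n. (\<delta> + 1 / real (Suc n))\<^sup>2 - \<delta>\<^sup>2) \<longlonglongrightarrow> (\<delta> + 0)\<^sup>2 - \<delta>\<^sup>2"
      by (intro tendsto_intros lim0)
    then have "\<forall>\<^sub>F n in sequentially. (\<delta> + 1 / real (Suc n))\<^sup>2 - \<delta>\<^sup>2 < \<epsilon>\<^sup>2 / 4"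
      using e by (intro order_tendstoD(2)) auto
    then obtain N where N: "\<And>n. N \<le> n \<Longrightarrow> (\<delta> + 1 / real (Suc n))\<^sup>2 - \<delta>\<^sup>2 < \<epsilon>\<^sup>2 / 4"
      by (auto simp: eventually_sequentially)
    have "nrm ((x - d m) - (x - d n)) < \<epsilon>" if "N \<le> m" "N \<le> n" for m n
    proof -
      have "(nrm (d m - d n))\<^sup>2 < \<epsilon>\<^sup>2"
        using sq[of m n] N[OF that(1)] N[OF that(2)] by simp
      then have "nrm (d m - d n) < \<epsilon>"
        using e by (intro power2_less_imp_less[of _ \<epsilon>]) simp_all
      moreover have "nrm (d m - d n) = nrm (d n - d m)"
        using Dc d by (simp add: nrm_diff_commute)
      ultimately show ?thesis by simp
    qed
    then show ?thesis by blast
  qed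
  then obtain y where y: "y \<in> carrier H" "(\<lambda>n. nrm ((x - d n) - y)) \<longlonglongrightarrow> 0"
    using Cauchy_limit[of "\<lambda>n. x - d n"] x Dc d diff_mem by metis
  have "nrm y \<le> \<delta>"
  proof (rule LIMSEQ_le)
    show "(\<lambda>n. nrm (x - d n)) \<longlonglongrightarrow> nrm y"
      using x Dc d y by (intro tendsto_nrm) (auto simp: diff_mem)
    show "(\<lambda>n. \<delta> + 1 / real (Suc n)) \<longlonglongrightarrow> \<delta>"
      using tendsto_add[OF tendsto_const lim0] by simp
    show "\<exists>N. \<forall>n\<ge>N. nrm (x - d n) \<le> \<delta> + 1 / real (Suc n)"
      using d(2) less_imp_le by blast
  qed
  moreover have "\<delta> \<le> nrm (y + a)" if a: "a \<in> D" for a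
  proof (rule LIMSEQ_le_const)
    have "(\<lambda>n. nrm ((x - d n + a) - (y + a))) \<longlonglongrightarrow> 0"
      using y(2) by simp
    then show "(\<lambda>n. nrm (x - d n + a)) \<longlonglongrightarrow> nrm (y + a)"
      using x Dc d y a by (intro tendsto_nrm) (auto simp: diff_mem add_mem)
    have "\<delta> \<le> nrm (x - d n + a)" for n
    proof -
      have "d n + (-1) *\<^sub>C a \<in> D" using d a D_add D_scale by blast
      from \<delta>_le[OF this] show ?thesis by (simp add: scaleC_minus_one algebra_simps)
    qed
    then show "\<exists>N. \<forall>n\<ge>N. \<delta> \<le> nrm (x - d n + a)" by blast
  qed
  ultimately have min: "nrm y \<le> nrm (y + a)" if "a \<in> D" for a
    using that order_trans by blast
  have "ip H y a = 0" if "a \<in> D" for a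
    by (rule orthogonal_if_nrm_minimal[OF y(1) Dc[OF that] min[OF D_scale[OF that]]])
  then have "y \<in> orth_compl H D" using y by (simp add: orth_compl_def)
  from that[OF this d(1) y(2)] show ?thesis .
qed

end

lemma hilbertI: "hilbert_space H \<Longrightarrow> hilbert H"
  unfolding hilbert_space_def hilbert_def pre_hilbert_def hilbert_axioms_def .

section \<open>Orthogonal sums and the comparison of projections\<close>

lemma pre_hilbert_prod_space:
  assumes "pre_hilbert_space H" "pre_hilbert_space K"
  shows "pre_hilbert_space (prod_space H K)"
proof -
  interpret H: pre_hilbert H by unfold_locales fact
  interpret K: pre_hilbert K by unfold_locales fact
  have def: "x = 0" if x: "x \<in> carrier (prod_space H K)" "ip (prod_space H K) x x = 0" for x
  proof -
    have "0 \<le> ip H (fst x) (fst x)" "0 \<le> ip K (snd x) (snd x)"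
      using x(1) by (auto simp: prod_space_def H.pos K.pos)
    then have "ip H (fst x) (fst x) = 0" "ip K (snd x) (snd x) = 0"
      using x(2) by (auto simp: prod_space_def add_nonneg_eq_0_iff)
    then show ?thesis
      using x(1) by (auto simp: prod_space_def prod_eq_iff mem_Times_iff intro: H.ip_definite K.ip_definite)
  qed
  have c: "x \<in> carrier (prod_space H K) \<longleftrightarrow> fst x \<in> carrier H \<and> snd x \<in> carrier K" for x
    by (simp add: prod_space_def mem_Times_iff)
  have ip: "ip (prod_space H K) x y = ip H (fst x) (fst y) + ip K (snd x) (snd y)" for x y
    by (simp add: prod_space_def)
  show ?thesis
    unfolding pre_hilbert_space_def
  proof (intro conjI ballI allI impI)
    show "0 \<in> carrier (prod_space H K)"
      by (simp add: c H.zero_mem K.zero_mem)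
    fix x assume x: "x \<in> carrier (prod_space H K)"
    then have x': "fst x \<in> carrier H" "snd x \<in> carrier K" by (simp_all add: c)
    show "a *\<^sub>C x \<in> carrier (prod_space H K)" for a
      using x' by (simp add: c scaleC_prod_def H.scale_mem K.scale_mem)
    show "0 \<le> ip (prod_space H K) x x"
      using x' by (simp add: ip H.pos K.pos)
    show "x = 0" if "ip (prod_space H K) x x = 0"
      using def x that .
    fix y assume "y \<in> carrier (prod_space H K)"
    then have y': "fst y \<in> carrier H" "snd y \<in> carrier K" by (simp_all add: c)
    show "x + y \<in> carrier (prod_space H K)"
      using x' y' by (simp add: c H.add_mem K.add_mem)
    show "ip (prod_space H K) (a *\<^sub>C x) y = a * ip (prod_space H K) x y" for a
      using x' y' by (simp add: ip scaleC_prod_def H.scale_left K.scale_left distrib_left)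
    show "ip (prod_space H K) y x = cnj (ip (prod_space H K) x y)"
      using H.hermitian[OF x'(1) y'(1)] K.hermitian[OF x'(2) y'(2)] by (simp add: ip)
    fix z assume "z \<in> carrier (prod_space H K)"
    then have "fst z \<in> carrier H" "snd z \<in> carrier K" by (simp_all add: c)
    then show "ip (prod_space H K) (x + y) z = ip (prod_space H K) x z + ip (prod_space H K) y z"
      using x' y' by (simp add: ip H.add_left K.add_left)
  qed
qed

lemma hilbert_prod_space:
  assumes H: "hilbert_space H" and K: "hilbert_space K"
  shows "hilbert (prod_space H K)"
proof -
  interpret H: hilbert H by (rule hilbertI) fact
  interpret K: hilbert K by (rule hilbertI) fact
  interpret P: pre_hilbert "prod_space H K"
    by unfold_locales (rule pre_hilbert_prod_space[OF H.pre_hilbert K.pre_hilbert])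
  have c: "x \<in> carrier (prod_space H K) \<longleftrightarrow> fst x \<in> carrier H \<and> snd x \<in> carrier K" for x
    by (simp add: prod_space_def mem_Times_iff)
  have sq: "(P.nrm x)\<^sup>2 = (H.nrm (fst x))\<^sup>2 + (K.nrm (snd x))\<^sup>2" if "x \<in> carrier (prod_space H K)" for x
    using that by (simp add: P.nrm_sq H.nrm_sq K.nrm_sq c) (simp add: prod_space_def)
  have "P.mcomplete"
    unfolding P.mcomplete_def
  proof (intro allI impI)
    fix X assume "P.MCauchy X"
    then have X: "\<And>n. X n \<in> carrier (prod_space H K)"
      and Cauchy: "\<And>\<epsilon>. 0 < \<epsilon> \<Longrightarrow> \<exists>N. \<forall>m\<ge>N. \<forall>n\<ge>N. P.nrm (X m - X n) < \<epsilon>"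
      by (simp_all add: P.MCauchy_iff)
    have D: "X m - X n \<in> carrier (prod_space H K)" for m n
      by (rule P.diff_mem[OF X X])
    have le1: "H.nrm (fst (X m) - fst (X n)) \<le> P.nrm (X m - X n)" for m n
      by (rule power2_le_imp_le[OF _ P.nrm_nonneg[OF D]]) (use sq[OF D, of m n] in simp)
    have le2: "K.nrm (snd (X m) - snd (X n)) \<le> P.nrm (X m - X n)" for m n
      by (rule power2_le_imp_le[OF _ P.nrm_nonneg[OF D]]) (use sq[OF D, of m n] in simp)
    obtain l where l: "l \<in> carrier H" "(\<lambda>n. H.nrm (fst (X n) - l)) \<longlonglongrightarrow> 0"
    proof -
      have "\<exists>N. \<forall>m\<ge>N. \<forall>n\<ge>N. H.nrm (fst (X m) - fst (X n)) < \<epsilon>" if "0 < \<epsilon>" for \<epsilon>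
        using Cauchy[OF that] le1 by (meson order_le_less_trans)
      then show ?thesis
        using H.Cauchy_limit[of "\<lambda>n. fst (X n)"] X that by (simp only: c) blast
    qed
    obtain k where k: "k \<in> carrier K" "(\<lambda>n. K.nrm (snd (X n) - k)) \<longlonglongrightarrow> 0"
    proof -
      have "\<exists>N. \<forall>m\<ge>N. \<forall>n\<ge>N. K.nrm (snd (X m) - snd (X n)) < \<epsilon>" if "0 < \<epsilon>" for \<epsilon>
        using Cauchy[OF that] le2 by (meson order_le_less_trans)
      then show ?thesis
        using K.Cauchy_limit[of "\<lambda>n. snd (X n)"] X that by (simp only: c) blast
    qed
    have lk: "(l, k) \<in> carrier (prod_space H K)" using l k by (simp add: c)
    have "(\<lambda>n. sqrt ((H.nrm (fst (X n) - l))\<^sup>2 + (K.nrm (snd (X n) - k))\<^sup>2)) \<longlonglongrightarrow> sqrt (0\<^sup>2 + 0\<^sup>2)"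
      using l k by (intro tendsto_intros)
    moreover have "P.nrm (X n - (l, k)) = sqrt ((H.nrm (fst (X n) - l))\<^sup>2 + (K.nrm (snd (X n) - k))\<^sup>2)" for n
      by (rule real_sqrt_unique[symmetric])
        (use sq[OF P.diff_mem[OF X lk], of n] P.nrm_nonneg[OF P.diff_mem[OF X lk]] in simp_all)
    ultimately have "(\<lambda>n. P.nrm (X n - (l, k))) \<longlonglongrightarrow> 0" by simp
    then show "\<exists>x. limitin P.mtopology X x sequentially"
      using X lk P.limitin_iff by blast
  qed
  then show ?thesis by unfold_locales
qed

text \<open>A sequence realising the projection in one space realises it in the other.\<close>

lemma projection_determined_by_gram:
  fixes V\<^sub>1 D\<^sub>1 :: "'a::complex_vector \<Rightarrow> 'v::complex_vector" and V\<^sub>2 D\<^sub>2 :: "'a \<Rightarrow> 'w::complex_vector"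
  assumes "hilbert H" "hilbert K"
    and V\<^sub>1: "\<And>a. V\<^sub>1 a \<in> carrier H" and D\<^sub>1: "\<And>a. D\<^sub>1 a \<in> carrier H" "clinear_on UNIV D\<^sub>1"
    and V\<^sub>2: "\<And>a. V\<^sub>2 a \<in> carrier K" and D\<^sub>2: "\<And>a. D\<^sub>2 a \<in> carrier K" "clinear_on UNIV D\<^sub>2"
    and VV: "\<And>a b. ip H (V\<^sub>1 a) (V\<^sub>1 b) = ip K (V\<^sub>2 a) (V\<^sub>2 b)"
    and VD: "\<And>a b. ip H (V\<^sub>1 a) (D\<^sub>1 b) = ip K (V\<^sub>2 a) (D\<^sub>2 b)"
    and DD: "\<And>a b. ip H (D\<^sub>1 a) (D\<^sub>1 b) = ip K (D\<^sub>2 a) (D\<^sub>2 b)"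
  obtains y z where "y \<in> orth_compl H (range D\<^sub>1)" "z \<in> orth_compl K (range D\<^sub>2)"
    "orth_proj H (orth_compl H (range D\<^sub>1)) (V\<^sub>1 a) = y"
    "orth_proj K (orth_compl K (range D\<^sub>2)) (V\<^sub>2 a) = z"
    "V\<^sub>1 a - y \<in> orth_compl H (orth_compl H (range D\<^sub>1))"
    "\<And>b. ip H y (V\<^sub>1 b) = ip K z (V\<^sub>2 b)"
proof -
  interpret H: hilbert H by fact
  interpret K: hilbert K by fact
  have add: "D\<^sub>1 (a + b) = D\<^sub>1 a + D\<^sub>1 b" "D\<^sub>2 (a + b) = D\<^sub>2 a + D\<^sub>2 b" for a b
    using D\<^sub>1(2) D\<^sub>2(2) by (simp_all add: clinear_on_def)
  have scale: "D\<^sub>1 (c *\<^sub>C a) = c *\<^sub>C D\<^sub>1 a" "D\<^sub>2 (c *\<^sub>C a) = c *\<^sub>C D\<^sub>2 a" for c a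
    using D\<^sub>1(2) D\<^sub>2(2) by (simp_all add: clinear_on_def)
  have diff: "D\<^sub>1 (a - b) = D\<^sub>1 a - D\<^sub>1 b" "D\<^sub>2 (a - b) = D\<^sub>2 a - D\<^sub>2 b" for a b
    using add(1)[of "a - b" b] add(2)[of "a - b" b] by simp_all
  have "D\<^sub>1 0 = 0" using diff(1)[of 0 0] by simp
  then have 0: "0 \<in> range D\<^sub>1" by (metis rangeI)
  have sub: "range D\<^sub>1 \<subseteq> carrier H" using D\<^sub>1 by blast
  have addc: "x + x' \<in> range D\<^sub>1" if "x \<in> range D\<^sub>1" "x' \<in> range D\<^sub>1" for x x'
    using that by (auto simp flip: add)
  have scalec: "c *\<^sub>C x \<in> range D\<^sub>1" if "x \<in> range D\<^sub>1" for c x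
    using that by (auto simp flip: scale)
  obtain y d where y: "y \<in> orth_compl H (range D\<^sub>1)" and d: "\<And>n. d n \<in> range D\<^sub>1"
    and lim: "(\<lambda>n. H.nrm ((V\<^sub>1 a - d n) - y)) \<longlonglongrightarrow> 0"
    using H.projection_exists[OF sub 0 addc scalec V\<^sub>1[of a]] by metis
  \<comment> \<open>Pull the sequence back to the parameter space. \<open>D\<^sub>1\<close> may fail
    to be injective, so any preimages are taken; the same parameters give the sequence
    \<open>Z\<close> in the second space.\<close>
  define b where "b = (\<lambda>n. inv D\<^sub>1 (d n))"
  have b: "d n = D\<^sub>1 (b n)" for n
    unfolding b_def by (rule f_inv_into_f[OF d, symmetric])
  have y_mem: "y \<in> carrier H" using y by (simp add: orth_compl_def)
  define X where "X = (\<lambda>n. V\<^sub>1 a - D\<^sub>1 (b n))"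
  define Z where "Z = (\<lambda>n. V\<^sub>2 a - D\<^sub>2 (b n))"
  have X: "X n \<in> carrier H" and Z: "Z n \<in> carrier K" for n
    using V\<^sub>1 D\<^sub>1 V\<^sub>2 D\<^sub>2 by (simp_all add: X_def Z_def H.diff_mem K.diff_mem)
  have limX: "(\<lambda>n. H.nrm (X n - y)) \<longlonglongrightarrow> 0" using lim by (simp only: X_def b)
  \<comment> \<open>In differences the terms \<open>V\<^sub>1 a\<close> and
    \<open>V\<^sub>2 a\<close> cancel, so the Gram identity for \<open>D\<^sub>1\<close> and
    \<open>D\<^sub>2\<close> makes \<open>Z\<close> a Cauchy sequence because \<open>X\<close> is
    one.\<close>
  have "K.nrm (Z m - Z n) = H.nrm (X m - X n)" for m n
  proof -
    have "Z m - Z n = D\<^sub>2 (b n - b m)" "X m - X n = D\<^sub>1 (b n - b m)"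
      by (simp_all add: X_def Z_def diff)
    then show ?thesis by (simp add: K.nrm_def H.nrm_def DD)
  qed
  moreover have "\<exists>N. \<forall>m\<ge>N. \<forall>n\<ge>N. H.nrm (X m - X n) < \<epsilon>" if "0 < \<epsilon>" for \<epsilon>
  proof -
    have "limitin H.mtopology X y sequentially"
      using limX y_mem by (simp only: H.limitin_iff[OF X] simp_thms)
    moreover have "range X \<subseteq> carrier H"
      using X by (rule image_subsetI)
    ultimately have "H.MCauchy X"
      by (intro H.convergent_imp_MCauchy)
    then show ?thesis using that by (simp add: H.MCauchy_iff)
  qed
  ultimately have CZ: "\<exists>N. \<forall>m\<ge>N. \<forall>n\<ge>N. K.nrm (Z m - Z n) < \<epsilon>" if "0 < \<epsilon>" for \<epsilon>
    using that by simp
  obtain z where z: "z \<in> carrier K" "(\<lambda>n. K.nrm (Z n - z)) \<longlonglongrightarrow> 0"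
    using K.Cauchy_limit[OF Z CZ] by blast
  have "ip K z (D\<^sub>2 c) = 0" for c
  proof -
    have "ip H (X n) (D\<^sub>1 c) = ip K (Z n) (D\<^sub>2 c)" for n
      using V\<^sub>1 D\<^sub>1 V\<^sub>2 D\<^sub>2 by (simp add: X_def Z_def H.diff_left K.diff_left VD DD)
    then have "ip H y (D\<^sub>1 c) = ip K z (D\<^sub>2 c)"
      using LIMSEQ_unique[OF H.tendsto_inner[OF X y_mem D\<^sub>1(1) limX, of c]]
        K.tendsto_inner[OF Z z(1) D\<^sub>2(1) z(2), of c] by simp
    then show ?thesis using y by (simp add: orth_compl_def)
  qed
  then have z_orth: "z \<in> orth_compl K (range D\<^sub>2)" using z by (auto simp: orth_compl_def)
  have "ip H (X n) (V\<^sub>1 c) = ip K (Z n) (V\<^sub>2 c)" for n c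
    using V\<^sub>1 D\<^sub>1 V\<^sub>2 D\<^sub>2 VD[of c "b n"]
      H.hermitian[of "V\<^sub>1 c" "D\<^sub>1 (b n)"] K.hermitian[of "V\<^sub>2 c" "D\<^sub>2 (b n)"]
    by (simp add: X_def Z_def H.diff_left K.diff_left VV)
  then have yz: "ip H y (V\<^sub>1 c) = ip K z (V\<^sub>2 c)" for c
    using LIMSEQ_unique[OF H.tendsto_inner[OF X y_mem V\<^sub>1 limX, of c]]
      K.tendsto_inner[OF Z z(1) V\<^sub>2 z(2), of c] by simp
  have "orth_proj H (orth_compl H (range D\<^sub>1)) (V\<^sub>1 a) = y"
    using H.orth_proj_eqI[OF _ V\<^sub>1 y d lim] D\<^sub>1 by auto
  moreover have "orth_proj K (orth_compl K (range D\<^sub>2)) (V\<^sub>2 a) = z"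
    using D\<^sub>2 z(2) by (intro K.orth_proj_eqI[OF _ V\<^sub>2 z_orth, of "\<lambda>n. D\<^sub>2 (b n)"]) (auto simp: Z_def)
  moreover have "V\<^sub>1 a - y \<in> orth_compl H (orth_compl H (range D\<^sub>1))"
    using H.orth_proj_residual[OF _ V\<^sub>1 y d lim] D\<^sub>1 by auto
  ultimately show ?thesis
    by (rule that[OF y z_orth _ _ _ yz])
qed

section \<open>The completion of the range of a positive operator\<close>

lemma antidual_add_left: "\<langle>\<phi> + \<psi>, x\<rangle> = \<langle>\<phi>, x\<rangle> + \<langle>\<psi>, x\<rangle>"
  and antidual_diff_left: "\<langle>\<phi> - \<psi>, x\<rangle> = \<langle>\<phi>, x\<rangle> - \<langle>\<psi>, x\<rangle>"
  and antidual_minus_left: "\<langle>- \<phi>, x\<rangle> = - \<langle>\<phi>, x\<rangle>"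
  and antidual_scaleC_left: "\<langle>c *\<^sub>C \<phi>, x\<rangle> = c * \<langle>\<phi>, x\<rangle>"
  and antidual_zero_left [simp]: "\<langle>0, x\<rangle> = 0"
  by (simp_all add: plus_antidual.rep_eq minus_antidual.rep_eq uminus_antidual.rep_eq scaleC_antidual.rep_eq zero_antidual.rep_eq)

lemma antidual_add_right: "\<langle>\<phi>, x + y\<rangle> = \<langle>\<phi>, x\<rangle> + \<langle>\<phi>, y\<rangle>"
  and antidual_diff_right: "\<langle>\<phi>, x - y\<rangle> = \<langle>\<phi>, x\<rangle> - \<langle>\<phi>, y\<rangle>"
  using bounded_linear_antidual_apply[of \<phi>]
  by (simp_all add: linear_add linear_diff bounded_linear.linear)

lemma antidual_scaleC_right: "\<langle>\<phi>, c *\<^sub>C x\<rangle> = cnj c * \<langle>\<phi>, x\<rangle>"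
  by transfer simp

lemma antidual_apply_Antidual:
  assumes "\<And>x y. L (x + y) = L x + L y" "\<And>c x. L (c *\<^sub>C x) = cnj c * L x"
    "\<And>x. cmod (L x) \<le> K * norm x"
  shows "antidual_apply (Antidual L) = L"
proof (rule Antidual_inverse)
  have "bounded_linear L"
    by (rule bounded_linear_intro[where K = K])
      (simp_all add: assms scaleR_eq_scaleC scaleR_conv_of_real mult.commute)
  then show "L \<in> {\<phi>. bounded_linear \<phi> \<and> (\<forall>c x. \<phi> (c *\<^sub>C x) = cnj c * \<phi> x)}"
    using assms by simp
qed

lemma norm_antidual_le:
  assumes "0 \<le> K" "\<And>x. cmod \<langle>\<phi>, x\<rangle> \<le> K * norm x"
  shows "norm \<phi> \<le> K"
  unfolding norm_antidual.rep_eq using assms by (rule onorm_bound)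

text \<open>Boundedness is stated for the seminorm of \<open>A\<close>, in which form it is used:
  functionals dominated by the seminorm are then norm continuous and belong to the antidual.\<close>

locale positive_operator =
  fixes A :: "'e::complex_normed_vector \<Rightarrow> 'e antidual"
  assumes A_add: "A (x + y) = A x + A y"
    and A_scaleC: "A (c *\<^sub>C x) = c *\<^sub>C A x"
    and A_pos: "0 \<le> \<langle>A x, x\<rangle>"
    and A_bounded: "\<exists>C. \<forall>x. sqrt (Re \<langle>A x, x\<rangle>) \<le> C * norm x"
begin

sublocale E: semi_inner UNIV "\<lambda>x y. \<langle>A x, y\<rangle>"
proof
  show "\<langle>A y, x\<rangle> = cnj \<langle>A x, y\<rangle>" for x y
    by (rule hermitian_if_sesquilinear_pos[where s = "\<lambda>x y. \<langle>A x, y\<rangle>"])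
      (simp_all add: A_add A_scaleC A_pos antidual_add_left antidual_add_right antidual_scaleC_left
        antidual_scaleC_right)
qed (simp_all add: A_add A_scaleC A_pos antidual_add_left antidual_scaleC_left)

lemma A_diff: "A (x - y) = A x - A y"
  using A_add[of "x - y" y] by simp

lemma nrm_bounded:
  obtains C where "0 \<le> C" "\<And>x. E.nrm x \<le> C * norm x"
proof -
  obtain C where C: "\<And>x. E.nrm x \<le> C * norm x"
    using A_bounded by (auto simp: E.nrm_def)
  have "E.nrm x \<le> \<bar>C\<bar> * norm x" for x
    by (rule order_trans[OF C mult_right_mono]) simp_all
  then show ?thesis by (intro that[of "\<bar>C\<bar>"]) simp_all
qed

text \<open>\<open>A (X n)\<close> tends to \<open>\<phi>\<close> in the norm dual to the seminorm of \<open>A\<close>; the functionals that are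
  approximable in this sense form the completion of \<open>range A\<close>.\<close>

definition approx :: "'e antidual \<Rightarrow> (nat \<Rightarrow> 'e) \<Rightarrow> bool" where
  "approx \<phi> X \<longleftrightarrow> (\<forall>\<epsilon>>0. \<forall>\<^sub>F n in sequentially. \<forall>y. cmod \<langle>\<phi> - A (X n), y\<rangle> \<le> \<epsilon> * E.nrm y)"

lemma approx_const: "approx (A x) (\<lambda>_. x)"
  by (simp add: approx_def)

lemma approx_add:
  assumes "approx \<phi> X" "approx \<psi> Y"
  shows "approx (\<phi> + \<psi>) (\<lambda>n. X n + Y n)"
  unfolding approx_def
proof (intro allI impI)
  fix \<epsilon> :: real assume "0 < \<epsilon>"
  then have "0 < \<epsilon> / 2" by simp
  then have "\<forall>\<^sub>F n in sequentially. \<forall>y. cmod \<langle>\<phi> - A (X n), y\<rangle> \<le> \<epsilon> / 2 * E.nrm y"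
    "\<forall>\<^sub>F n in sequentially. \<forall>y. cmod \<langle>\<psi> - A (Y n), y\<rangle> \<le> \<epsilon> / 2 * E.nrm y"
    using assms unfolding approx_def by blast+
  then show "\<forall>\<^sub>F n in sequentially. \<forall>y. cmod \<langle>\<phi> + \<psi> - A (X n + Y n), y\<rangle> \<le> \<epsilon> * E.nrm y"
  proof eventually_elim
    case (elim n)
    show ?case
    proof
      fix y
      have "\<langle>\<phi> + \<psi> - A (X n + Y n), y\<rangle> = \<langle>\<phi> - A (X n), y\<rangle> + \<langle>\<psi> - A (Y n), y\<rangle>"
        by (simp add: A_add antidual_add_left antidual_diff_left)
      also have "cmod \<dots> \<le> \<epsilon> / 2 * E.nrm y + \<epsilon> / 2 * E.nrm y"
        using elim by (intro norm_triangle_mono) simp_all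
      finally show "cmod \<langle>\<phi> + \<psi> - A (X n + Y n), y\<rangle> \<le> \<epsilon> * E.nrm y" by simp
    qed
  qed
qed

lemma approx_scaleC:
  assumes "approx \<phi> X"
  shows "approx (c *\<^sub>C \<phi>) (\<lambda>n. c *\<^sub>C X n)"
  unfolding approx_def
proof (intro allI impI)
  fix \<epsilon> :: real assume e: "0 < \<epsilon>"
  define \<delta> where "\<delta> = \<epsilon> / (cmod c + 1)"
  have c: "0 < cmod c + 1" by (simp add: add_nonneg_pos)
  then have \<delta>: "0 < \<delta>" using e by (simp add: \<delta>_def)
  have cd: "cmod c * \<delta> \<le> \<epsilon>" using c e by (simp add: \<delta>_def field_simps)
  from \<delta> have "\<forall>\<^sub>F n in sequentially. \<forall>y. cmod \<langle>\<phi> - A (X n), y\<rangle> \<le> \<delta> * E.nrm y"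
    using assms unfolding approx_def by blast
  then show "\<forall>\<^sub>F n in sequentially. \<forall>y. cmod \<langle>c *\<^sub>C \<phi> - A (c *\<^sub>C X n), y\<rangle> \<le> \<epsilon> * E.nrm y"
  proof eventually_elim
    case (elim n)
    show ?case
    proof
      fix y
      have "\<langle>c *\<^sub>C \<phi> - A (c *\<^sub>C X n), y\<rangle> = c * \<langle>\<phi> - A (X n), y\<rangle>"
        by (simp add: A_scaleC antidual_scaleC_left antidual_diff_left algebra_simps)
      then have "cmod \<langle>c *\<^sub>C \<phi> - A (c *\<^sub>C X n), y\<rangle> \<le> cmod c * (\<delta> * E.nrm y)"
        using elim by (simp add: norm_mult mult_left_mono)
      also have "\<dots> \<le> \<epsilon> * E.nrm y"
        using mult_right_mono[OF cd, of "E.nrm y"] by (simp add: mult.assoc)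
      finally show "cmod \<langle>c *\<^sub>C \<phi> - A (c *\<^sub>C X n), y\<rangle> \<le> \<epsilon> * E.nrm y" .
    qed
  qed
qed

lemma approx_minus: "approx \<phi> X \<Longrightarrow> approx (- \<phi>) (\<lambda>n. - X n)"
  using approx_scaleC[of \<phi> X "- 1"] by (simp add: scaleC_minus_one)

lemma approx_diff: "approx \<phi> X \<Longrightarrow> approx \<psi> Y \<Longrightarrow> approx (\<phi> - \<psi>) (\<lambda>n. X n - Y n)"
  using approx_add[OF _ approx_minus, of \<phi> X \<psi> Y] by simp

text \<open>Testing at \<open>y = x\<close>. With Cauchy-Schwarz, the dual norm of
  \<open>A x\<close> equals the seminorm of \<open>x\<close>.\<close>

lemma nrm_le_if_dual:
  assumes "\<And>y. cmod \<langle>A x, y\<rangle> \<le> \<epsilon> * E.nrm y" "0 \<le> \<epsilon>"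
  shows "E.nrm x \<le> \<epsilon>"
proof (cases "E.nrm x = 0")
  case True
  then show ?thesis using assms(2) by simp
next
  case False
  then have "0 < E.nrm x" using E.nrm_nonneg[of x] by (simp add: less_le)
  moreover have "(E.nrm x)\<^sup>2 \<le> \<epsilon> * E.nrm x"
    using order_trans[OF complex_Re_le_cmod assms(1)[of x]] by (simp add: E.nrm_sq)
  ultimately show ?thesis by (simp add: power2_eq_square)
qed

lemma approx_zero_nrm:
  assumes "approx 0 X"
  shows "(\<lambda>n. E.nrm (X n)) \<longlonglongrightarrow> 0"
proof (rule tendstoI)
  fix \<epsilon> :: real assume "0 < \<epsilon>"
  then have "0 < \<epsilon> / 2" by simp
  then have "\<forall>\<^sub>F n in sequentially. \<forall>y. cmod \<langle>0 - A (X n), y\<rangle> \<le> \<epsilon> / 2 * E.nrm y"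
    using assms unfolding approx_def by blast
  then show "\<forall>\<^sub>F n in sequentially. dist (E.nrm (X n)) 0 < \<epsilon>"
  proof eventually_elim
    case (elim n)
    then have "E.nrm (X n) \<le> \<epsilon> / 2"
      using \<open>0 < \<epsilon> / 2\<close> by (intro nrm_le_if_dual) (auto simp: antidual_minus_left)
    then show ?case using \<open>0 < \<epsilon>\<close> by simp
  qed
qed

lemma approx_Cauchy:
  assumes "approx \<phi> X" "0 < \<epsilon>"
  shows "\<exists>N. \<forall>m\<ge>N. \<forall>n\<ge>N. E.nrm (X m - X n) \<le> \<epsilon>"
proof -
  have "0 < \<epsilon> / 2" using assms by simp
  then obtain N where N: "\<And>n y. N \<le> n \<Longrightarrow> cmod \<langle>\<phi> - A (X n), y\<rangle> \<le> \<epsilon> / 2 * E.nrm y"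
    using assms(1) unfolding approx_def eventually_sequentially by blast
  have "E.nrm (X m - X n) \<le> \<epsilon>" if "N \<le> m" "N \<le> n" for m n
  proof (rule nrm_le_if_dual)
    fix y
    have "\<langle>A (X m - X n), y\<rangle> = \<langle>\<phi> - A (X n), y\<rangle> - \<langle>\<phi> - A (X m), y\<rangle>"
      by (simp add: A_diff antidual_diff_left)
    also have "cmod \<dots> \<le> \<epsilon> / 2 * E.nrm y + \<epsilon> / 2 * E.nrm y"
      by (rule order_trans[OF norm_triangle_ineq4 add_mono[OF N[OF that(2)] N[OF that(1)]]])
    finally show "cmod \<langle>A (X m - X n), y\<rangle> \<le> \<epsilon> * E.nrm y" by simp
  qed (use assms in simp)
  then show ?thesis by blast
qed

lemma approx_nrm_bounded:
  assumes "approx \<phi> X"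
  obtains M where "0 \<le> M" "\<forall>\<^sub>F n in sequentially. E.nrm (X n) \<le> M"
proof -
  obtain N where N: "\<And>m n. N \<le> m \<Longrightarrow> N \<le> n \<Longrightarrow> E.nrm (X m - X n) \<le> 1"
    using approx_Cauchy[OF assms, of 1] by auto
  have "E.nrm (X n) \<le> E.nrm (X N) + 1" if "N \<le> n" for n
    using E.nrm_le[of "X n" "X N"] N[OF that order_refl] by simp
  then show ?thesis
    by (intro that[of "E.nrm (X N) + 1"]) (auto simp: eventually_sequentially intro: add_nonneg_nonneg)
qed

lemma approx_dual_bounded:
  assumes "approx \<phi> X"
  obtains M where "0 \<le> M" "\<And>y. cmod \<langle>\<phi>, y\<rangle> \<le> M * E.nrm y"
proof -
  obtain n where n: "\<And>y. cmod \<langle>\<phi> - A (X n), y\<rangle> \<le> 1 * E.nrm y"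
    using assms unfolding approx_def eventually_sequentially by (meson order_refl zero_less_one)
  have "cmod \<langle>\<phi>, y\<rangle> \<le> (E.nrm (X n) + 1) * E.nrm y" for y
  proof -
    have "\<langle>\<phi>, y\<rangle> = \<langle>A (X n), y\<rangle> + \<langle>\<phi> - A (X n), y\<rangle>"
      by (simp add: antidual_diff_left)
    also have "cmod \<dots> \<le> E.nrm (X n) * E.nrm y + 1 * E.nrm y"
      by (rule norm_triangle_mono[OF E.cauchy_schwarz n]) simp_all
    finally show ?thesis by (simp add: algebra_simps)
  qed
  then show ?thesis
    by (intro that[of "E.nrm (X n) + 1"]) (auto intro: add_nonneg_nonneg)
qed

text \<open>The inner product of \<phi> with \<open>A y\<close> has to be
  \<open>\<langle>\<phi>, y\<rangle>\<close>, and continuity in the second argument then forces this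
  limit. \<open>ip_compl_lim\<close> shows that the chosen sequence does not matter.\<close>

definition compl_ip :: "'e antidual \<Rightarrow> 'e antidual \<Rightarrow> complex" where
  "compl_ip \<phi> \<psi> = lim (\<lambda>n. \<langle>\<phi>, (SOME Y. approx \<psi> Y) n\<rangle>)"

definition compl :: "'e antidual inner_space" where
  "compl = \<lparr>carrier = {\<phi>. \<exists>X. approx \<phi> X}, ip = compl_ip\<rparr>"

lemma carrier_compl: "\<phi> \<in> carrier compl \<longleftrightarrow> (\<exists>X. approx \<phi> X)"
  by (simp add: compl_def)

text \<open>\<phi> is bounded for the seminorm, so it maps the seminorm Cauchy sequence
  \<open>Z\<close> to a convergent one. Two sequences approximating \<psi> differ by one
  approximating 0, whose seminorms tend to 0.\<close>

lemma ip_compl_lim: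
  assumes \<phi>: "\<phi> \<in> carrier compl" and Y: "approx \<psi> Y"
  shows "(\<lambda>n. \<langle>\<phi>, Y n\<rangle>) \<longlonglongrightarrow> ip compl \<phi> \<psi>"
proof -
  obtain M where M: "0 \<le> M" "\<And>y. cmod \<langle>\<phi>, y\<rangle> \<le> M * E.nrm y"
    using \<phi> approx_dual_bounded by (auto simp: carrier_compl)
  define Z where "Z = (SOME Y. approx \<psi> Y)"
  have Z: "approx \<psi> Z" unfolding Z_def by (rule someI[of "approx \<psi>", OF Y])
  have "Cauchy (\<lambda>n. \<langle>\<phi>, Z n\<rangle>)"
  proof (rule CauchyI)
    fix \<epsilon> :: real assume e: "0 < \<epsilon>"
    define \<delta> where "\<delta> = \<epsilon> / (M + 1)"
    have \<delta>: "0 < \<delta>" using e M by (simp add: \<delta>_def)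
    have "M * \<delta> < \<epsilon>" using e M by (simp add: \<delta>_def field_simps)
    obtain N where N: "\<And>m n. N \<le> m \<Longrightarrow> N \<le> n \<Longrightarrow> E.nrm (Z m - Z n) \<le> \<delta>"
      using approx_Cauchy[OF Z \<delta>] by blast
    have "cmod (\<langle>\<phi>, Z m\<rangle> - \<langle>\<phi>, Z n\<rangle>) < \<epsilon>" if "N \<le> m" "N \<le> n" for m n
    proof -
      have "cmod \<langle>\<phi>, Z m - Z n\<rangle> \<le> M * \<delta>"
        by (rule order_trans[OF M(2) mult_left_mono[OF N[OF that] M(1)]])
      then show ?thesis using \<open>M * \<delta> < \<epsilon>\<close> by (simp add: antidual_diff_right)
    qed
    then show "\<exists>N. \<forall>m\<ge>N. \<forall>n\<ge>N. cmod (\<langle>\<phi>, Z m\<rangle> - \<langle>\<phi>, Z n\<rangle>) < \<epsilon>" by blast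
  qed
  then have lim: "(\<lambda>n. \<langle>\<phi>, Z n\<rangle>) \<longlonglongrightarrow> ip compl \<phi> \<psi>"
    by (simp add: compl_def compl_ip_def Z_def Cauchy_convergent convergent_LIMSEQ_iff[symmetric])
  have "approx 0 (\<lambda>n. Y n - Z n)"
    using approx_diff[OF Y Z] by simp
  then have "(\<lambda>n. M * E.nrm (Y n - Z n)) \<longlonglongrightarrow> 0"
    by (intro tendsto_mult_right_zero approx_zero_nrm)
  then have "(\<lambda>n. \<langle>\<phi>, Y n - Z n\<rangle>) \<longlonglongrightarrow> 0"
    by (rule LIMSEQ_null_comparison[OF M(2)])
  from tendsto_add[OF this lim] show ?thesis
    by (simp add: antidual_diff_right)
qed

text \<open>With both arguments approximated, symmetry and positivity carry over from the semi-inner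
  product of \<open>A\<close>.\<close>

lemma ip_compl_lim2:
  assumes X: "approx \<phi> X" and Y: "approx \<psi> Y"
  shows "(\<lambda>n. \<langle>A (X n), Y n\<rangle>) \<longlonglongrightarrow> ip compl \<phi> \<psi>"
proof -
  obtain M where M: "0 \<le> M" "\<forall>\<^sub>F n in sequentially. E.nrm (Y n) \<le> M"
    using approx_nrm_bounded[OF Y] by blast
  have "(\<lambda>n. \<langle>\<phi> - A (X n), Y n\<rangle>) \<longlonglongrightarrow> 0"
  proof (rule tendstoI)
    fix \<epsilon> :: real assume e: "0 < \<epsilon>"
    define \<delta> where "\<delta> = \<epsilon> / (M + 1)"
    have \<delta>: "0 < \<delta>" using e M by (simp add: \<delta>_def)
    have small: "\<delta> * M < \<epsilon>" using e M by (simp add: \<delta>_def field_simps)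
    have "\<forall>\<^sub>F n in sequentially. \<forall>y. cmod \<langle>\<phi> - A (X n), y\<rangle> \<le> \<delta> * E.nrm y"
      using X \<delta> unfolding approx_def by blast
    with M(2) show "\<forall>\<^sub>F n in sequentially. dist \<langle>\<phi> - A (X n), Y n\<rangle> 0 < \<epsilon>"
    proof eventually_elim
      case (elim n)
      have "cmod \<langle>\<phi> - A (X n), Y n\<rangle> \<le> \<delta> * M"
        using elim \<delta> by (meson mult_left_mono less_imp_le order_trans)
      then show ?case using small by simp
    qed
  qed
  moreover have "(\<lambda>n. \<langle>\<phi>, Y n\<rangle>) \<longlonglongrightarrow> ip compl \<phi> \<psi>"
    using X Y by (intro ip_compl_lim) (auto simp: carrier_compl)
  ultimately have "(\<lambda>n. \<langle>\<phi>, Y n\<rangle> - \<langle>\<phi> - A (X n), Y n\<rangle>) \<longlonglongrightarrow> ip compl \<phi> \<psi> - 0"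
    by (intro tendsto_diff)
  then show ?thesis by (simp add: antidual_diff_left)
qed

lemma ip_compl_A: "\<phi> \<in> carrier compl \<Longrightarrow> ip compl \<phi> (A y) = \<langle>\<phi>, y\<rangle>"
  using ip_compl_lim[OF _ approx_const, of \<phi> y] by (simp add: LIMSEQ_const_iff)

lemma A_mem_compl: "A x \<in> carrier compl"
  using approx_const carrier_compl by blast

lemma pre_hilbert_compl: "pre_hilbert_space compl"
  unfolding pre_hilbert_space_def
proof (intro conjI ballI allI impI)
  show "0 \<in> carrier compl"
    using A_mem_compl[of 0] A_diff[of 0 0] by simp
  fix \<phi> assume \<phi>: "\<phi> \<in> carrier compl"
  then obtain X where X: "approx \<phi> X" by (auto simp: carrier_compl)
  show "c *\<^sub>C \<phi> \<in> carrier compl" for c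
    using approx_scaleC[OF X] carrier_compl by blast
  have herm: "ip compl \<psi> \<phi> = cnj (ip compl \<phi> \<psi>)" if \<psi>: "\<psi> \<in> carrier compl" for \<psi>
  proof -
    obtain Y where Y: "approx \<psi> Y" using \<psi> by (auto simp: carrier_compl)
    have "(\<lambda>n. \<langle>A (Y n), X n\<rangle>) = (\<lambda>n. cnj \<langle>A (X n), Y n\<rangle>)"
      by (rule ext, rule E.hermitian) simp_all
    then have "(\<lambda>n. \<langle>A (Y n), X n\<rangle>) \<longlonglongrightarrow> cnj (ip compl \<phi> \<psi>)"
      using tendsto_cnj[OF ip_compl_lim2[OF X Y]] by simp
    then show ?thesis using LIMSEQ_unique[OF ip_compl_lim2[OF Y X]] by blast
  qed
  have lim: "(\<lambda>n. (E.nrm (X n))\<^sup>2) \<longlonglongrightarrow> Re (ip compl \<phi> \<phi>)"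
    using tendsto_Re[OF ip_compl_lim2[OF X X]] by (simp add: E.nrm_sq)
  then have "0 \<le> Re (ip compl \<phi> \<phi>)"
    by (rule LIMSEQ_le_const) simp
  moreover have "Im (ip compl \<phi> \<phi>) = 0"
    using herm[OF \<phi>] by (simp add: complex_eq_iff)
  ultimately show "0 \<le> ip compl \<phi> \<phi>"
    by (simp add: less_eq_complex_def)
  \<comment> \<open>Definiteness is automatic among functionals: if the seminorms of
    \<open>X n\<close> tend to 0, the values \<open>\<langle>A (X n), y\<rangle>\<close> tend to 0
    for every \<open>y\<close>, and their limit is
    \<open>\<langle>\<phi>, y\<rangle>\<close>.\<close>
  show "\<phi> = 0" if "ip compl \<phi> \<phi> = 0"
  proof (rule antidual_eqI)
    fix y
    have "(\<lambda>n. sqrt ((E.nrm (X n))\<^sup>2)) \<longlonglongrightarrow> sqrt 0"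
      using lim that by (intro tendsto_real_sqrt) simp
    then have "(\<lambda>n. E.nrm (X n) * E.nrm y) \<longlonglongrightarrow> 0"
      by (intro tendsto_mult_left_zero) simp
    then have "(\<lambda>n. \<langle>A (X n), y\<rangle>) \<longlonglongrightarrow> 0"
      by (rule LIMSEQ_null_comparison[OF E.cauchy_schwarz, rotated 2]) simp_all
    moreover have "(\<lambda>n. \<langle>A (X n), y\<rangle>) \<longlonglongrightarrow> \<langle>\<phi>, y\<rangle>"
      using ip_compl_lim2[OF X approx_const[of y]] ip_compl_A[OF \<phi>] by simp
    ultimately show "\<langle>\<phi>, y\<rangle> = \<langle>0, y\<rangle>"
      using LIMSEQ_unique by fastforce
  qed
  fix \<psi> assume \<psi>: "\<psi> \<in> carrier compl"
  then obtain Y where Y: "approx \<psi> Y" by (auto simp: carrier_compl)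
  show sum: "\<phi> + \<psi> \<in> carrier compl"
    using approx_add[OF X Y] carrier_compl by blast
  show "ip compl \<psi> \<phi> = cnj (ip compl \<phi> \<psi>)" by (rule herm[OF \<psi>])
  show "ip compl (c *\<^sub>C \<phi>) \<psi> = c * ip compl \<phi> \<psi>" for c
  proof (rule LIMSEQ_unique)
    show "(\<lambda>n. \<langle>c *\<^sub>C \<phi>, Y n\<rangle>) \<longlonglongrightarrow> ip compl (c *\<^sub>C \<phi>) \<psi>"
      using approx_scaleC[OF X] Y by (intro ip_compl_lim) (auto simp: carrier_compl)
    show "(\<lambda>n. \<langle>c *\<^sub>C \<phi>, Y n\<rangle>) \<longlonglongrightarrow> c * ip compl \<phi> \<psi>"
      unfolding antidual_scaleC_left by (intro tendsto_mult tendsto_const ip_compl_lim \<phi> Y)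
  qed
  fix \<theta> assume "\<theta> \<in> carrier compl"
  then obtain Z where Z: "approx \<theta> Z" by (auto simp: carrier_compl)
  show "ip compl (\<phi> + \<psi>) \<theta> = ip compl \<phi> \<theta> + ip compl \<psi> \<theta>"
  proof (rule LIMSEQ_unique)
    show "(\<lambda>n. \<langle>\<phi> + \<psi>, Z n\<rangle>) \<longlonglongrightarrow> ip compl (\<phi> + \<psi>) \<theta>"
      by (rule ip_compl_lim[OF sum Z])
    show "(\<lambda>n. \<langle>\<phi> + \<psi>, Z n\<rangle>) \<longlonglongrightarrow> ip compl \<phi> \<theta> + ip compl \<psi> \<theta>"
      unfolding antidual_add_left by (intro tendsto_add ip_compl_lim \<phi> \<psi> Z)
  qed
qed

sublocale H: pre_hilbert compl
  by unfold_locales (rule pre_hilbert_compl)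

lemma nrm_A: "H.nrm (A x) = E.nrm x"
  by (simp add: H.nrm_def E.nrm_def ip_compl_A A_mem_compl)

lemma compl_apply_le: "\<phi> \<in> carrier compl \<Longrightarrow> cmod \<langle>\<phi>, y\<rangle> \<le> H.nrm \<phi> * E.nrm y"
  using H.cauchy_schwarz[OF _ A_mem_compl, of \<phi> y] by (simp add: ip_compl_A nrm_A)

text \<open>Testing at \<open>y = X n\<close> and passing to the limit bounds the square of the norm
  by \<epsilon> times the norm. Together with \<open>compl_apply_le\<close>, the norm of
  \<open>compl\<close> is the dual norm of the seminorm, so \<open>approx\<close> is convergence in
  \<open>compl\<close>.\<close>

lemma compl_nrm_le:
  assumes \<phi>: "\<phi> \<in> carrier compl" and e: "0 \<le> \<epsilon>" and le: "\<And>y. cmod \<langle>\<phi>, y\<rangle> \<le> \<epsilon> * E.nrm y"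
  shows "H.nrm \<phi> \<le> \<epsilon>"
proof -
  obtain X where X: "approx \<phi> X" using \<phi> by (auto simp: carrier_compl)
  have "(\<lambda>n. sqrt ((E.nrm (X n))\<^sup>2)) \<longlonglongrightarrow> sqrt ((H.nrm \<phi>)\<^sup>2)"
    using tendsto_Re[OF ip_compl_lim2[OF X X]] \<phi>
    by (intro tendsto_real_sqrt) (simp add: E.nrm_sq H.nrm_sq)
  then have nrm: "(\<lambda>n. E.nrm (X n)) \<longlonglongrightarrow> H.nrm \<phi>" using \<phi> by simp
  have "(H.nrm \<phi>)\<^sup>2 \<le> \<epsilon> * H.nrm \<phi>"
  proof (rule LIMSEQ_le)
    show "(\<lambda>n. Re \<langle>\<phi>, X n\<rangle>) \<longlonglongrightarrow> (H.nrm \<phi>)\<^sup>2"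
      using tendsto_Re[OF ip_compl_lim[OF \<phi> X]] \<phi> by (simp add: H.nrm_sq)
    show "(\<lambda>n. \<epsilon> * E.nrm (X n)) \<longlonglongrightarrow> \<epsilon> * H.nrm \<phi>"
      by (intro tendsto_mult tendsto_const nrm)
    show "\<exists>N. \<forall>n\<ge>N. Re \<langle>\<phi>, X n\<rangle> \<le> \<epsilon> * E.nrm (X n)"
      using order_trans[OF complex_Re_le_cmod le] by blast
  qed
  then show ?thesis
    using e H.nrm_nonneg[OF \<phi>] by (cases "H.nrm \<phi> = 0") (simp_all add: power2_eq_square)
qed

lemma approx_iff:
  assumes \<phi>: "\<phi> \<in> carrier compl"
  shows "approx \<phi> X \<longleftrightarrow> (\<lambda>n. H.nrm (\<phi> - A (X n))) \<longlonglongrightarrow> 0"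
proof
  have mem: "\<phi> - A (X n) \<in> carrier compl" for n
    using \<phi> A_mem_compl by (rule H.diff_mem)
  assume X: "approx \<phi> X"
  show "(\<lambda>n. H.nrm (\<phi> - A (X n))) \<longlonglongrightarrow> 0"
  proof (rule tendstoI)
    fix \<epsilon> :: real assume e: "0 < \<epsilon>"
    then have "\<forall>\<^sub>F n in sequentially. \<forall>y. cmod \<langle>\<phi> - A (X n), y\<rangle> \<le> \<epsilon> / 2 * E.nrm y"
      using X half_gt_zero unfolding approx_def by blast
    then show "\<forall>\<^sub>F n in sequentially. dist (H.nrm (\<phi> - A (X n))) 0 < \<epsilon>"
    proof eventually_elim
      case (elim n)
      then have "H.nrm (\<phi> - A (X n)) \<le> \<epsilon> / 2"
        using e by (intro compl_nrm_le[OF mem]) simp_all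
      then show ?case using e mem by simp
    qed
  qed
next
  have mem: "\<phi> - A (X n) \<in> carrier compl" for n
    using \<phi> A_mem_compl by (rule H.diff_mem)
  assume lim: "(\<lambda>n. H.nrm (\<phi> - A (X n))) \<longlonglongrightarrow> 0"
  show "approx \<phi> X"
    unfolding approx_def
  proof (intro allI impI)
    fix \<epsilon> :: real assume e: "0 < \<epsilon>"
    from order_tendstoD(2)[OF lim e]
    show "\<forall>\<^sub>F n in sequentially. \<forall>y. cmod \<langle>\<phi> - A (X n), y\<rangle> \<le> \<epsilon> * E.nrm y"
    proof eventually_elim
      case (elim n)
      then show ?case
        using order_trans[OF compl_apply_le[OF mem] mult_right_mono[OF less_imp_le]] by simp
    qed
  qed
qed

lemma dense_compl: "dense_in compl (range A)"
  unfolding H.dense_in_iff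
proof (intro conjI ballI allI impI)
  show "range A \<subseteq> carrier compl" using A_mem_compl by blast
  fix \<phi> and \<epsilon> :: real assume \<phi>: "\<phi> \<in> carrier compl" and e: "0 < \<epsilon>"
  obtain X where X: "approx \<phi> X" using \<phi> by (auto simp: carrier_compl)
  have "(\<lambda>n. H.nrm (\<phi> - A (X n))) \<longlonglongrightarrow> 0" using X approx_iff[OF \<phi>] by simp
  then have "\<forall>\<^sub>F n in sequentially. H.nrm (\<phi> - A (X n)) < \<epsilon>"
    using e by (rule order_tendstoD(2))
  then obtain n where "H.nrm (\<phi> - A (X n)) < \<epsilon>"
    by (auto simp: eventually_sequentially)
  then show "\<exists>y\<in>range A. H.nrm (\<phi> - y) < \<epsilon>" by blast
qed

text \<open>The limit of a Cauchy sequence is the pointwise limit of the functionals.\<close>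

lemma approx_limit_exists:
  assumes Cauchy: "\<And>\<epsilon>. 0 < \<epsilon> \<Longrightarrow> \<exists>N. \<forall>m\<ge>N. \<forall>n\<ge>N. E.nrm (X m - X n) \<le> \<epsilon>"
  obtains \<phi> where "approx \<phi> X"
proof -
  obtain C where C: "0 \<le> C" "\<And>x. E.nrm x \<le> C * norm x" using nrm_bounded by blast
  have diff_le: "cmod (\<langle>A (X m), y\<rangle> - \<langle>A (X n), y\<rangle>) \<le> E.nrm (X m - X n) * E.nrm y" for m n y
    using E.cauchy_schwarz[of "X m - X n" y] by (simp add: A_diff antidual_diff_left)
  have "convergent (\<lambda>n. \<langle>A (X n), y\<rangle>)" for y
  proof (rule Cauchy_convergent, rule CauchyI)
    fix \<epsilon> :: real assume e: "0 < \<epsilon>"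
    define \<delta> where "\<delta> = \<epsilon> / (E.nrm y + 1)"
    have y: "0 < E.nrm y + 1" by (simp add: add_nonneg_pos)
    have \<delta>: "0 < \<delta>" using e y by (simp add: \<delta>_def)
    have small: "\<delta> * E.nrm y < \<epsilon>" using e y by (simp add: \<delta>_def field_simps)
    obtain N where N: "\<And>m n. N \<le> m \<Longrightarrow> N \<le> n \<Longrightarrow> E.nrm (X m - X n) \<le> \<delta>"
      using Cauchy[OF \<delta>] by blast
    have "cmod (\<langle>A (X m), y\<rangle> - \<langle>A (X n), y\<rangle>) < \<epsilon>" if "N \<le> m" "N \<le> n" for m n
      using order_trans[OF diff_le mult_right_mono[OF N[OF that]], of y] small by simp
    then show "\<exists>N. \<forall>m\<ge>N. \<forall>n\<ge>N. cmod (\<langle>A (X m), y\<rangle> - \<langle>A (X n), y\<rangle>) < \<epsilon>" by blast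
  qed
  then obtain L where L: "\<And>y. (\<lambda>n. \<langle>A (X n), y\<rangle>) \<longlonglongrightarrow> L y"
    unfolding convergent_def by metis
  \<comment> \<open>Letting m tend to infinity in \<open>diff_le\<close> makes the pointwise
    convergence uniform relative to \<open>E.nrm y\<close>, as \<open>approx\<close>
    demands.\<close>
  have le: "cmod (L y - \<langle>A (X n), y\<rangle>) \<le> \<epsilon> * E.nrm y"
    if N: "\<And>m n. N \<le> m \<Longrightarrow> N \<le> n \<Longrightarrow> E.nrm (X m - X n) \<le> \<epsilon>" and n: "N \<le> n" for N n \<epsilon> y
  proof (rule LIMSEQ_le_const2)
    show "(\<lambda>m. cmod (\<langle>A (X m), y\<rangle> - \<langle>A (X n), y\<rangle>)) \<longlonglongrightarrow> cmod (L y - \<langle>A (X n), y\<rangle>)"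
      by (intro tendsto_intros L)
    show "\<exists>N. \<forall>m\<ge>N. cmod (\<langle>A (X m), y\<rangle> - \<langle>A (X n), y\<rangle>) \<le> \<epsilon> * E.nrm y"
      using order_trans[OF diff_le mult_right_mono[OF N[OF _ n]], of _ y] by (intro exI[of _ N]) simp
  qed
  obtain N where N: "\<And>m n. N \<le> m \<Longrightarrow> N \<le> n \<Longrightarrow> E.nrm (X m - X n) \<le> 1"
    using Cauchy[of 1] by auto
  \<comment> \<open>\<open>L\<close> is bounded by \<open>M\<close> times the seminorm, hence by a
    multiple of the norm: it is an element of the antidual.\<close>
  define M where "M = E.nrm (X N) + 1"
  have M: "0 \<le> M" by (simp add: M_def)
  have "cmod (L y) \<le> M * C * norm y" for y
  proof -
    have "cmod (L y) \<le> cmod \<langle>A (X N), y\<rangle> + cmod (L y - \<langle>A (X N), y\<rangle>)"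
      by (metis norm_triangle_sub)
    also have "\<dots> \<le> E.nrm (X N) * E.nrm y + 1 * E.nrm y"
      by (rule add_mono[OF E.cauchy_schwarz[OF UNIV_I UNIV_I] le[OF N order_refl]])
    also have "\<dots> = M * E.nrm y" by (simp add: M_def algebra_simps)
    also have "\<dots> \<le> M * (C * norm y)" by (intro mult_left_mono C M)
    finally show ?thesis by simp
  qed
  moreover have "L (x + y) = L x + L y" for x y
    using LIMSEQ_unique[OF L[of "x + y"]] tendsto_add[OF L[of x] L[of y]]
    by (simp add: antidual_add_right)
  moreover have "L (c *\<^sub>C x) = cnj c * L x" for c x
    using LIMSEQ_unique[OF L[of "c *\<^sub>C x"]] tendsto_mult[OF tendsto_const L[of x], of "cnj c"]
    by (simp add: antidual_scaleC_right)
  ultimately have apply_L: "antidual_apply (Antidual L) = L"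
    by (intro antidual_apply_Antidual)
  have "approx (Antidual L) X"
    unfolding approx_def eventually_sequentially
  proof (intro allI impI)
    fix \<epsilon> :: real assume "0 < \<epsilon>"
    then obtain N where "\<And>m n. N \<le> m \<Longrightarrow> N \<le> n \<Longrightarrow> E.nrm (X m - X n) \<le> \<epsilon>"
      using Cauchy by blast
    from le[OF this] show "\<exists>N. \<forall>n\<ge>N. \<forall>y. cmod \<langle>Antidual L - A (X n), y\<rangle> \<le> \<epsilon> * E.nrm y"
      by (auto simp: antidual_diff_left apply_L)
  qed
  then show ?thesis by (rule that)
qed

lemma hilbert_compl: "hilbert_space compl"
  unfolding hilbert_space_def H.mcomplete_def
proof (intro conjI allI impI pre_hilbert_compl)
  fix \<Phi> assume "H.MCauchy \<Phi>"
  then have \<Phi>: "\<And>n. \<Phi> n \<in> carrier compl"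
    and Cauchy: "\<And>\<epsilon>. 0 < \<epsilon> \<Longrightarrow> \<exists>N. \<forall>m\<ge>N. \<forall>n\<ge>N. H.nrm (\<Phi> m - \<Phi> n) < \<epsilon>"
    by (simp_all add: H.MCauchy_iff)
  \<comment> \<open>By density, the Cauchy sequence is replaced by one in \<open>range A\<close>, to
    which \<open>approx_limit_exists\<close> applies.\<close>
  have "\<exists>x. H.nrm (\<Phi> n - A x) < inverse (real (Suc n))" for n
    using dense_compl \<Phi>[of n] unfolding H.dense_in_iff by force
  then obtain X where X: "\<And>n. H.nrm (\<Phi> n - A (X n)) < inverse (real (Suc n))"
    by metis
  have X_lim: "(\<lambda>n. H.nrm (\<Phi> n - A (X n))) \<longlonglongrightarrow> 0"
    by (rule LIMSEQ_null_comparison[OF _ LIMSEQ_inverse_real_of_nat])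
      (use X \<Phi> A_mem_compl in \<open>simp add: H.diff_mem less_imp_le\<close>)
  have "\<exists>N. \<forall>m\<ge>N. \<forall>n\<ge>N. E.nrm (X m - X n) \<le> \<epsilon>" if e: "0 < \<epsilon>" for \<epsilon>
  proof -
    have e3: "0 < \<epsilon> / 3" using e by simp
    obtain N where N: "\<And>m n. N \<le> m \<Longrightarrow> N \<le> n \<Longrightarrow> H.nrm (\<Phi> m - \<Phi> n) < \<epsilon> / 3"
      using Cauchy[OF e3] by blast
    obtain N' where N': "\<And>n. N' \<le> n \<Longrightarrow> H.nrm (\<Phi> n - A (X n)) < \<epsilon> / 3"
      using order_tendstoD(2)[OF X_lim e3] by (auto simp: eventually_sequentially)
    have "E.nrm (X m - X n) \<le> \<epsilon>" if mn: "max N N' \<le> m" "max N N' \<le> n" for m n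
    proof -
      have "E.nrm (X m - X n) = H.nrm (A (X m) - A (X n))"
        by (simp add: A_diff flip: nrm_A)
      also have "\<dots> \<le> H.nrm (A (X m) - \<Phi> m) + H.nrm (\<Phi> m - A (X n))"
        by (intro H.nrm_triangle_diff A_mem_compl \<Phi>)
      also have "H.nrm (\<Phi> m - A (X n)) \<le> H.nrm (\<Phi> m - \<Phi> n) + H.nrm (\<Phi> n - A (X n))"
        by (intro H.nrm_triangle_diff A_mem_compl \<Phi>)
      also have "H.nrm (A (X m) - \<Phi> m) = H.nrm (\<Phi> m - A (X m))"
        by (intro H.nrm_diff_commute A_mem_compl \<Phi>)
      finally show ?thesis
        using N[of m n] N'[of m] N'[of n] mn by simp
    qed
    then show ?thesis by blast
  qed
  then obtain \<phi> where \<phi>: "approx \<phi> X"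
    using approx_limit_exists by blast
  then have mem: "\<phi> \<in> carrier compl" using carrier_compl by blast
  have "(\<lambda>n. H.nrm (\<phi> - A (X n))) \<longlonglongrightarrow> 0"
    using \<phi> approx_iff[OF mem] by blast
  then have "(\<lambda>n. H.nrm (\<Phi> n - A (X n)) + H.nrm (\<phi> - A (X n))) \<longlonglongrightarrow> 0"
    using tendsto_add[OF X_lim] by fastforce
  moreover have "norm (H.nrm (\<Phi> n - \<phi>)) \<le> H.nrm (\<Phi> n - A (X n)) + H.nrm (\<phi> - A (X n))" for n
    using H.nrm_triangle_diff[OF \<Phi> A_mem_compl mem, of n "X n"]
      H.nrm_diff_commute[OF A_mem_compl mem, of "X n"] H.nrm_nonneg[OF H.diff_mem[OF \<Phi> mem]] by simp
  ultimately have "(\<lambda>n. H.nrm (\<Phi> n - \<phi>)) \<longlonglongrightarrow> 0"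
    by (rule LIMSEQ_null_comparison[rotated])
  then show "\<exists>x. limitin H.mtopology \<Phi> x sequentially"
    using H.limitin_iff[of \<Phi> \<phi>, OF \<Phi>] mem by blast
qed

lemma is_range_completion_compl: "is_range_completion A compl"
  unfolding is_range_completion_def using hilbert_compl dense_compl ip_compl_A[OF A_mem_compl] by blast

lemma is_range_completion: "is_range_completion A (range_completion A)"
  unfolding range_completion_def by (rule someI[of "is_range_completion A", OF is_range_completion_compl])

end

section \<open>Parallel sums\<close>

context pre_hilbert
begin

lemma zero_if_orthogonal_to_dense:
  assumes dense: "dense_in H S" and v: "v \<in> carrier H" and orth: "\<And>y. y \<in> S \<Longrightarrow> ip H v y = 0"
  shows "v = 0"
proof (rule ccontr)
  assume "v \<noteq> 0"
  then have pos: "0 < nrm v"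
    using nrm_definite[OF v] nrm_nonneg[OF v] by (auto simp: less_le)
  then obtain y where y: "y \<in> S" "nrm (v - y) < nrm v"
    using dense v unfolding dense_in_iff by blast
  have yc: "y \<in> carrier H" using dense y by (auto simp: dense_in_iff)
  have "ip H v v = ip H v (v - y)"
    using v yc orth[OF y(1)] by (simp add: diff_right)
  then have "(nrm v)\<^sup>2 \<le> nrm v * nrm (v - y)"
    using order_trans[OF complex_Re_le_cmod cauchy_schwarz[OF v diff_mem[OF v yc]]]
    by (simp add: nrm_sq[OF v])
  then show False using pos y by (simp add: power2_eq_square)
qed

text \<open>Any operators chosen for \<open>J_op\<close> and \<open>J_tilde\<close> are determined
  on the carrier by this.\<close>

lemma bounded_op_eq_on_dense:
  assumes S: "bounded_op H S" and T: "bounded_op H T" and dense: "dense_in H D"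
    and eq: "\<And>d. d \<in> D \<Longrightarrow> S d = T d" and x: "x \<in> carrier H"
  shows "S x = (T x :: 'w::complex_normed_vector)"
proof -
  obtain C where C: "\<And>x. x \<in> carrier H \<Longrightarrow> norm (S x) \<le> C * nrm x"
    using S by (auto simp: bounded_op_def hnorm_eq)
  obtain C' where C': "\<And>x. x \<in> carrier H \<Longrightarrow> norm (T x) \<le> C' * nrm x"
    using T by (auto simp: bounded_op_def hnorm_eq)
  have diff: "U (x - d) = U x - U d" if U: "bounded_op H U" and d: "d \<in> carrier H" for U :: "'v \<Rightarrow> 'w" and d
  proof -
    have "U ((x - d) + d) = U (x - d) + U d"
      using U diff_mem[OF x d] d unfolding bounded_op_def clinear_on_def by blast
    then show ?thesis by simp
  qed
  have "norm (S x - T x) \<le> 0 + e" if e: "0 < e" for e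
  proof -
    \<comment> \<open>The absolute values and the summand 1 make \<open>K\<close> positive; the
      bounds \<open>C\<close> and \<open>C'\<close> may be negative on a trivial space.\<close>
    define K where "K = \<bar>C\<bar> + \<bar>C'\<bar> + 1"
    have K: "0 < K" by (simp add: K_def)
    obtain d where d: "d \<in> D" "nrm (x - d) < e / K"
      using dense x e K unfolding dense_in_iff by (meson divide_pos_pos)
    have dc: "d \<in> carrier H" using dense d by (auto simp: dense_in_iff)
    have xd: "x - d \<in> carrier H" using x dc by (rule diff_mem)
    have "S x - T x = S (x - d) - T (x - d)"
      using diff[OF S dc] diff[OF T dc] eq[OF d(1)] by simp
    also have "norm \<dots> \<le> C * nrm (x - d) + C' * nrm (x - d)"
      by (rule order_trans[OF norm_triangle_ineq4 add_mono[OF C[OF xd] C'[OF xd]]])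
    also have "\<dots> = (C + C') * nrm (x - d)" by (simp add: distrib_right)
    also have "\<dots> \<le> K * nrm (x - d)"
      using xd by (intro mult_right_mono) (simp_all add: K_def)
    also have "\<dots> \<le> e"
      using d(2) K by (simp add: field_simps)
    finally show ?thesis by simp
  qed
  then have "norm (S x - T x) \<le> 0" by (rule field_le_epsilon)
  then show ?thesis by simp
qed

lemma op_adjoint_eqI:
  assumes k: "k \<in> carrier H" and eq: "\<And>\<xi>. \<xi> \<in> carrier H \<Longrightarrow> ip H k \<xi> = \<langle>\<Phi>, S \<xi>\<rangle>"
  shows "op_adjoint H S \<Phi> = k"
  unfolding op_adjoint_def
proof (rule the_equality)
  show "k \<in> carrier H \<and> (\<forall>\<xi>\<in>carrier H. ip H k \<xi> = \<langle>\<Phi>, S \<xi>\<rangle>)"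
    using k eq by blast
  fix k' assume k': "k' \<in> carrier H \<and> (\<forall>\<xi>\<in>carrier H. ip H k' \<xi> = \<langle>\<Phi>, S \<xi>\<rangle>)"
  have d: "k' - k \<in> carrier H" using k k' by (simp add: diff_mem)
  have "ip H (k' - k) (k' - k) = ip H k' (k' - k) - ip H k (k' - k)"
    using k k' d by (intro diff_left) simp_all
  also have "\<dots> = 0" using k' d eq[OF d] by simp
  finally show "k' = k" using ip_definite[OF d] by simp
qed

end

lemma dense_in_prod_space:
  assumes "pre_hilbert_space H" "pre_hilbert_space K" and S: "dense_in H S" and T: "dense_in K T"
  shows "dense_in (prod_space H K) (S \<times> T)"
proof -
  interpret H: pre_hilbert H by unfold_locales fact
  interpret K: pre_hilbert K by unfold_locales fact
  interpret P: pre_hilbert "prod_space H K"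
    by unfold_locales (rule pre_hilbert_prod_space[OF assms(1,2)])
  have sub: "S \<subseteq> carrier H" "T \<subseteq> carrier K"
    using S T by (simp_all add: H.dense_in_iff K.dense_in_iff)
  show ?thesis
    unfolding P.dense_in_iff
  proof (intro conjI ballI allI impI)
    show "S \<times> T \<subseteq> carrier (prod_space H K)"
      using sub by (auto simp: prod_space_def)
    fix x and \<epsilon> :: real assume "x \<in> carrier (prod_space H K)" and e: "0 < \<epsilon>"
    then have x: "fst x \<in> carrier H" "snd x \<in> carrier K"
      by (simp_all add: prod_space_def mem_Times_iff)
    have e2: "0 < \<epsilon> / 2" using e by simp
    obtain y where y: "y \<in> S" "H.nrm (fst x - y) < \<epsilon> / 2"
      using S x e2 unfolding H.dense_in_iff by blast
    obtain z where z: "z \<in> T" "K.nrm (snd x - z) < \<epsilon> / 2"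
      using T x e2 unfolding K.dense_in_iff by blast
    have mem: "fst x - y \<in> carrier H" "snd x - z \<in> carrier K"
      using x y z sub by (auto intro: H.diff_mem K.diff_mem)
    have "P.nrm (x - (y, z)) = sqrt ((H.nrm (fst x - y))\<^sup>2 + (K.nrm (snd x - z))\<^sup>2)"
      unfolding P.nrm_def using mem by (simp add: prod_space_def H.nrm_sq K.nrm_sq)
    also have "\<dots> \<le> H.nrm (fst x - y) + K.nrm (snd x - z)"
      using mem by (intro sqrt_sum_squares_le_sum) simp_all
    also have "\<dots> < \<epsilon>" using y z by simp
    finally show "\<exists>w\<in>S \<times> T. P.nrm (x - w) < \<epsilon>"
      using y z by blast
  qed
qed

context positive_operator
begin

lemma hilbert_range_completion: "hilbert_space (range_completion A)"
  and dense_range: "dense_in (range_completion A) (range A)"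
  and ip_range: "ip (range_completion A) (A x) (A y) = \<langle>A x, y\<rangle>"
  using is_range_completion by (simp_all add: is_range_completion_def)

sublocale R: hilbert "range_completion A"
  by (rule hilbertI[OF hilbert_range_completion])

lemma A_mem: "A x \<in> carrier (range_completion A)"
  using dense_range by (auto simp: R.dense_in_iff)

lemma R_nrm_A: "R.nrm (A x) = E.nrm x"
  by (simp add: R.nrm_def E.nrm_def ip_range)

text \<open>The continuous extension of the inclusion of \<open>range A\<close>.\<close>

definition embed :: "'e antidual \<Rightarrow> 'e antidual" where
  "embed \<xi> = Antidual (\<lambda>y. ip (range_completion A) \<xi> (A y))"

text \<open>Only the inner product relates an element of the chosen completion outside
  \<open>range A\<close> to a functional: such an element, though of antidual type, need not be the
  functional that it represents. Continuity comes from Cauchy-Schwarz and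
  \<open>nrm_bounded\<close>.\<close>

lemma embed_apply:
  assumes \<xi>: "\<xi> \<in> carrier (range_completion A)"
  shows "\<langle>embed \<xi>, y\<rangle> = ip (range_completion A) \<xi> (A y)"
proof -
  obtain C where C: "\<And>x. E.nrm x \<le> C * norm x" using nrm_bounded by blast
  have "cmod (ip (range_completion A) \<xi> (A y)) \<le> (R.nrm \<xi> * C) * norm y" for y
  proof -
    have "cmod (ip (range_completion A) \<xi> (A y)) \<le> R.nrm \<xi> * E.nrm y"
      using R.cauchy_schwarz[OF \<xi> A_mem, of y] by (simp add: R_nrm_A)
    also have "\<dots> \<le> R.nrm \<xi> * (C * norm y)"
      by (rule mult_left_mono[OF C R.nrm_nonneg[OF \<xi>]])
    finally show ?thesis by (simp add: mult.assoc)
  qed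
  then have "antidual_apply (embed \<xi>) = (\<lambda>y. ip (range_completion A) \<xi> (A y))"
    unfolding embed_def
    by (intro antidual_apply_Antidual)
      (simp_all add: A_add A_scaleC R.add_right R.scale_right A_mem \<xi>)
  then show ?thesis by simp
qed

lemma embed_A [simp]: "embed (A x) = A x"
  by (rule antidual_eqI) (simp add: embed_apply A_mem ip_range)

lemma clinear_embed: "clinear_on (carrier (range_completion A)) embed"
  unfolding clinear_on_def
  by (intro conjI ballI allI antidual_eqI)
    (simp_all add: embed_apply antidual_add_left antidual_scaleC_left R.add_mem R.scale_mem
      R.add_left R.scale_left A_mem)

lemma embed_bounded:
  obtains C where "0 \<le> C" "\<And>\<xi>. \<xi> \<in> carrier (range_completion A) \<Longrightarrow> norm (embed \<xi>) \<le> C * R.nrm \<xi>"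
proof -
  obtain C where C: "0 \<le> C" "\<And>x. E.nrm x \<le> C * norm x" using nrm_bounded by blast
  have "norm (embed \<xi>) \<le> C * R.nrm \<xi>" if \<xi>: "\<xi> \<in> carrier (range_completion A)" for \<xi>
  proof (rule norm_antidual_le)
    show "0 \<le> C * R.nrm \<xi>" using C \<xi> by simp
    fix y
    have "cmod \<langle>embed \<xi>, y\<rangle> \<le> R.nrm \<xi> * E.nrm y"
      using R.cauchy_schwarz[OF \<xi> A_mem, of y] by (simp add: embed_apply[OF \<xi>] R_nrm_A)
    also have "\<dots> \<le> R.nrm \<xi> * (C * norm y)"
      by (rule mult_left_mono[OF C(2) R.nrm_nonneg[OF \<xi>]])
    finally show "cmod \<langle>embed \<xi>, y\<rangle> \<le> C * R.nrm \<xi> * norm y" by (simp add: mult_ac)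
  qed
  with C(1) show ?thesis by (rule that)
qed

end

lemma bounded_op_add:
  assumes "bounded_op H S" "bounded_op H T"
  shows "bounded_op H (\<lambda>x. S x + T x)"
proof -
  obtain C where C: "\<And>x. x \<in> carrier H \<Longrightarrow> norm (S x) \<le> C * hnorm H x"
    using assms(1) by (auto simp: bounded_op_def)
  obtain C' where C': "\<And>x. x \<in> carrier H \<Longrightarrow> norm (T x) \<le> C' * hnorm H x"
    using assms(2) by (auto simp: bounded_op_def)
  have "norm (S x + T x) \<le> (C + C') * hnorm H x" if "x \<in> carrier H" for x
    using norm_triangle_mono[OF C[OF that] C'[OF that]] by (simp add: distrib_right)
  moreover have "clinear_on (carrier H) (\<lambda>x. S x + T x)"
    using assms by (simp add: bounded_op_def clinear_on_def scaleC_add_right)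
  ultimately show ?thesis unfolding bounded_op_def by blast
qed

locale positive_operator_pair = A: positive_operator A + B: positive_operator B
  for A B :: "'e::complex_normed_vector \<Rightarrow> 'e antidual"
begin

sublocale K: hilbert "sum_space A B"
  unfolding sum_space_def
  by (rule hilbert_prod_space[OF A.hilbert_range_completion B.hilbert_range_completion])

lemma mem_sum_space:
  "x \<in> carrier (sum_space A B) \<longleftrightarrow>
    fst x \<in> carrier (range_completion A) \<and> snd x \<in> carrier (range_completion B)"
  by (simp add: sum_space_def prod_space_def mem_Times_iff)

lemma ip_sum_space:
  "ip (sum_space A B) x y =
    ip (range_completion A) (fst x) (fst y) + ip (range_completion B) (snd x) (snd y)"
  by (simp add: sum_space_def prod_space_def)

lemma dense_sum_space: "dense_in (sum_space A B) (range A \<times> range B)"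
  unfolding sum_space_def
  by (intro dense_in_prod_space A.dense_range B.dense_range A.R.pre_hilbert B.R.pre_hilbert)

lemma nrm_components_le:
  assumes "x \<in> carrier (sum_space A B)"
  shows "A.R.nrm (fst x) \<le> K.nrm x" "B.R.nrm (snd x) \<le> K.nrm x"
proof -
  have "(K.nrm x)\<^sup>2 = (A.R.nrm (fst x))\<^sup>2 + (B.R.nrm (snd x))\<^sup>2"
    using assms by (simp add: K.nrm_sq A.R.nrm_sq B.R.nrm_sq mem_sum_space ip_sum_space)
  then have "(A.R.nrm (fst x))\<^sup>2 \<le> (K.nrm x)\<^sup>2" "(B.R.nrm (snd x))\<^sup>2 \<le> (K.nrm x)\<^sup>2"
    by simp_all
  then show "A.R.nrm (fst x) \<le> K.nrm x" "B.R.nrm (snd x) \<le> K.nrm x"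
    using K.nrm_nonneg[OF assms] by - (erule (1) power2_le_imp_le)+
qed

lemma bounded_op_fst: "bounded_op (sum_space A B) (\<lambda>x. A.embed (fst x))"
proof -
  obtain C where C: "0 \<le> C" "\<And>\<xi>. \<xi> \<in> carrier (range_completion A) \<Longrightarrow> norm (A.embed \<xi>) \<le> C * A.R.nrm \<xi>"
    using A.embed_bounded by blast
  have "norm (A.embed (fst x)) \<le> C * K.nrm x" if x: "x \<in> carrier (sum_space A B)" for x
    using order_trans[OF C(2) mult_left_mono[OF nrm_components_le(1)[OF x] C(1)]] x
    by (simp add: mem_sum_space)
  moreover have "clinear_on (carrier (sum_space A B)) (\<lambda>x. A.embed (fst x))"
    using A.clinear_embed unfolding clinear_on_def
    by (auto simp: mem_sum_space scaleC_prod_def)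
  ultimately show ?thesis
    unfolding bounded_op_def K.hnorm_eq by blast
qed

lemma bounded_op_snd: "bounded_op (sum_space A B) (\<lambda>x. B.embed (snd x))"
proof -
  obtain C where C: "0 \<le> C" "\<And>\<xi>. \<xi> \<in> carrier (range_completion B) \<Longrightarrow> norm (B.embed \<xi>) \<le> C * B.R.nrm \<xi>"
    using B.embed_bounded by blast
  have "norm (B.embed (snd x)) \<le> C * K.nrm x" if x: "x \<in> carrier (sum_space A B)" for x
    using order_trans[OF C(2) mult_left_mono[OF nrm_components_le(2)[OF x] C(1)]] x
    by (simp add: mem_sum_space)
  moreover have "clinear_on (carrier (sum_space A B)) (\<lambda>x. B.embed (snd x))"
    using B.clinear_embed unfolding clinear_on_def
    by (auto simp: mem_sum_space scaleC_prod_def)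
  ultimately show ?thesis
    unfolding bounded_op_def K.hnorm_eq by blast
qed

text \<open>The sum of the two embeddings witnesses the existence that the choice presupposes, and
  density forces every other choice to agree with it on the carrier.\<close>

lemma J_op_eq:
  assumes x: "x \<in> carrier (sum_space A B)"
  shows "J_op A B x = A.embed (fst x) + B.embed (snd x)"
proof -
  have b: "bounded_op (sum_space A B) (\<lambda>x. A.embed (fst x) + B.embed (snd x))"
    by (rule bounded_op_add[OF bounded_op_fst bounded_op_snd])
  then have "\<exists>J. bounded_op (sum_space A B) J \<and> (\<forall>x y. J (A x, B y) = A x + B y)"
    by (intro exI[of _ "\<lambda>x. A.embed (fst x) + B.embed (snd x)"]) simp
  then have J: "bounded_op (sum_space A B) (J_op A B) \<and> (\<forall>x y. J_op A B (A x, B y) = A x + B y)"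
    unfolding J_op_def by (rule someI_ex)
  show ?thesis
    by (rule K.bounded_op_eq_on_dense[OF conjunct1[OF J] b dense_sum_space _ x]) (use J in auto)
qed

lemma J_tilde_eq:
  assumes x: "x \<in> carrier (sum_space A B)"
  shows "J_tilde A B x = A.embed (fst x)"
proof -
  have "\<exists>J. bounded_op (sum_space A B) J \<and> (\<forall>x y. J (A x, B y) = A x)"
    using bounded_op_fst by (intro exI[of _ "\<lambda>x. A.embed (fst x)"]) simp
  then have J: "bounded_op (sum_space A B) (J_tilde A B) \<and> (\<forall>x y. J_tilde A B (A x, B y) = A x)"
    unfolding J_tilde_def by (rule someI_ex)
  show ?thesis
    by (rule K.bounded_op_eq_on_dense[OF conjunct1[OF J] bounded_op_fst dense_sum_space _ x]) (use J in auto)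
qed

text \<open>\<open>embed\<close> is defined by pairing with \<open>A x\<close>, so the conjugate in
  \<open>j_E\<close> only exchanges the two arguments of the inner product.\<close>

lemma op_adjoint_J_op: "op_adjoint (sum_space A B) (J_op A B) (j_E x) = (A x, B x)"
proof (rule K.op_adjoint_eqI)
  show "(A x, B x) \<in> carrier (sum_space A B)"
    by (simp add: mem_sum_space A.A_mem B.A_mem)
  fix \<xi> assume \<xi>: "\<xi> \<in> carrier (sum_space A B)"
  then have m: "fst \<xi> \<in> carrier (range_completion A)" "snd \<xi> \<in> carrier (range_completion B)"
    by (simp_all add: mem_sum_space)
  show "ip (sum_space A B) (A x, B x) \<xi> = \<langle>j_E x, J_op A B \<xi>\<rangle>"
    using A.R.hermitian[OF m(1) A.A_mem, of x] B.R.hermitian[OF m(2) B.A_mem, of x]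
    by (simp add: ip_sum_space j_E.rep_eq J_op_eq[OF \<xi>] antidual_add_left A.embed_apply[OF m(1)]
        B.embed_apply[OF m(2)])
qed

lemma op_adjoint_J_tilde: "op_adjoint (sum_space A B) (J_tilde A B) (j_E x) = (A x, 0)"
proof (rule K.op_adjoint_eqI)
  show "(A x, 0) \<in> carrier (sum_space A B)"
    by (simp add: mem_sum_space A.A_mem B.R.zero_mem)
  fix \<xi> assume \<xi>: "\<xi> \<in> carrier (sum_space A B)"
  then have m: "fst \<xi> \<in> carrier (range_completion A)" "snd \<xi> \<in> carrier (range_completion B)"
    by (simp_all add: mem_sum_space)
  show "ip (sum_space A B) (A x, 0) \<xi> = \<langle>j_E x, J_tilde A B \<xi>\<rangle>"
    using A.R.hermitian[OF m(1) A.A_mem, of x] m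
    by (simp add: ip_sum_space j_E.rep_eq J_tilde_eq[OF \<xi>] A.embed_apply[OF m(1)])
qed

lemma operator_parallel_sum_apply:
  assumes z: "orth_proj (sum_space A B) (orth_compl (sum_space A B) (range (\<lambda>b. (A b, B b)))) (A x, 0) = z"
    and mem: "z \<in> carrier (sum_space A B)"
  shows "\<langle>operator_parallel_sum A B x, a\<rangle> = ip (sum_space A B) z (A a, 0)"
proof -
  have "operator_parallel_sum A B x = J_tilde A B z"
    using z by (simp add: operator_parallel_sum_def Let_def op_adjoint_J_tilde op_adjoint_J_op)
  moreover have "fst z \<in> carrier (range_completion A)" "snd z \<in> carrier (range_completion B)"
    using mem by (simp_all add: mem_sum_space)
  ultimately show ?thesis
    by (simp add: J_tilde_eq[OF mem] A.embed_apply ip_sum_space)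
qed

end

section \<open>The GNS-triple realised in the antidual\<close>

lift_definition left_action :: "'a::unital_banach_star_algebra \<Rightarrow> 'a antidual \<Rightarrow> 'a antidual"
  is "\<lambda>a \<phi> b. \<phi> (star a * b)"
  by (auto simp: mult_scaleC_right intro: bounded_linear_compose bounded_linear_mult_right)

context pos_functional
begin

text \<open>The definite description is meaningful only if \<open>f (star b * a)\<close> is
  continuous in \<open>b\<close>. This is what the Baire argument behind \<open>nrm_bounded\<close>
  provides.\<close>

lemma assoc_operator_apply: "\<langle>assoc_operator f a, b\<rangle> = f (star b * a)"
proof -
  obtain C where C: "0 \<le> C" "\<And>y. nrm y \<le> C * norm y" using nrm_bounded by blast
  have "cmod (f (star b * a)) \<le> (nrm a * C) * norm b" for b
    using order_trans[OF cauchy_schwarz[OF UNIV_I UNIV_I, of b a] mult_left_mono[OF C(2)]]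
    by (simp add: mult.assoc)
  then have "antidual_apply (Antidual (\<lambda>b. f (star b * a))) = (\<lambda>b. f (star b * a))"
    by (intro antidual_apply_Antidual)
      (simp_all add: star_add star_scaleC distrib_right mult_scaleC_left f_add f_scaleC)
  then have ex: "\<forall>b. \<langle>Antidual (\<lambda>b. f (star b * a)), b\<rangle> = f (star b * a)" by simp
  have "\<forall>b. \<langle>assoc_operator f a, b\<rangle> = f (star b * a)"
    unfolding assoc_operator_def
    by (rule theI[where a = "Antidual (\<lambda>b. f (star b * a))"]) (auto intro: antidual_eqI simp: ex)
  then show ?thesis by blast
qed

lemma positive_operator_assoc: "positive_operator (assoc_operator f)"
proof
  show "assoc_operator f (x + y) = assoc_operator f x + assoc_operator f y" for x y
    by (rule antidual_eqI) (simp add: assoc_operator_apply antidual_add_left distrib_left f_add)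
  show "assoc_operator f (c *\<^sub>C x) = c *\<^sub>C assoc_operator f x" for c x
    by (rule antidual_eqI)
      (simp add: assoc_operator_apply antidual_scaleC_left mult_scaleC_right f_scaleC)
  show "0 \<le> \<langle>assoc_operator f x, x\<rangle>" for x
    by (simp add: assoc_operator_apply f_pos)
  show "\<exists>C. \<forall>x. sqrt (Re \<langle>assoc_operator f x, x\<rangle>) \<le> C * norm x"
    using nrm_bounded unfolding nrm_def assoc_operator_apply by metis
qed

sublocale op: positive_operator "assoc_operator f"
  by (rule positive_operator_assoc)

lemma op_nrm: "op.E.nrm x = nrm x"
  by (simp add: op.E.nrm_def nrm_def assoc_operator_apply)

text \<open>The reason for \<open>star a\<close> in \<open>left_action\<close>: moving
  \<open>a\<close> across \<open>star b\<close> gives f(b* a x) =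
  \<open>\<langle>assoc_operator f x, star a * b\<rangle>\<close>.\<close>

lemma left_action_assoc: "left_action a (assoc_operator f x) = assoc_operator f (a * x)"
  by (rule antidual_eqI)
    (simp add: left_action.rep_eq assoc_operator_apply star_mult star_star mult.assoc)

lemma left_action_bound:
  obtains C where "0 \<le> C" "\<And>y. nrm (star a * y) \<le> C * nrm y"
  by (rule that[of "sqrt (2 * norm (star (star a) * star a))"]) (simp_all add: nrm_mult_le)

text \<open>By \<open>nrm_mult_le\<close> for \<open>star a\<close>, the dual norm of an error grows
  at most by the factor \<open>C\<close> under the action, so the action preserves the
  completion.\<close>

lemma approx_left_action:
  assumes "op.approx \<phi> X"
  shows "op.approx (left_action a \<phi>) (\<lambda>n. a * X n)"
proof -
  obtain C where C: "0 \<le> C" "\<And>y. nrm (star a * y) \<le> C * nrm y"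
    using left_action_bound by blast
  show ?thesis
    unfolding op.approx_def
  proof (intro allI impI)
    fix \<epsilon> :: real assume e: "0 < \<epsilon>"
    define \<delta> where "\<delta> = \<epsilon> / (C + 1)"
    have \<delta>: "0 < \<delta>" using e C by (simp add: \<delta>_def)
    have \<delta>C: "\<delta> * C \<le> \<epsilon>" using e C by (simp add: \<delta>_def field_simps)
    have "\<forall>\<^sub>F n in sequentially. \<forall>y. cmod \<langle>\<phi> - assoc_operator f (X n), y\<rangle> \<le> \<delta> * nrm y"
      using assms \<delta> unfolding op.approx_def op_nrm by blast
    then show "\<forall>\<^sub>F n in sequentially. \<forall>y. cmod \<langle>left_action a \<phi> - assoc_operator f (a * X n), y\<rangle>
        \<le> \<epsilon> * op.E.nrm y"
    proof eventually_elim
      case (elim n)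
      show ?case
      proof
        fix y
        have "\<langle>left_action a \<phi> - assoc_operator f (a * X n), y\<rangle> = \<langle>\<phi> - assoc_operator f (X n), star a * y\<rangle>"
          by (simp add: antidual_diff_left left_action.rep_eq flip: left_action_assoc)
        also have "cmod \<dots> \<le> \<delta> * nrm (star a * y)" using elim by blast
        also have "\<dots> \<le> \<delta> * (C * nrm y)" using C(2) \<delta> by (intro mult_left_mono) simp_all
        also have "\<dots> \<le> \<epsilon> * nrm y"
          using mult_right_mono[OF \<delta>C, of "nrm y"] by (simp add: mult.assoc)
        finally show "cmod \<langle>left_action a \<phi> - assoc_operator f (a * X n), y\<rangle> \<le> \<epsilon> * op.E.nrm y"
          by (simp add: op_nrm)
      qed
    qed
  qed
qed

lemma left_action_mem: "\<phi> \<in> carrier op.compl \<Longrightarrow> left_action a \<phi> \<in> carrier op.compl"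
  using approx_left_action op.carrier_compl by blast

lemma bounded_endo_left_action: "bounded_endo op.compl (left_action a)"
proof -
  obtain C where C: "0 \<le> C" "\<And>y. nrm (star a * y) \<le> C * nrm y"
    using left_action_bound by blast
  have "op.H.nrm (left_action a \<phi>) \<le> C * op.H.nrm \<phi>" if \<phi>: "\<phi> \<in> carrier op.compl" for \<phi>
  proof (rule op.compl_nrm_le[OF left_action_mem[OF \<phi>]])
    show "0 \<le> C * op.H.nrm \<phi>" using C \<phi> by simp
    fix y
    have "cmod \<langle>left_action a \<phi>, y\<rangle> \<le> op.H.nrm \<phi> * nrm (star a * y)"
      using op.compl_apply_le[OF \<phi>, of "star a * y"] by (simp add: left_action.rep_eq op_nrm)
    also have "\<dots> \<le> op.H.nrm \<phi> * (C * nrm y)"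
      using C(2) \<phi> by (intro mult_left_mono) simp_all
    finally show "cmod \<langle>left_action a \<phi>, y\<rangle> \<le> C * op.H.nrm \<phi> * op.E.nrm y"
      by (simp add: op_nrm mult_ac)
  qed
  moreover have "clinear_on (carrier op.compl) (left_action a)"
    unfolding clinear_on_def
    by (intro conjI ballI allI antidual_eqI)
      (simp_all add: left_action.rep_eq antidual_add_left antidual_scaleC_left)
  ultimately show ?thesis
    unfolding bounded_endo_def op.H.hnorm_eq using left_action_mem by blast
qed

lemma star_representation_left_action: "star_representation op.compl left_action"
  unfolding star_representation_def
proof (intro conjI allI ballI)
  show "bounded_endo op.compl (left_action a)" for a
    by (rule bounded_endo_left_action)
  fix a b :: 'a and c :: complex and \<phi>
  show "left_action (a + b) \<phi> = left_action a \<phi> + left_action b \<phi>"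
    by (rule antidual_eqI)
      (simp add: left_action.rep_eq antidual_add_left star_add distrib_right antidual_add_right)
  show "left_action (c *\<^sub>C a) \<phi> = c *\<^sub>C left_action a \<phi>"
    by (rule antidual_eqI)
      (simp add: left_action.rep_eq antidual_scaleC_left star_scaleC mult_scaleC_left antidual_scaleC_right)
  show "left_action (a * b) \<phi> = left_action a (left_action b \<phi>)"
    by (rule antidual_eqI) (simp add: left_action.rep_eq star_mult mult.assoc)
  fix \<psi> assume \<phi>: "\<phi> \<in> carrier op.compl" and "\<psi> \<in> carrier op.compl"
  then obtain Y where Y: "op.approx \<psi> Y" by (auto simp: op.carrier_compl)
  have "(\<lambda>n. \<langle>left_action (star a) \<phi>, Y n\<rangle>) = (\<lambda>n. \<langle>\<phi>, a * Y n\<rangle>)"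
    by (simp add: left_action.rep_eq star_star)
  then show "ip op.compl (left_action (star a) \<phi>) \<psi> = ip op.compl \<phi> (left_action a \<psi>)"
    using LIMSEQ_unique[OF op.ip_compl_lim[OF left_action_mem[OF \<phi>] Y]]
      op.ip_compl_lim[OF \<phi> approx_left_action[OF Y]] by metis
qed

text \<open>Writing A for the associated operator, its completion is itself a GNS space with cyclic
  vector A1, as (Aa | A1) = \<open>f a\<close>. This shows that the choice in
  \<open>gns_triple\<close> succeeds; the chosen triple may still be another one.\<close>

lemma is_gns_triple: "is_gns_triple f (gns_triple f)"
proof -
  have "is_gns_triple f (op.compl, left_action, assoc_operator f 1)"
    unfolding is_gns_triple_def
    using op.hilbert_compl star_representation_left_action op.A_mem_compl op.dense_compl
    by (simp add: left_action_assoc op.ip_compl_A op.A_mem_compl assoc_operator_apply)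
  then show ?thesis
    unfolding gns_triple_def by (rule someI[of "is_gns_triple f"])
qed

end

section \<open>Properties shared by all GNS-triples\<close>

locale gns =
  fixes f :: "'a::unital_banach_star_algebra \<Rightarrow> complex"
    and H :: "'v::complex_vector inner_space" and \<pi> \<zeta>
  assumes gns: "is_gns_triple f (H, \<pi>, \<zeta>)"
begin

sublocale hilbert H
  using gns by (intro hilbertI) (simp add: is_gns_triple_def)

lemma \<zeta>_mem: "\<zeta> \<in> carrier H"
  and dense: "dense_in H (range (\<lambda>a. \<pi> a \<zeta>))"
  and f_eq: "f a = ip H (\<pi> a \<zeta>) \<zeta>"
  and rep: "star_representation H \<pi>"
  using gns by (simp_all add: is_gns_triple_def)

lemma rep_mem: "x \<in> carrier H \<Longrightarrow> \<pi> a x \<in> carrier H"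
  using rep by (auto simp: star_representation_def bounded_endo_def)

lemma rep_clinear: "clinear_on (carrier H) (\<pi> a)"
  using rep by (simp add: star_representation_def bounded_endo_def)

lemma rep_add: "x \<in> carrier H \<Longrightarrow> \<pi> (a + b) x = \<pi> a x + \<pi> b x"
  and rep_scaleC: "x \<in> carrier H \<Longrightarrow> \<pi> (c *\<^sub>C a) x = c *\<^sub>C \<pi> a x"
  and rep_mult: "x \<in> carrier H \<Longrightarrow> \<pi> (a * b) x = \<pi> a (\<pi> b x)"
  and rep_star: "x \<in> carrier H \<Longrightarrow> y \<in> carrier H \<Longrightarrow> ip H (\<pi> (star a) x) y = ip H x (\<pi> a y)"
  using rep by (simp_all add: star_representation_def)

lemma rep_zero: "\<pi> a 0 = 0"
proof -
  have "\<pi> a (0 + 0) = \<pi> a 0 + \<pi> a 0"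
    using rep_clinear zero_mem unfolding clinear_on_def by blast
  then show ?thesis by simp
qed

lemma rep_diff: "x \<in> carrier H \<Longrightarrow> y \<in> carrier H \<Longrightarrow> \<pi> a (x - y) = \<pi> a x - \<pi> a y"
proof -
  assume x: "x \<in> carrier H" and y: "y \<in> carrier H"
  have "\<pi> a ((x - y) + y) = \<pi> a (x - y) + \<pi> a y"
    using rep_clinear diff_mem[OF x y] y unfolding clinear_on_def by blast
  then show ?thesis by simp
qed

lemma gram: "ip H (\<pi> a \<zeta>) (\<pi> b \<zeta>) = f (star b * a)"
  using rep_star[OF rep_mem[OF \<zeta>_mem] \<zeta>_mem, of b a] by (simp add: f_eq rep_mult \<zeta>_mem)

text \<open>Cyclicity forces this: \<open>\<pi> 1 \<zeta>\<close> and \<zeta> both have inner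
  product \<open>f (star a)\<close> with \<open>\<pi> a \<zeta>\<close>. It identifies the vector
  \<open>(\<zeta>\<^sub>f, 0)\<close> with the member at \<open>1\<close> of a family indexed by the
  algebra.\<close>

lemma rep_one: "\<pi> 1 \<zeta> = \<zeta>"
proof -
  have "ip H (\<pi> 1 \<zeta> - \<zeta>) y = 0" if range: "y \<in> range (\<lambda>a. \<pi> a \<zeta>)" for y
  proof -
    obtain a where y: "y = \<pi> a \<zeta>" using range by blast
    have "ip H \<zeta> (\<pi> a \<zeta>) = f (star a)"
      using rep_star[OF \<zeta>_mem \<zeta>_mem, of a] by (simp add: f_eq)
    then show ?thesis
      by (simp add: y diff_left rep_mem \<zeta>_mem gram)
  qed
  then have "\<pi> 1 \<zeta> - \<zeta> = 0"
    by (intro zero_if_orthogonal_to_dense[OF dense]) (auto simp: diff_mem rep_mem \<zeta>_mem)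
  then show ?thesis by simp
qed

end

theorem theorem5p4:
  fixes f g :: "'a::unital_banach_star_algebra \<Rightarrow> complex"
  assumes "positive_functional f" and "positive_functional g"
  shows "\<forall>a. functional_parallel_sum f g a =
    cnj \<langle>operator_parallel_sum (assoc_operator f) (assoc_operator g) 1, a\<rangle>"
proof
  fix a :: 'a
  interpret F: pos_functional f by unfold_locales fact
  interpret G: pos_functional g by unfold_locales fact
  interpret AB: positive_operator_pair "assoc_operator f" "assoc_operator g" ..
  obtain H\<^sub>f \<pi>\<^sub>f \<zeta>\<^sub>f where tf: "gns_triple f = (H\<^sub>f, \<pi>\<^sub>f, \<zeta>\<^sub>f)" by (cases "gns_triple f")
  obtain H\<^sub>g \<pi>\<^sub>g \<zeta>\<^sub>g where tg: "gns_triple g = (H\<^sub>g, \<pi>\<^sub>g, \<zeta>\<^sub>g)" by (cases "gns_triple g")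
  interpret f: gns f H\<^sub>f \<pi>\<^sub>f \<zeta>\<^sub>f using F.is_gns_triple by unfold_locales (simp add: tf)
  interpret g: gns g H\<^sub>g \<pi>\<^sub>g \<zeta>\<^sub>g using G.is_gns_triple by unfold_locales (simp add: tg)
  define A where "A = assoc_operator f"
  define B where "B = assoc_operator g"
  \<comment> \<open>The families below are indexed by the algebra: \<open>D\<^sub>1\<close> and
    \<open>D\<^sub>2\<close> run through the subspaces on whose complements Q and P project, and
    \<open>V\<^sub>1 1\<close>, \<open>V\<^sub>2 1\<close> are the vectors to be projected.\<close>
  define K where "K = prod_space H\<^sub>f H\<^sub>g"
  define L where "L = sum_space A B"
  define V\<^sub>1 :: "'a \<Rightarrow> 'a antidual \<times> 'a antidual" where "V\<^sub>1 = (\<lambda>b. (\<pi>\<^sub>f b \<zeta>\<^sub>f, 0))"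
  define D\<^sub>1 where "D\<^sub>1 = (\<lambda>b. (\<pi>\<^sub>f b \<zeta>\<^sub>f, \<pi>\<^sub>g b \<zeta>\<^sub>g))"
  define V\<^sub>2 :: "'a \<Rightarrow> 'a antidual \<times> 'a antidual" where "V\<^sub>2 = (\<lambda>b. (A b, 0))"
  define D\<^sub>2 where "D\<^sub>2 = (\<lambda>b. (A b, B b))"
  define \<pi> where "\<pi> = (\<lambda>a \<xi>. (\<pi>\<^sub>f a (fst \<xi>), \<pi>\<^sub>g a (snd \<xi>)))"
  interpret K: hilbert K
    unfolding K_def using f.gns g.gns by (intro hilbert_prod_space) (simp_all add: is_gns_triple_def)
  have memK: "x \<in> carrier K \<longleftrightarrow> fst x \<in> carrier H\<^sub>f \<and> snd x \<in> carrier H\<^sub>g" for x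
    by (simp add: K_def prod_space_def mem_Times_iff)
  have ipK: "ip K x y = ip H\<^sub>f (fst x) (fst y) + ip H\<^sub>g (snd x) (snd y)" for x y
    by (simp add: K_def prod_space_def)
  note memL = AB.mem_sum_space[folded A_def B_def, folded L_def]
  note ipL = AB.ip_sum_space[folded A_def B_def, folded L_def]
  have A_apply: "\<langle>A x, y\<rangle> = f (star y * x)" and B_apply: "\<langle>B x, y\<rangle> = g (star y * x)" for x y
    by (simp_all add: A_def B_def F.assoc_operator_apply G.assoc_operator_apply)
  note mem = f.rep_mem[OF f.\<zeta>_mem] g.rep_mem[OF g.\<zeta>_mem] f.zero_mem g.zero_mem
    F.op.A_mem[folded A_def] G.op.A_mem[folded B_def]
    F.op.R.zero_mem[folded A_def] G.op.R.zero_mem[folded B_def]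
  note ips = f.gram g.gram F.op.ip_range[folded A_def] G.op.ip_range[folded B_def] A_apply B_apply
    G.op.R.zero_left[folded B_def] g.zero_left
  have V\<^sub>1: "V\<^sub>1 b \<in> carrier K" and D\<^sub>1: "D\<^sub>1 b \<in> carrier K"
    and V\<^sub>2: "V\<^sub>2 b \<in> carrier L" and D\<^sub>2: "D\<^sub>2 b \<in> carrier L" for b
    by (simp_all add: V\<^sub>1_def D\<^sub>1_def V\<^sub>2_def D\<^sub>2_def memK memL mem)
  have lin1: "clinear_on UNIV D\<^sub>1"
    by (simp add: clinear_on_def D\<^sub>1_def scaleC_prod_def f.rep_add g.rep_add f.rep_scaleC
        g.rep_scaleC f.\<zeta>_mem g.\<zeta>_mem)
  have lin2: "clinear_on UNIV D\<^sub>2"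
    by (simp add: clinear_on_def D\<^sub>2_def scaleC_prod_def A_def B_def F.op.A_add G.op.A_add
        F.op.A_scaleC G.op.A_scaleC)
  have "hilbert L" unfolding L_def A_def B_def by (rule AB.K.hilbert_axioms)
  have "ip K (V\<^sub>1 a) (V\<^sub>1 b) = ip L (V\<^sub>2 a) (V\<^sub>2 b)"
    "ip K (V\<^sub>1 a) (D\<^sub>1 b) = ip L (V\<^sub>2 a) (D\<^sub>2 b)"
    "ip K (D\<^sub>1 a) (D\<^sub>1 b) = ip L (D\<^sub>2 a) (D\<^sub>2 b)" for a b
    by (simp_all add: V\<^sub>1_def D\<^sub>1_def V\<^sub>2_def D\<^sub>2_def ipK ipL ips mem)
  then obtain y z where y: "y \<in> orth_compl K (range D\<^sub>1)" and z: "z \<in> orth_compl L (range D\<^sub>2)"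
    and Qy: "orth_proj K (orth_compl K (range D\<^sub>1)) (V\<^sub>1 1) = y"
    and Pz: "orth_proj L (orth_compl L (range D\<^sub>2)) (V\<^sub>2 1) = z"
    and res: "V\<^sub>1 1 - y \<in> orth_compl K (orth_compl K (range D\<^sub>1))"
    and yz: "\<And>b. ip K y (V\<^sub>1 b) = ip L z (V\<^sub>2 b)"
    using projection_determined_by_gram[where V\<^sub>1 = V\<^sub>1 and D\<^sub>1 = D\<^sub>1 and V\<^sub>2 = V\<^sub>2 and D\<^sub>2 = D\<^sub>2
        and a = 1, OF K.hilbert_axioms \<open>hilbert L\<close> V\<^sub>1 D\<^sub>1 lin1 V\<^sub>2 D\<^sub>2 lin2] by blast
  have V\<^sub>1_one: "V\<^sub>1 1 = (\<zeta>\<^sub>f, 0)" by (simp add: V\<^sub>1_def f.rep_one)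
  have y_mem: "y \<in> carrier K" and z_mem: "z \<in> carrier L"
    using y z by (simp_all add: orth_compl_def)
  have \<pi>_mem: "\<pi> b x \<in> carrier K" if "x \<in> carrier K" for b x
    using that by (simp add: \<pi>_def memK f.rep_mem g.rep_mem)
  have \<pi>_star: "ip K (\<pi> (star b) x) w = ip K x (\<pi> b w)" if "x \<in> carrier K" "w \<in> carrier K" for b x w
    using that by (simp add: \<pi>_def memK ipK f.rep_star g.rep_star)
  define l where "l = V\<^sub>1 1 - y"
  have l_mem: "l \<in> carrier K" unfolding l_def by (rule K.diff_mem[OF V\<^sub>1 y_mem])
  \<comment> \<open>The range of \<open>D\<^sub>1\<close> is invariant under \<open>\<pi> a\<close>,
    hence its complement under \<open>\<pi> (star a)\<close>.\<close>
  have "\<pi> (star a) y \<in> orth_compl K (range D\<^sub>1)"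
  proof -
    have "\<pi> a (D\<^sub>1 b) = D\<^sub>1 (a * b)" for b
      by (simp add: \<pi>_def D\<^sub>1_def f.rep_mult g.rep_mult f.\<zeta>_mem g.\<zeta>_mem)
    then have "ip K (\<pi> (star a) y) (D\<^sub>1 b) = 0" for b
      using y \<pi>_star[OF y_mem D\<^sub>1, of a b] by (simp add: orth_compl_def)
    then show ?thesis using \<pi>_mem[OF y_mem] by (auto simp: orth_compl_def)
  qed
  then have "ip K l (\<pi> (star a) y) = 0"
    using res unfolding l_def by (simp add: orth_compl_def[of K "orth_compl K _"])
  then have "ip K (\<pi> a l) y = 0"
    using \<pi>_star[OF l_mem y_mem, of "star a"] by (simp add: star_star)
  moreover have "\<pi> a y = V\<^sub>1 a - \<pi> a l"
  proof -
    have "\<pi> a (V\<^sub>1 1) = V\<^sub>1 a"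
      by (simp add: V\<^sub>1_one) (simp add: \<pi>_def V\<^sub>1_def g.rep_zero)
    moreover have "\<pi> a (V\<^sub>1 1 - l) = \<pi> a (V\<^sub>1 1) - \<pi> a l"
      using V\<^sub>1[of 1] l_mem by (simp add: \<pi>_def memK f.rep_diff g.rep_diff)
    ultimately show ?thesis by (simp add: l_def)
  qed
  ultimately have "ip K (\<pi> a y) y = ip K (V\<^sub>1 a) y"
    by (simp add: K.diff_left V\<^sub>1 \<pi>_mem l_mem y_mem)
  \<comment> \<open>The conjugation of the theorem arises here: the vector indexed by
    \<open>a\<close> stands first in the inner product for \<open>f:g\<close>, but second in the
    pairing with \<open>a\<close>.\<close>
  also have "\<dots> = cnj (ip L z (V\<^sub>2 a))"
    unfolding yz[symmetric] by (rule K.hermitian[OF y_mem V\<^sub>1])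
  also have "ip L z (V\<^sub>2 a) = \<langle>operator_parallel_sum A B 1, a\<rangle>"
    using AB.operator_parallel_sum_apply[folded A_def B_def, folded L_def, of 1 z a] Pz z_mem
    by (simp add: V\<^sub>2_def D\<^sub>2_def)
  also have "ip K (\<pi> a y) y = functional_parallel_sum f g a"
    using Qy by (simp add: functional_parallel_sum_def tf tg Let_def K_def \<pi>_def D\<^sub>1_def V\<^sub>1_one)
  finally show "functional_parallel_sum f g a =
      cnj \<langle>operator_parallel_sum (assoc_operator f) (assoc_operator g) 1, a\<rangle>"
    by (simp only: A_def B_def)
qed

end
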